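(* Let $\mathfrak n\lhd A$ be nonzero and let $\mathfrak p_1,\mathfrak p_2,\mathfrak p_3$ be three distinct primes of $A$ dividing $\mathfrak n$ and coprime to $\mathfrak n/(\mathfrak p_1\mathfrak p_2\mathfrak p_3)$. Let $R$ be a coefficient ring and $f\in\mathcal H(\mathfrak n,R)$ such that $f^\ast(\mathfrak m)=0$ for every nonzero ideal $\mathfrak m$ not divisible by any of $\mathfrak p_1,\mathfrak p_2,\mathfrak p_3$. Then there exist $f_i\in\mathcal H(\mathfrak n/\mathfrak p_i,R)$, $1\le i\le 3$, such that $$s_{\mathfrak p_1,\mathfrak p_2}s_{\mathfrak p_1,\mathfrak p_3}s_{\mathfrak p_2,\mathfrak p_3}\cdot f=f_1|B_{\mathfrak p_1}+f_2|B_{\mathfrak p_2}+f_3|B_{\mathfrak p_3},$$ where $s_{\mathfrak p_i,\mathfrak p_j}=\gcd(|\mathfrak p_i|+1,|\mathfrak p_j|+1)$.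
   Context: $q$ is a power of a prime $p$, $A=\mathbb F_q[T]$, $F_\infty=\mathbb F_q((\pi))$, $\pi=T^{-1}$; ideals are identified with monic generators, $|\mathfrak m|=\#A/\mathfrak m$. A coefficient ring is a commutative ring $R$ with $p\in R^\times$ which is a quotient of a discrete valuation ring containing the $p$-th roots of unity. $\mathscr T$ is the Bruhat–Tits tree of $\mathrm{PGL}_2(F_\infty)$ (oriented edges $\mathrm{GL}_2(F_\infty)/Z(F_\infty)\mathcal I_\infty$, $\mathcal I_\infty$ the Iwahori subgroup, reversal $\bar e$ by right multiplication by $\begin{pmatrix}0&1\\\pi&0\end{pmatrix}$), with $(f|\gamma)(e)=f(\gamma e)$. An $R$-valued harmonic cochain is $f:E(\mathscr T)\to R$ with $f(\bar e)=-f(e)$ and $\sum_{t(e)=v}f(e)=0$ for all vertices $v$; $\mathcal H(\mathfrak n,R)$ is the group of those invariant under $\Gamma_0(\mathfrak n)=\{\begin{pmatrix}a&b\\c&d\end{pmatrix}\in\mathrm{GL}_2(A):c\in\mathfrak n\}$. Fix a nontrivial character $\eta_0:\mathbb F_p\to R^\times$ and put $\eta(\sum a_i\pi^i)=\eta_0(\mathrm{Tr}_{\mathbb F_q/\mathbb F_p}(a_1))$. The Fourier coefficients are $f^\ast(\mathfrak m)=q^{-1-\deg\mathfrak m}\sum_{u\in(\pi)/(\pi^{2+\deg\mathfrak m})}f\left(\begin{pmatrix}\pi^{2+\deg\mathfrak m}&u\\0&1\end{pmatrix}\right)\eta(-\mathfrak m u)$. For a nonzero ideal $\mathfrak m$,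 $B_\mathfrak m=\begin{pmatrix}\mathfrak m&0\\0&1\end{pmatrix}$; if $f\in\mathcal H(\mathfrak n',R)$ then $f|B_\mathfrak m\in\mathcal H(\mathfrak n'\mathfrak m,R)$. *)

theory Defs
  imports
    "HOL-Analysis.Analysis"
    "HOL-Computational_Algebra.Computational_Algebra"
begin

text \<open>
  The finite field \<open>F_q\<close> is a type \<open>'k :: {field, finite}\<close>, so that \<open>q = CARD('k)\<close> and
  \<open>p = CHAR('k)\<close>; \<open>A\<close> is \<open>'k poly\<close>, and \<open>F_\<infinity> = F_q((\<pi>))\<close> is \<open>'k fls\<close> with \<open>\<pi> = fls_X\<close>.
  A nonzero ideal of \<open>A\<close> is represented by its monic generator.
\<close>

definition monic :: "'k::field poly \<Rightarrow> bool" where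
  "monic m \<longleftrightarrow> lead_coeff m = 1"

definition ideal_norm :: "'k::field poly \<Rightarrow> nat" where
  "ideal_norm m = card (UNIV // {(a, b). m dvd a - b})"

text \<open>The embedding of \<open>A\<close> into \<open>F_\<infinity>\<close> sends \<open>T\<close> to \<open>\<pi>\<^sup>-\<^sup>1\<close>.\<close>

definition emb :: "'k::field poly \<Rightarrow> 'k fls" where
  "emb a = poly (map_poly fls_const a) fls_X_inv"

definition mat2 :: "'a::zero \<Rightarrow> 'a \<Rightarrow> 'a \<Rightarrow> 'a \<Rightarrow> 'a^2^2" where
  "mat2 a b c d = vector [vector [a, b], vector [c, d]]"

definition emb_mat :: "'k::field poly^2^2 \<Rightarrow> 'k fls^2^2" where
  "emb_mat M = (\<chi> i j. emb (M $ i $ j))"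

definition GL2 :: "('a::comm_ring_1^2^2) set" where
  "GL2 = {M. invertible M}"

definition Gamma0 :: "'k::field poly \<Rightarrow> ('k poly^2^2) set" where
  "Gamma0 n = {M \<in> GL2. n dvd M $ 2 $ 1}"


subsection \<open>The Bruhat--Tits tree\<close>

definition integers_inf :: "('k::field fls) set" where
  "integers_inf = {x. x = 0 \<or> fls_subdegree x \<ge> 0}"

text \<open>\<open>GL\<^sub>2(O_\<infinity>)\<close>: integral entries and a determinant which is a unit of \<open>O_\<infinity>\<close>.\<close>

definition maximal_compact :: "('k::field fls^2^2) set" where
  "maximal_compact =
     {M. (\<forall>i j. M $ i $ j \<in> integers_inf) \<and> det M \<noteq> 0 \<and> fls_subdegree (det M) = 0}"

definition iwahori :: "('k::field fls^2^2) set" where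
  "iwahori = {M \<in> maximal_compact. \<exists>x\<in>integers_inf. M $ 2 $ 1 = fls_X * x}"

definition scalars :: "('k::field fls^2^2) set" where
  "scalars = {mat z | z. z \<noteq> 0}"

text \<open>
  Oriented edges are the left cosets of \<open>Z(F_\<infinity>) \<I>_\<infinity>\<close> and vertices the left cosets of
  \<open>Z(F_\<infinity>) GL\<^sub>2(O_\<infinity>)\<close>, both as sets of matrices.
\<close>

definition edge_coset :: "'k::field fls^2^2 \<Rightarrow> ('k fls^2^2) set" where
  "edge_coset g = {g ** z ** h | z h. z \<in> scalars \<and> h \<in> iwahori}"

definition vertex_coset :: "'k::field fls^2^2 \<Rightarrow> ('k fls^2^2) set" where
  "vertex_coset g = {g ** z ** h | z h. z \<in> scalars \<and> h \<in> maximal_compact}"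

definition edges :: "('k::field fls^2^2) set set" where
  "edges = edge_coset ` GL2"

definition vertices :: "('k::field fls^2^2) set set" where
  "vertices = vertex_coset ` GL2"

definition reverse_edge :: "('k::field fls^2^2) set \<Rightarrow> ('k fls^2^2) set" where
  "reverse_edge e = (\<lambda>g. g ** mat2 0 1 fls_X 0) ` e"

text \<open>
  The origin is given by the projection of cosets.  Taking this projection to be the terminus
  instead would not change the notion of a harmonic cochain, because cochains are alternating.
\<close>

definition origin :: "('k::field fls^2^2) set \<Rightarrow> ('k fls^2^2) set" where
  "origin e = (\<Union>g\<in>e. vertex_coset g)"

definition terminus :: "('k::field fls^2^2) set \<Rightarrow> ('k fls^2^2) set" where
  "terminus e = origin (reverse_edge e)"

definition act :: "'k::field fls^2^2 \<Rightarrow> ('k fls^2^2) set \<Rightarrow> ('k fls^2^2) set" where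
  "act \<gamma> e = (\<lambda>g. \<gamma> ** g) ` e"


subsection \<open>Harmonic cochains\<close>

text \<open>
  Cochains are functions on all sets of matrices of which only the values on \<open>edges\<close> are
  meaningful; equality of cochains means equality on \<open>edges\<close>.
\<close>

definition slash ::
    "(('k::field fls^2^2) set \<Rightarrow> 'r) \<Rightarrow> 'k fls^2^2 \<Rightarrow> ('k fls^2^2) set \<Rightarrow> 'r" where
  "slash f \<gamma> e = f (act \<gamma> e)"

definition harmonic_cochain ::
    "(('k::field fls^2^2) set \<Rightarrow> 'r::comm_ring_1) \<Rightarrow> bool" where
  "harmonic_cochain f \<longleftrightarrow>
     (\<forall>e\<in>edges. f (reverse_edge e) = - f e) \<and>
     (\<forall>v\<in>vertices. (\<Sum>e\<in>{e \<in> edges. terminus e = v}. f e) = 0)"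

definition harmonic_cochains ::
    "'k::field poly \<Rightarrow> (('k fls^2^2) set \<Rightarrow> 'r::comm_ring_1) set" where
  "harmonic_cochains n =
     {f. harmonic_cochain f \<and>
         (\<forall>\<gamma>\<in>Gamma0 n. \<forall>e\<in>edges. slash f (emb_mat \<gamma>) e = f e)}"

definition B_mat :: "'k::field poly \<Rightarrow> 'k fls^2^2" where
  "B_mat m = mat2 (emb m) 0 0 1"


subsection \<open>Coefficient rings\<close>

text \<open>
  A domain is a discrete valuation ring if it is the valuation ring of a normalized discrete
  valuation \<open>v\<close> of its fraction field; \<open>v 0\<close> is irrelevant.
\<close>

definition discrete_valuation_ring :: "'d::idom itself \<Rightarrow> bool" where
  "discrete_valuation_ring _ \<longleftrightarrow>
     (\<exists>v :: 'd fract \<Rightarrow> int.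
        v ` (- {0}) = UNIV \<and>
        (\<forall>x y. x \<noteq> 0 \<longrightarrow> y \<noteq> 0 \<longrightarrow> v (x * y) = v x + v y) \<and>
        (\<forall>x y. x \<noteq> 0 \<longrightarrow> y \<noteq> 0 \<longrightarrow> x + y \<noteq> 0 \<longrightarrow> v (x + y) \<ge> min (v x) (v y)) \<and>
        range (to_fract :: 'd \<Rightarrow> 'd fract) = {x. x = 0 \<or> v x \<ge> 0})"

definition unital_ring_hom :: "('d::comm_ring_1 \<Rightarrow> 'r::comm_ring_1) \<Rightarrow> bool" where
  "unital_ring_hom \<phi> \<longleftrightarrow>
     \<phi> 1 = 1 \<and> (\<forall>x y. \<phi> (x + y) = \<phi> x + \<phi> y) \<and> (\<forall>x y. \<phi> (x * y) = \<phi> x * \<phi> y)"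

text \<open>
  The type \<open>'r\<close> is a coefficient ring for the prime \<open>p\<close>, presented as a quotient by the surjection
  \<open>\<phi>\<close> from a discrete valuation ring which contains all \<open>p\<close> of the \<open>p\<close>-th roots of unity.
\<close>

definition coefficient_ring :: "nat \<Rightarrow> ('d::idom \<Rightarrow> 'r::comm_ring_1) \<Rightarrow> bool" where
  "coefficient_ring p \<phi> \<longleftrightarrow>
     (of_nat p :: 'r) dvd 1 \<and>
     discrete_valuation_ring TYPE('d) \<and>
     card {\<zeta> :: 'd. \<zeta> ^ p = 1} = p \<and>
     unital_ring_hom \<phi> \<and> surj \<phi>"

definition unit_inverse :: "'r::comm_ring_1 \<Rightarrow> 'r" where
  "unit_inverse x = (THE y. x * y = 1)"


subsection \<open>Fourier coefficients\<close>

definition prime_field :: "('k::field) set" where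
  "prime_field = range of_nat"

text \<open>The Galois group of \<open>F_q / F_p\<close>, \<open>q = p\<^sup>n\<close>, consists of the \<open>n\<close> powers of the Frobenius.\<close>

definition abs_trace :: "'k::{field, finite} \<Rightarrow> 'k" where
  "abs_trace x = (\<Sum>i < (THE n. CARD('k) = CHAR('k) ^ n). x ^ (CHAR('k) ^ i))"

definition nontrivial_character :: "('k::field \<Rightarrow> 'r::comm_ring_1) \<Rightarrow> bool" where
  "nontrivial_character \<eta>\<^sub>0 \<longleftrightarrow>
     (\<forall>x\<in>prime_field. \<eta>\<^sub>0 x dvd 1) \<and>
     (\<forall>x\<in>prime_field. \<forall>y\<in>prime_field. \<eta>\<^sub>0 (x + y) = \<eta>\<^sub>0 x * \<eta>\<^sub>0 y) \<and>
     (\<exists>x\<in>prime_field. \<eta>\<^sub>0 x \<noteq> 1)"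

definition eta :: "('k::{field, finite} \<Rightarrow> 'r) \<Rightarrow> 'k fls \<Rightarrow> 'r" where
  "eta \<eta>\<^sub>0 x = \<eta>\<^sub>0 (abs_trace (fls_nth x 1))"

text \<open>
  The quotient \<open>(\<pi>)/(\<pi>\<^sup>N)\<close> is represented by the Laurent polynomials supported in
  degrees \<open>1, \<dots>, N - 1\<close>.
\<close>

definition pi_residues :: "nat \<Rightarrow> ('k::field fls) set" where
  "pi_residues N = {u. \<forall>i. fls_nth u i \<noteq> 0 \<longrightarrow> 1 \<le> i \<and> i < int N}"

definition fourier_coeff ::
    "('k \<Rightarrow> 'r) \<Rightarrow> (('k::{field, finite} fls^2^2) set \<Rightarrow> 'r::comm_ring_1) \<Rightarrow> 'k poly \<Rightarrow> 'r" where
  "fourier_coeff \<eta>\<^sub>0 f m =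
     unit_inverse (of_nat (CARD('k) ^ (1 + degree m))) *
     (\<Sum>u\<in>pi_residues (2 + degree m).
        f (edge_coset (mat2 (fls_X ^ (2 + degree m)) u 0 1)) * eta \<eta>\<^sub>0 (- emb m * u))"

end

theory Submission
  imports Defs
begin

text \<open>
  Let \<open>U\<^sub>i\<close> be the translations by \<open>p\<^sub>i\<^sup>-\<^sup>1 A\<close>, \<open>q\<^sub>i = |p\<^sub>i|\<close>, and let \<open>D\<^sub>i = q\<^sub>i (1 - e\<^sub>i)\<close>, where
  \<open>e\<^sub>i\<close> averages over \<open>U\<^sub>i\<close> modulo translations by \<open>A\<close>.  A cochain of level \<open>n\<close> which is invariant under \<open>U\<^sub>i\<close> is
  of the form \<open>g|B\<close> with \<open>g\<close> of level \<open>n/p\<^sub>i\<close>, and by Fourier inversion the vanishing hypothesis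
  says precisely that \<open>D\<^sub>1 D\<^sub>2 D\<^sub>3 f = 0\<close>.

  The translates of a cochain \<open>F\<close> of level \<open>n\<close> under \<open>B\<^sup>-\<^sup>1 \<Gamma>\<^sub>0(n/p\<^sub>i) B\<close> are indexed by the
  projective line over \<open>A/p\<^sub>i\<close>; let \<open>T\<^sub>i F\<close> be their sum, which is invariant under \<open>U\<^sub>i\<close>.  If \<open>F\<close> is
  the point \<open>0\<close>, then \<open>D\<^sub>i F = q\<^sub>i [0] + [\<infinity>] - T\<^sub>i F\<close>.  Applying elements which fix \<open>0\<close> and move \<open>\<infinity>\<close>
  to this vector yields \<open>[\<infinity>] - [0]\<close>, hence \<open>(q\<^sub>i + 1) F - T\<^sub>i F\<close> is a combination of
  translates of \<open>D\<^sub>i F\<close>.  The lower unipotent factors of the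
  translating matrices can be chosen \<open>p\<^sub>j\<close>-adically close to \<open>1\<close>, so that translating commutes
  with \<open>D\<^sub>j\<close>.  Therefore \<open>(q\<^sub>1 + 1 - T\<^sub>1) (q\<^sub>2 + 1 - T\<^sub>2) f\<close> is killed by \<open>D\<^sub>3\<close>, that is, it is
  invariant under \<open>U\<^sub>3\<close>, and \<open>(q\<^sub>1 + 1) (q\<^sub>2 + 1) f\<close> has a decomposition as desired.  So
  have the other two such products, and the product of the three gcds is an integral
  combination of the three products.
\<close>

section \<open>The trace of a finite field\<close>

lemma prime_CHAR_finite: "prime CHAR('k::{field,finite})"
  by (rule prime_CHAR_semidom) (rule finite_imp_CHAR_pos, rule finite)

text \<open>Multiplication by a nonzero \<open>x\<close> permutes the nonzero elements; comparing
  their product before and after gives \<open>x ^ (CARD('k) - 1) = 1\<close>.\<close>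

lemma power_CARD_eq_same:
  fixes x :: "'k::{field,finite}"
  shows "x ^ CARD('k) = x"
proof (cases "x = 0")
  case False
  have "(\<Prod>y\<in>UNIV-{0}. x * y) = (\<Prod>y\<in>UNIV-{0::'k}. y)"
    by (rule prod.reindex_bij_witness[of _ "\<lambda>y. y / x" "\<lambda>y. x * y"]) (use False in auto)
  then have "x ^ (CARD('k) - 1) = 1"
    by (simp add: prod.distrib)
  then show ?thesis
    using power_eq_if[of x "CARD('k)"] by auto
qed (auto simp: finite_UNIV_card_ge_0)

lemma prime_field_add: "x \<in> prime_field \<Longrightarrow> y \<in> prime_field \<Longrightarrow> x + y \<in> prime_field"
  unfolding prime_field_def by (auto simp flip: of_nat_add)

lemma prime_field_mult: "x \<in> prime_field \<Longrightarrow> y \<in> prime_field \<Longrightarrow> x * y \<in> prime_field"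
  unfolding prime_field_def by (auto simp flip: of_nat_mult)

lemma prime_field_0: "0 \<in> prime_field" and prime_field_1: "1 \<in> prime_field"
  unfolding prime_field_def by (metis of_nat_0 rangeI) (metis of_nat_1 rangeI)

lemma prime_field_uminus:
  fixes x :: "'k::{field,finite}"
  assumes "x \<in> prime_field" shows "- x \<in> prime_field"
proof -
  have "of_nat (CHAR('k) - 1) + (1::'k) = of_nat (CHAR('k))"
    using prime_gt_0_nat[OF prime_CHAR_finite[where 'k='k]]
    by (metis of_nat_Suc Suc_diff_1 add.commute)
  then have "(-1::'k) = of_nat (CHAR('k) - 1)"
    by (metis of_nat_CHAR add.commute add_eq_0_iff)
  then have "(-1::'k) \<in> prime_field"
    by (simp add: prime_field_def)
  from prime_field_mult[OF this assms] show ?thesis by simp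
qed

lemma prime_field_diff:
  fixes x :: "'k::{field,finite}"
  shows "x \<in> prime_field \<Longrightarrow> y \<in> prime_field \<Longrightarrow> x - y \<in> prime_field"
  using prime_field_add[OF _ prime_field_uminus, of x y] by simp

lemma prime_field_power: "x \<in> prime_field \<Longrightarrow> x ^ n \<in> prime_field"
  by (induction n) (auto intro: prime_field_mult prime_field_1)

text \<open>By \<open>power_CARD_eq_same\<close> the inverse of a nonzero element is its power with
  exponent \<open>CARD('k) - 2\<close>, and the prime field is closed under powers.\<close>

lemma prime_field_inverse:
  fixes x :: "'k::{field,finite}"
  assumes "x \<in> prime_field" shows "inverse x \<in> prime_field"
proof (cases "x = 0")
  case False
  have "CARD('k) \<ge> card {0, 1::'k}"
    by (intro card_mono) auto
  then have "CARD('k) = Suc (Suc (CARD('k) - 2))"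
    by simp
  then have "x * x * x ^ (CARD('k) - 2) = x"
    using power_CARD_eq_same[of x] by (metis power_Suc mult.assoc)
  then have "inverse x = x ^ (CARD('k) - 2)"
    using False by (metis inverse_unique mult.assoc mult_cancel_left mult.right_neutral)
  then show ?thesis using prime_field_power[OF assms] by simp
qed (use assms in simp)

lemma prime_field_eq_image: "(prime_field :: 'k::{field,finite} set) = of_nat ` {..<CHAR('k)}"
proof -
  have "(of_nat n :: 'k) = of_nat (n mod CHAR('k))" for n
  proof -
    have "(of_nat (CHAR('k) * (n div CHAR('k)) + n mod CHAR('k)) :: 'k) = of_nat (n mod CHAR('k))"
      by (simp only: of_nat_add of_nat_mult of_nat_CHAR) simp
    then show ?thesis by simp
  qed
  moreover have "n mod CHAR('k) < CHAR('k)" for n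
    using prime_gt_0_nat[OF prime_CHAR_finite[where 'k='k]] by simp
  ultimately show ?thesis
    unfolding prime_field_def by (metis (no_types, lifting) image_subset_iff image_eqI lessThan_iff
        rangeI subset_antisym)
qed

lemma card_prime_field: "card (prime_field :: 'k::{field,finite} set) = CHAR('k)"
proof -
  have *: "i = j" if "i \<le> j" "j < CHAR('k)" "(of_nat i :: 'k) = of_nat j" for i j
  proof -
    have "(of_nat (j - i) :: 'k) = 0"
      using that by (simp add: of_nat_diff)
    then have "CHAR('k) dvd j - i"
      by (simp add: of_nat_eq_0_iff_char_dvd)
    moreover have "j - i < CHAR('k)" using that by linarith
    ultimately have "j - i = 0" using nat_dvd_not_less by blast
    then show ?thesis using that by simp
  qed
  have "inj_on (of_nat :: nat \<Rightarrow> 'k) {..<CHAR('k)}"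
    unfolding inj_on_def
  proof (intro ballI impI)
    fix i j assume "i \<in> {..<CHAR('k)}" "j \<in> {..<CHAR('k)}" "(of_nat i :: 'k) = of_nat j"
    then show "i = j" using *[of i j] *[of j i] by (cases "i \<le> j") auto
  qed
  then show ?thesis
    by (simp add: prime_field_eq_image card_image)
qed

text \<open>A subspace over the prime field of maximal order among those of \<open>p\<close>-power order is everything.\<close>

lemma CARD_eq_CHAR_power: "\<exists>n. CARD('k::{field,finite}) = CHAR('k) ^ n"
proof -
  let ?p = "CHAR('k)"
  define sub where "sub H \<longleftrightarrow> 0 \<in> H \<and> (\<forall>x\<in>H. \<forall>y\<in>H. x + y \<in> H) \<and>
      (\<forall>a\<in>prime_field. \<forall>x\<in>H. a * x \<in> H)" for H :: "'k set"
  define good where "good H \<longleftrightarrow> sub H \<and> (\<exists>n. card H = ?p ^ n)" for H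
  have "good {0}"
    unfolding good_def sub_def by (auto intro: exI[of _ 0])
  moreover have "\<forall>H. good H \<longrightarrow> card H < Suc CARD('k)"
    by (simp add: card_mono le_imp_less_Suc)
  ultimately obtain H where H: "good H" and max: "\<And>H'. good H' \<Longrightarrow> card H' \<le> card H"
    using ex_has_greatest_nat[of good "{0}" card "Suc CARD('k)"] by blast
  from H have add: "x \<in> H \<Longrightarrow> y \<in> H \<Longrightarrow> x + y \<in> H"
    and scale: "a \<in> prime_field \<Longrightarrow> x \<in> H \<Longrightarrow> a * x \<in> H" and zero: "0 \<in> H" for x y a
    unfolding good_def sub_def by auto
  have diff: "x - y \<in> H" if "x \<in> H" "y \<in> H" for x y
    using add[OF that(1) scale[OF prime_field_uminus[OF prime_field_1] that(2)]] by simp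
  have "H = UNIV"
  proof (rule ccontr)
    assume "H \<noteq> UNIV"
    then obtain x where x: "x \<notin> H" by auto
    \<comment> \<open>Adjoining the line through an \<open>x\<close> outside \<open>H\<close>
      multiplies the order by \<open>CHAR('k)\<close>, which contradicts maximality.\<close>
    define g where "g = (\<lambda>(h, a). h + a * x)"
    have "inj_on g (H \<times> prime_field)"
    proof (rule inj_onI, clarify)
      fix h a h' a'
      assume h: "h \<in> H" "a \<in> prime_field" "h' \<in> H" "a' \<in> prime_field" "g (h, a) = g (h', a')"
      have eq: "(a - a') * x = h' - h"
        using h(5) by (simp add: g_def algebra_simps)
      have "a = a'"
      proof (rule ccontr)
        assume "a \<noteq> a'"
        then have "x = inverse (a - a') * (h' - h)"
          using eq by (simp add: field_simps)
        then show False
          using x h scale[OF prime_field_inverse[OF prime_field_diff] diff] by metis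
      qed
      with eq show "h = h' \<and> a = a'" by simp
    qed
    then have card: "card (g ` (H \<times> prime_field)) = card H * ?p"
      by (simp add: card_image card_cartesian_product card_prime_field)
    have "sub (g ` (H \<times> prime_field))"
      unfolding sub_def
    proof (intro conjI ballI)
      show "0 \<in> g ` (H \<times> prime_field)"
        by (rule image_eqI[of _ _ "(0, 0)"]) (auto simp: g_def zero prime_field_0)
    next
      fix y z assume "y \<in> g ` (H \<times> prime_field)" "z \<in> g ` (H \<times> prime_field)"
      then obtain h a h' a' where "h \<in> H" "a \<in> prime_field" "h' \<in> H" "a' \<in> prime_field"
        "y = g (h, a)" "z = g (h', a')" by auto
      then show "y + z \<in> g ` (H \<times> prime_field)"
        by (intro image_eqI[of _ _ "(h + h', a + a')"])
           (auto simp: g_def algebra_simps add prime_field_add)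
    next
      fix b y :: 'k assume "b \<in> prime_field" "y \<in> g ` (H \<times> prime_field)"
      then obtain h a where "h \<in> H" "a \<in> prime_field" "y = g (h, a)" by auto
      then show "b * y \<in> g ` (H \<times> prime_field)" using \<open>b \<in> prime_field\<close>
        by (intro image_eqI[of _ _ "(b * h, b * a)"])
           (auto simp: g_def algebra_simps scale prime_field_mult)
    qed
    moreover obtain n where n: "card H = ?p ^ n" using H unfolding good_def by auto
    moreover have "card (g ` (H \<times> prime_field)) = ?p ^ Suc n"
      by (simp add: card n)
    ultimately have "good (g ` (H \<times> prime_field))" unfolding good_def by blast
    from max[OF this] have "card H * ?p \<le> card H" by (simp add: card)
    moreover have "card H > 0" using zero by (simp add: card_gt_0_iff) auto
    ultimately show False
      using prime_gt_1_nat[OF prime_CHAR_finite[where 'k='k]] by simp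
  qed
  with H show ?thesis unfolding good_def by auto
qed

text \<open>The exponent is unique because \<open>CHAR('k) > 1\<close>, so the definite description
  in \<open>abs_trace\<close> really denotes the degree over the prime field.\<close>

lemma CARD_eq_CHAR_power_THE:
  "CARD('k::{field,finite}) = CHAR('k) ^ (THE n. CARD('k) = CHAR('k) ^ n)"
proof -
  obtain n where n: "CARD('k) = CHAR('k) ^ n"
    using CARD_eq_CHAR_power by blast
  then have "(THE n. CARD('k) = CHAR('k) ^ n) = n"
    using prime_gt_1_nat[OF prime_CHAR_finite[where 'k='k]]
    by (intro the_equality) (auto simp: power_inject_exp)
  then show ?thesis using n by metis
qed

text \<open>The prime field consists of roots of a polynomial of degree at most
  \<open>CHAR('k)\<close> and already has \<open>CHAR('k)\<close> elements, so there are no further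
  roots.\<close>

lemma prime_field_iff_power_CHAR:
  fixes x :: "'k::{field,finite}"
  shows "x ^ CHAR('k) = x \<longleftrightarrow> x \<in> prime_field"
proof -
  let ?p = "CHAR('k)"
  let ?P = "monom 1 ?p - monom 1 1 :: 'k poly"
  have p: "?p > 1" using prime_gt_1_nat[OF prime_CHAR_finite] .
  have "poly.coeff ?P ?p \<noteq> 0" using p by simp
  then have nz: "?P \<noteq> 0" by (metis coeff_0)
  have "card {x. poly ?P x = 0} \<le> degree ?P"
    using card_poly_roots_bound[OF nz] .
  also have "\<dots> \<le> ?p" using p by (intro degree_diff_le) (auto simp: degree_monom_eq)
  finally have le: "card {x. poly ?P x = 0} \<le> card (prime_field :: 'k set)"
    by (simp add: card_prime_field)
  have "(of_nat n :: 'k) ^ ?p = of_nat n" for n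
    by (induction n) (use p in \<open>simp_all add: freshmans_dream[OF prime_CHAR_finite refl] power_0_left\<close>)
  then have "prime_field \<subseteq> {x. poly ?P x = 0}"
    by (auto simp: prime_field_def poly_monom)
  then have "prime_field = {x. poly ?P x = 0}"
    using le by (intro card_seteq) auto
  then show ?thesis by (auto simp: poly_monom)
qed

lemma abs_trace_add: "abs_trace (x + y) = abs_trace x + abs_trace (y::'k::{field,finite})"
  unfolding abs_trace_def
  unfolding freshmans_dream'[OF prime_CHAR_finite refl] by (rule sum.distrib)

text \<open>Frobenius permutes the summands of the trace cyclically, as the last one returns to
  \<open>x\<close> by \<open>power_CARD_eq_same\<close>. The trace is therefore fixed by
  Frobenius.\<close>

lemma abs_trace_in_prime_field: "abs_trace (x::'k::{field,finite}) \<in> prime_field"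
proof -
  let ?p = "CHAR('k)"
  define n where "n = (THE n. CARD('k) = ?p ^ n)"
  have n: "CARD('k) = ?p ^ n" unfolding n_def by (rule CARD_eq_CHAR_power_THE)
  have "abs_trace x ^ ?p = (\<Sum>i<n. x ^ (?p ^ Suc i))"
    unfolding abs_trace_def n_def[symmetric]
    unfolding freshmans_dream_sum[OF prime_CHAR_finite refl]
    by (intro sum.cong refl) (simp only: power_mult[symmetric] power_Suc mult.commute)
  also have "\<dots> = (\<Sum>i<n. x ^ (?p ^ i))"
  proof -
    have "x ^ (?p ^ 0) + (\<Sum>i<n. x ^ (?p ^ Suc i)) = (\<Sum>i<n. x ^ (?p ^ i)) + x ^ (?p ^ n)"
      using sum.lessThan_Suc_shift[of "\<lambda>i. x ^ (?p ^ i)" n] unfolding sum.lessThan_Suc by (rule sym)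
    also have "x ^ (?p ^ n) = x ^ (?p ^ 0)"
      using power_CARD_eq_same[of x] unfolding n by (simp only: power_0 power_one_right)
    finally show ?thesis
      by (simp only: add.commute[of _ "x ^ (?p ^ 0)"] add_left_cancel)
  qed
  finally have "abs_trace x ^ ?p = abs_trace x"
    unfolding abs_trace_def n_def[symmetric] .
  then show ?thesis by (simp only: prime_field_iff_power_CHAR)
qed

text \<open>The trace is a polynomial function with linear coefficient 1 and degree at most
  \<open>CARD('k)\<close> divided by \<open>CHAR('k)\<close>, too small for every element to be a
  root.\<close>

lemma abs_trace_nonzero: "\<exists>x::'k::{field,finite}. abs_trace x \<noteq> 0"
proof (rule ccontr)
  let ?p = "CHAR('k)"
  assume "\<not> ?thesis"
  then have zero: "abs_trace x = 0" for x :: 'k by auto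
  have p: "?p > 1" using prime_gt_1_nat[OF prime_CHAR_finite] .
  define n where "n = (THE n. CARD('k) = ?p ^ n)"
  have n: "CARD('k) = ?p ^ n" unfolding n_def by (rule CARD_eq_CHAR_power_THE)
  have "CARD('k) \<ge> card {0, 1::'k}" by (intro card_mono) auto
  then have "n \<noteq> 0" using n by (cases n) auto
  then obtain l where l: "n = Suc l" by (cases n) auto
  let ?P = "\<Sum>i<n. monom 1 (?p ^ i) :: 'k poly"
  have "poly.coeff ?P 1 = (\<Sum>i<n. if i = 0 then 1 else 0)"
    unfolding coeff_sum using p by (intro sum.cong) auto
  also have "\<dots> = 1" using l by (simp add: sum.delta')
  finally have nz: "?P \<noteq> 0" by (metis coeff_0 zero_neq_one)
  have "poly ?P x = abs_trace x" for x
    unfolding abs_trace_def n_def[symmetric] poly_sum poly_monom by simp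
  then have "CARD('k) \<le> degree ?P"
    using card_poly_roots_bound[OF nz] by (simp only: zero) simp
  also have "\<dots> \<le> ?p ^ l"
    using p l by (intro degree_sum_le) (auto simp: degree_monom_eq intro!: power_increasing)
  finally have "?p ^ n \<le> ?p ^ l" unfolding n .
  then show False using p l by simp
qed

lemma abs_trace_scale:
  assumes "a \<in> prime_field" shows "abs_trace (a * x) = a * abs_trace (x::'k::{field,finite})"
proof -
  have "a ^ (CHAR('k) ^ i) = a" for i
    using assms[folded prime_field_iff_power_CHAR] by (induction i) (simp_all add: power_mult)
  then show ?thesis
    unfolding abs_trace_def by (simp add: power_mult_distrib sum_distrib_left)
qed

section \<open>Characters with values in a coefficient ring\<close>

text \<open>Elements of valuation 0 are units, because their inverses lie in the valuation ring. As
  \<open>x\<close> and \<open>1 - x\<close> add up to 1, which has valuation 0, they cannot both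
  have positive valuation.\<close>

lemma discrete_valuation_ring_local:
  fixes x :: "'d::idom"
  assumes "discrete_valuation_ring TYPE('d)"
  shows "x dvd 1 \<or> (1 - x) dvd 1"
proof -
  obtain v :: "'d fract \<Rightarrow> int" where
    v: "\<forall>x y. x \<noteq> 0 \<longrightarrow> y \<noteq> 0 \<longrightarrow> v (x * y) = v x + v y"
      "\<forall>x y. x \<noteq> 0 \<longrightarrow> y \<noteq> 0 \<longrightarrow> x + y \<noteq> 0 \<longrightarrow> v (x + y) \<ge> min (v x) (v y)"
    and range: "range (to_fract :: 'd \<Rightarrow> 'd fract) = {x. x = 0 \<or> v x \<ge> 0}"
    using assms unfolding discrete_valuation_ring_def by (elim exE conjE)
  have mult: "v (x * y) = v x + v y" if "x \<noteq> 0" "y \<noteq> 0" for x y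
    using v(1) that by simp
  have add: "v (x + y) \<ge> min (v x) (v y)" if "x \<noteq> 0" "y \<noteq> 0" "x + y \<noteq> 0" for x y
    using v(2) that by simp
  have one: "v 1 = 0" using mult[of 1 1] by simp
  have unit: "a dvd 1" if "a \<noteq> 0" "v (to_fract a) = 0" for a
  proof -
    have nz: "to_fract a \<noteq> 0" using that by simp
    then have "v (inverse (to_fract a)) = 0"
      using mult[of "to_fract a" "inverse (to_fract a)"] one that by simp
    then have "inverse (to_fract a) \<in> range to_fract" unfolding range by simp
    then obtain b where b: "inverse (to_fract a) = to_fract b" by auto
    have "to_fract (a * b) = to_fract 1"
      using nz by (simp add: b[symmetric])
    then have "a * b = 1" by (simp only: to_fract_eq_iff)
    then show ?thesis by (rule dvdI[OF sym])
  qed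
  have nonneg: "v (to_fract a) \<ge> 0" if "a \<noteq> 0" for a
  proof -
    have "to_fract a \<in> range to_fract" by simp
    then show ?thesis unfolding range using that by simp
  qed
  show ?thesis
  proof (cases "x = 0 \<or> 1 - x = 0")
    case False
    then have "v (to_fract x + to_fract (1 - x)) \<ge> min (v (to_fract x)) (v (to_fract (1 - x)))"
      by (intro add) (simp_all only: to_fract_eq_0_iff to_fract_add[symmetric], simp_all)
    then have "min (v (to_fract x)) (v (to_fract (1 - x))) \<le> 0"
      using one by (simp flip: to_fract_add)
    then have "v (to_fract x) = 0 \<or> v (to_fract (1 - x)) = 0"
      using nonneg[of x] nonneg[of "1 - x"] False by linarith
    then show ?thesis using unit False by blast
  qed auto
qed

text \<open>Locality passes to quotients, since ring homomorphisms map units to units.\<close>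

lemma coefficient_ring_local:
  fixes \<phi> :: "'d::idom \<Rightarrow> 'r::comm_ring_1"
  assumes "coefficient_ring p \<phi>"
  shows "(x :: 'r) dvd 1 \<or> (1 - x) dvd 1"
proof -
  from assms have hom: "\<phi> 1 = 1" "\<And>x y. \<phi> (x + y) = \<phi> x + \<phi> y" "\<And>x y. \<phi> (x * y) = \<phi> x * \<phi> y"
    and surj: "surj \<phi>" and dvr: "discrete_valuation_ring TYPE('d)"
    unfolding coefficient_ring_def unital_ring_hom_def by auto
  obtain y where y: "x = \<phi> y" using surj by (metis surjD)
  have "\<phi> (1 - y) + \<phi> y = 1" by (simp only: hom(2)[symmetric] diff_add_cancel hom(1))
  then have y': "1 - x = \<phi> (1 - y)" by (simp only: y eq_diff_eq[symmetric])
  have "\<phi> a dvd 1" if unit: "a dvd 1" for a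
  proof -
    from unit obtain b where b: "1 = a * b" by (rule dvdE)
    have "\<phi> a * \<phi> b = 1" unfolding hom(3)[symmetric] b[symmetric] by (rule hom(1))
    then show ?thesis by (rule dvdI[OF sym])
  qed
  then show ?thesis using discrete_valuation_ring_local[OF dvr, of y] y y' by auto
qed

text \<open>The sum \<open>s\<close> of the powers of \<open>\<zeta>\<close> is killed by the
  nonzero element \<open>1 - \<zeta>\<close>, so it is not a unit. Modulo \<open>1 - \<zeta>\<close>
  it equals the unit \<open>p\<close>, and locality forces \<open>1 - \<zeta>\<close> to be a unit.
  This replaces cancellation, as the ring may have zero divisors.\<close>

lemma one_minus_root_of_unity_unit:
  fixes \<zeta> :: "'r::comm_ring_1"
  assumes local: "\<And>x::'r. x dvd 1 \<or> (1 - x) dvd 1"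
    and p: "(of_nat p :: 'r) dvd 1" and "\<zeta> ^ p = 1" "\<zeta> \<noteq> 1"
  shows "(1 - \<zeta>) dvd 1"
proof -
  define s where "s = (\<Sum>i<p. \<zeta> ^ i)"
  have zero: "(1 - \<zeta>) * s = 0"
    using one_diff_power_eq[of \<zeta> p] assms(3) by (simp add: s_def)
  have "1 - \<zeta> dvd (\<Sum>i<p. 1 - \<zeta> ^ i)"
    by (intro dvd_sum) (auto simp: one_diff_power_eq)
  also have "(\<Sum>i<p. 1 - \<zeta> ^ i) = of_nat p - s"
    by (simp add: sum_subtractf s_def)
  finally obtain t where t: "of_nat p - s = (1 - \<zeta>) * t" by (rule dvdE)
  from p obtain r :: 'r where r: "1 = of_nat p * r" by (rule dvdE)
  have "1 - (1 - \<zeta>) * t * r = s * r"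
    by (simp only: t[symmetric] left_diff_distrib[of "of_nat p" s r] r[symmetric]) simp
  moreover have "\<not> s * r dvd 1"
  proof
    assume "s * r dvd 1"
    then obtain w where w: "1 = s * r * w" by (rule dvdE)
    have "(1 - \<zeta>) * (s * r * w) = (1 - \<zeta>) * s * (r * w)" by (simp only: mult.assoc)
    then have "1 - \<zeta> = 0" unfolding w[symmetric] zero by simp
    then show False using assms(4) by simp
  qed
  ultimately have "(1 - \<zeta>) * t * r dvd 1" using local[of "(1 - \<zeta>) * t * r"] by simp
  then show ?thesis by (rule dvd_mult_left[OF dvd_mult_left])
qed

lemma nontrivial_characterD:
  assumes "nontrivial_character \<eta>\<^sub>0"
  shows "x \<in> prime_field \<Longrightarrow> \<eta>\<^sub>0 x dvd 1"
    and "x \<in> prime_field \<Longrightarrow> y \<in> prime_field \<Longrightarrow> \<eta>\<^sub>0 (x + y) = \<eta>\<^sub>0 x * \<eta>\<^sub>0 y"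
    and "\<exists>x\<in>prime_field. \<eta>\<^sub>0 x \<noteq> 1"
  using assms unfolding nontrivial_character_def by simp_all

lemma eta0_zero:
  assumes "nontrivial_character \<eta>\<^sub>0" shows "\<eta>\<^sub>0 0 = 1"
proof -
  have idem: "\<eta>\<^sub>0 0 * \<eta>\<^sub>0 0 = \<eta>\<^sub>0 0"
    using nontrivial_characterD(2)[OF assms prime_field_0 prime_field_0] by simp
  from nontrivial_characterD(1)[OF assms prime_field_0] obtain b where b: "1 = \<eta>\<^sub>0 0 * b" by (rule dvdE)
  have "\<eta>\<^sub>0 0 * (\<eta>\<^sub>0 0 * b) = \<eta>\<^sub>0 0 * b" by (simp only: mult.assoc[symmetric] idem)
  then show ?thesis unfolding b[symmetric] by simp
qed

lemma eta_add:
  assumes "nontrivial_character \<eta>\<^sub>0"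
  shows "eta \<eta>\<^sub>0 (x + y) = eta \<eta>\<^sub>0 x * eta \<eta>\<^sub>0 y"
  by (simp add: eta_def abs_trace_add abs_trace_in_prime_field nontrivial_characterD(2)[OF assms])

lemma eta_eq_1:
  fixes x :: "'k::{field,finite} fls"
  assumes "nontrivial_character \<eta>\<^sub>0" "fls_nth x 1 = 0"
  shows "eta \<eta>\<^sub>0 x = 1"
proof -
  have "abs_trace 0 = (0 :: 'k)"
    using abs_trace_scale[OF prime_field_0, of "0 :: 'k"] by simp
  then show ?thesis using assms(2) eta0_zero[OF assms(1)] by (simp add: eta_def)
qed

text \<open>A nontrivial value of the character is a root of unity of order dividing
  \<open>CHAR('k)\<close>, so its difference from 1 is invertible. Orthogonality will divide by this
  difference.\<close>

lemma eta_nontrivial: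
  fixes \<phi> :: "'d::idom \<Rightarrow> 'r::comm_ring_1" and \<eta>\<^sub>0 :: "'k::{field,finite} \<Rightarrow> 'r"
  assumes eta: "nontrivial_character \<eta>\<^sub>0" and R: "coefficient_ring CHAR('k) \<phi>"
  shows "\<exists>t. (1 - \<eta>\<^sub>0 (abs_trace t)) dvd 1"
proof -
  obtain x where x: "x \<in> prime_field" "\<eta>\<^sub>0 x \<noteq> 1"
    using nontrivial_characterD(3)[OF eta] by auto
  obtain s :: 'k where s: "abs_trace s \<noteq> 0" using abs_trace_nonzero by blast
  \<comment> \<open>The trace is linear over the prime field, so rescaling \<open>s\<close> gives
    any prescribed trace.\<close>
  define t where "t = x * inverse (abs_trace s) * s"
  have t: "abs_trace t = x"
    unfolding t_def using s abs_trace_in_prime_field[of s] x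
    by (simp add: abs_trace_scale prime_field_mult prime_field_inverse)
  have "\<eta>\<^sub>0 (of_nat i * x) = \<eta>\<^sub>0 x ^ i" for i
  proof (induction i)
    case (Suc i)
    have "of_nat i * x \<in> prime_field"
      by (intro prime_field_mult x) (simp add: prime_field_def)
    then have "\<eta>\<^sub>0 (x + of_nat i * x) = \<eta>\<^sub>0 x * \<eta>\<^sub>0 (of_nat i * x)"
      using nontrivial_characterD(2)[OF eta x(1)] by simp
    then show ?case using Suc by (simp add: algebra_simps)
  qed (simp add: eta0_zero[OF eta])
  from this[of "CHAR('k)"] have "\<eta>\<^sub>0 x ^ CHAR('k) = 1"
    by (simp add: eta0_zero[OF eta])
  then have "(1 - \<eta>\<^sub>0 x) dvd 1"
    using R x(2) unfolding coefficient_ring_def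
    by (intro one_minus_root_of_unity_unit[OF coefficient_ring_local[OF R], where p = "CHAR('k)"]) auto
  then show ?thesis using t by blast
qed

lemma CARD_power_unit:
  fixes \<phi> :: "'d::idom \<Rightarrow> 'r::comm_ring_1"
  assumes R: "coefficient_ring CHAR('k::{field,finite}) \<phi>"
  shows "(of_nat (CARD('k) ^ n) :: 'r) dvd 1"
proof -
  obtain l where "CARD('k) = CHAR('k) ^ l" using CARD_eq_CHAR_power by blast
  moreover have "(of_nat CHAR('k) :: 'r) dvd 1" using R by (simp add: coefficient_ring_def)
  ultimately show ?thesis
    using dvd_power_same[of "of_nat CHAR('k)" "1 :: 'r" "l * n"] by (simp add: power_mult)
qed

text \<open>For \<open>d = degree p\<close> these are the remainders modulo \<open>p\<close>; they
  also serve as the frequencies of Fourier expansions. The condition on coefficients treats the zero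
  polynomial and \<open>d = 0\<close> uniformly.\<close>

definition polys_below :: "nat \<Rightarrow> 'k::zero poly set" where
  "polys_below d = {m. \<forall>i\<ge>d. coeff m i = 0}"

lemma polys_below_Suc: "polys_below (Suc d) = (\<lambda>(a, m). pCons a m) ` (UNIV \<times> polys_below d)"
proof (intro set_eqI iffI)
  fix m :: "'a poly" assume m: "m \<in> polys_below (Suc d)"
  obtain a l where al: "m = pCons a l" by (rule pCons_cases)
  have "coeff l i = 0" if "d \<le> i" for i
    using m that by (auto simp: al polys_below_def dest: spec[of _ "Suc i"])
  then have "l \<in> polys_below d" by (simp add: polys_below_def)
  then show "m \<in> (\<lambda>(a, m). pCons a m) ` (UNIV \<times> polys_below d)"
    using al by auto
qed (auto simp: polys_below_def coeff_pCons split: nat.splits)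

lemma card_polys_below: "card (polys_below d :: 'k::{zero,finite} poly set) = CARD('k) ^ d"
proof (induction d)
  case 0
  have "polys_below 0 = {0 :: 'k poly}" by (auto simp: polys_below_def poly_eq_iff)
  then show ?case by simp
next
  case (Suc d)
  have "inj_on (\<lambda>(a, m). pCons a m) (UNIV \<times> (polys_below d :: 'k poly set))"
    by (auto simp: inj_on_def)
  then show ?case
    by (simp add: polys_below_Suc card_image card_cartesian_product Suc)
qed

lemma finite_polys_below: "finite (polys_below d :: 'k::{zero,finite} poly set)"
  by (rule card_ge_0_finite) (simp add: card_polys_below)

lemma polys_below_iff_degree: "m \<in> polys_below (Suc d) \<longleftrightarrow> degree m \<le> d"
  unfolding polys_below_def by (auto intro: degree_le coeff_eq_0)

section \<open>Edges of the tree\<close>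

lemma mat2_nth [simp]:
  "mat2 a b c d $ 1 $ 1 = a" "mat2 a b c d $ 1 $ 2 = b"
  "mat2 a b c d $ 2 $ 1 = c" "mat2 a b c d $ 2 $ 2 = d"
  by (simp_all add: mat2_def)

lemma mat2_eta: "mat2 (M $ 1 $ 1) (M $ 1 $ 2) (M $ 2 $ 1) (M $ 2 $ 2) = M"
  by (simp add: vec_eq_iff forall_2)

lemma mat2_cases: obtains a b c d where "M = mat2 a b c d"
  by (metis mat2_eta)

lemma mat2_eq_iff: "mat2 a b c d = mat2 a' b' c' d' \<longleftrightarrow> a = a' \<and> b = b' \<and> c = c' \<and> d = d'"
  by (metis mat2_nth)

lemma mat2_mult:
  "mat2 a b c d ** mat2 a' b' c' (d' :: 'a::semiring_1) =
   mat2 (a * a' + b * c') (a * b' + b * d') (c * a' + d * c') (c * b' + d * d')"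
  by (simp add: vec_eq_iff forall_2 matrix_matrix_mult_def sum_2)

lemma det_mat2: "det (mat2 a b c d) = a * d - b * (c :: 'a::comm_ring_1)"
  by (simp add: det_2)

lemma mat_eq_mat2: "mat z = mat2 z 0 0 z"
  by (simp add: vec_eq_iff forall_2 mat_def)

lemma mat_mult_comm: "mat z ** M = (M :: 'a::comm_ring_1^2^2) ** mat z"
  by (rule mat2_cases[of M]) (simp add: mat_eq_mat2 mat2_mult mult.commute)

lemma mat_mult_mat: "mat z ** mat y = (mat (z * y) :: 'a::comm_ring_1^2^2)"
  by (simp add: mat_eq_mat2 mat2_mult)

lemma GL2_iff: "(g :: 'a::field^2^2) \<in> GL2 \<longleftrightarrow> det g \<noteq> 0"
  by (simp add: GL2_def invertible_det_nz)

lemma GL2_mult: "g \<in> GL2 \<Longrightarrow> h \<in> GL2 \<Longrightarrow> g ** h \<in> (GL2 :: ('a::field^2^2) set)"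
  by (simp add: GL2_iff det_mul)

lemma GL2_left_cancel:
  fixes g a b :: "'a::field^2^2"
  assumes "g \<in> GL2" "g ** a = g ** b" shows "a = b"
proof -
  obtain g' where g': "g' ** g = mat 1" using assms(1) unfolding GL2_def invertible_def by auto
  have "g' ** (g ** a) = g' ** (g ** b)" by (simp only: assms(2))
  then show ?thesis by (simp add: matrix_mul_assoc g' matrix_mul_lid)
qed

lemma GL2_right_cancel:
  fixes g a b :: "'a::field^2^2"
  assumes "g \<in> GL2" "a ** g = b ** g" shows "a = b"
proof -
  obtain g' where g': "g ** g' = mat 1" using assms(1) unfolding GL2_def invertible_def by auto
  have "(a ** g) ** g' = (b ** g) ** g'" by (simp only: assms(2))
  then show ?thesis by (simp only: matrix_mul_assoc[symmetric] g' matrix_mul_rid)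
qed

section \<open>Integral matrices and the Iwahori subgroup\<close>

lemma integers_inf_iff: "x \<in> integers_inf \<longleftrightarrow> (\<forall>i<0. fls_nth x i = 0)"
  unfolding integers_inf_def by (auto intro: fls_subdegree_ge0I)

lemma integers_inf_simps [simp, intro]:
  "0 \<in> integers_inf" "1 \<in> integers_inf" "fls_const c \<in> integers_inf" "fls_X \<in> integers_inf"
  by (auto simp: integers_inf_iff)

lemma integers_inf_add: "x \<in> integers_inf \<Longrightarrow> y \<in> integers_inf \<Longrightarrow> x + y \<in> integers_inf"
  and integers_inf_diff: "x \<in> integers_inf \<Longrightarrow> y \<in> integers_inf \<Longrightarrow> x - y \<in> integers_inf"
  and integers_inf_uminus: "x \<in> integers_inf \<Longrightarrow> - x \<in> integers_inf"
  by (auto simp: integers_inf_iff)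

lemma integers_inf_mult: "(x :: 'k::field fls) \<in> integers_inf \<Longrightarrow> y \<in> integers_inf \<Longrightarrow> x * y \<in> integers_inf"
  unfolding integers_inf_def by (cases "x = 0 \<or> y = 0") auto

lemmas integers_inf_closed =
  integers_inf_add integers_inf_diff integers_inf_uminus integers_inf_mult

lemma fls_X_times_integers_iff:
  "(\<exists>x\<in>integers_inf. y = fls_X * x) \<longleftrightarrow> (\<forall>i<1. fls_nth y i = (0 :: 'k::field))"
proof
  assume "\<forall>i<1. fls_nth y i = 0"
  then have "fls_X_inv * y \<in> integers_inf"
    by (auto simp: integers_inf_iff fls_X_inv_times_conv_shift)
  moreover have "y = fls_X * (fls_X_inv * y)"
    by (simp add: fls_X_inv_times_conv_shift fls_X_times_conv_shift)
  ultimately show "\<exists>x\<in>integers_inf. y = fls_X * x" by blast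
qed (auto simp: integers_inf_iff fls_X_times_conv_shift)

lemma maximal_compact_mat2:
  "mat2 a b c d \<in> maximal_compact \<longleftrightarrow>
     a \<in> integers_inf \<and> b \<in> integers_inf \<and> c \<in> integers_inf \<and> d \<in> integers_inf \<and>
     a * d - b * c \<noteq> 0 \<and> fls_subdegree (a * d - b * c) = 0"
  unfolding maximal_compact_def by (simp add: forall_2 det_mat2)

lemma iwahori_mat2:
  "mat2 a b c d \<in> iwahori \<longleftrightarrow>
     a \<in> integers_inf \<and> b \<in> integers_inf \<and> (\<exists>x\<in>integers_inf. c = fls_X * x) \<and> d \<in> integers_inf \<and>
     a * d - b * c \<noteq> 0 \<and> fls_subdegree (a * d - b * c) = 0"
  unfolding iwahori_def by (auto simp: maximal_compact_mat2 integers_inf_mult)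

text \<open>The coset calculus uses nothing else about \<open>iwahori\<close> and
  \<open>maximal_compact\<close>, so it is developed once for both.\<close>

definition matrix_group :: "('a::semiring_1^2^2) set \<Rightarrow> bool" where
  "matrix_group H \<longleftrightarrow> mat 1 \<in> H \<and> (\<forall>g\<in>H. \<forall>h\<in>H. g ** h \<in> H) \<and>
     (\<forall>g\<in>H. \<exists>h\<in>H. g ** h = mat 1 \<and> h ** g = mat 1)"

lemma mat2_inverse:
  fixes a b c d :: "'a::field"
  assumes "a * d - b * c \<noteq> 0"
  defines "r \<equiv> inverse (a * d - b * c)"
  shows "mat2 a b c d ** mat2 (r * d) (- r * b) (- r * c) (r * a) = mat 1"
    and "mat2 (r * d) (- r * b) (- r * c) (r * a) ** mat2 a b c d = mat 1"
proof -
  have "r * (a * d - b * c) = 1" using assms by simp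
  then have "r * a * d - r * b * c = 1" by (simp add: algebra_simps)
  then show "mat2 a b c d ** mat2 (r * d) (- r * b) (- r * c) (r * a) = mat 1"
    and "mat2 (r * d) (- r * b) (- r * c) (r * a) ** mat2 a b c d = mat 1"
    by (simp_all add: mat2_mult mat_eq_mat2 mat2_eq_iff algebra_simps)
qed

lemma mat2_inverse_det:
  fixes a b c d :: "'a::field"
  assumes "a * d - b * c \<noteq> 0"
  defines "r \<equiv> inverse (a * d - b * c)"
  shows "r * d * (r * a) - (- r * b) * (- r * c) = r"
proof -
  have "r * (a * d - b * c) = 1" using assms by simp
  then have "r * (r * (a * d - b * c)) = r" by simp
  then show ?thesis by (simp add: algebra_simps)
qed

lemma maximal_compact_group: "matrix_group (maximal_compact :: ('k::field fls^2^2) set)"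
  unfolding matrix_group_def
proof (intro conjI ballI)
  show "mat 1 \<in> (maximal_compact :: ('k fls^2^2) set)"
    by (simp add: mat_eq_mat2 maximal_compact_mat2)
next
  fix g h :: "'k fls^2^2" assume gh: "g \<in> maximal_compact" "h \<in> maximal_compact"
  show "g ** h \<in> maximal_compact"
  proof (cases g rule: mat2_cases, cases h rule: mat2_cases)
    fix a b c d a' b' c' d'
    assume "g = mat2 a b c d" "h = mat2 a' b' c' d'"
    moreover have "det (g ** h) \<noteq> 0" "fls_subdegree (det (g ** h)) = 0"
      using gh by (simp_all add: maximal_compact_def det_mul)
    ultimately show ?thesis using gh
      by (simp add: mat2_mult maximal_compact_mat2 det_mat2 integers_inf_closed)
  qed
next
  fix g :: "'k fls^2^2" assume g: "g \<in> maximal_compact"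
  show "\<exists>h\<in>maximal_compact. g ** h = mat 1 \<and> h ** g = mat 1"
  proof (cases g rule: mat2_cases)
    fix a b c d assume gd: "g = mat2 a b c d"
    let ?r = "inverse (a * d - b * c)"
    have *: "a * d - b * c \<noteq> 0" "fls_subdegree (a * d - b * c) = 0" "a \<in> integers_inf"
      "b \<in> integers_inf" "c \<in> integers_inf" "d \<in> integers_inf"
      using g by (simp_all add: gd maximal_compact_mat2)
    then have "?r \<in> integers_inf" "?r \<noteq> 0" "fls_subdegree ?r = 0"
      by (simp_all add: integers_inf_def)
    then have "mat2 (?r * d) (- ?r * b) (- ?r * c) (?r * a) \<in> maximal_compact"
      unfolding maximal_compact_mat2 mat2_inverse_det[OF *(1)]
      using * by (simp add: integers_inf_closed)
    then show ?thesis using mat2_inverse[OF *(1)] gd by blast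
  qed
qed

lemma iwahori_group: "matrix_group (iwahori :: ('k::field fls^2^2) set)"
  unfolding matrix_group_def
proof (intro conjI ballI)
  show "mat 1 \<in> (iwahori :: ('k fls^2^2) set)"
    by (auto simp: mat_eq_mat2 iwahori_mat2 intro!: bexI[of _ 0])
next
  fix g h :: "'k fls^2^2" assume gh: "g \<in> iwahori" "h \<in> iwahori"
  show "g ** h \<in> iwahori"
  proof (cases g rule: mat2_cases, cases h rule: mat2_cases)
    fix a b c d a' b' c' d'
    assume eq: "g = mat2 a b c d" "h = mat2 a' b' c' d'"
    obtain x x' where x: "x \<in> integers_inf" "c = fls_X * x" "x' \<in> integers_inf" "c' = fls_X * x'"
      using gh by (auto simp: eq iwahori_mat2)
    have "a' \<in> integers_inf" "d \<in> integers_inf" using gh by (simp_all add: eq iwahori_mat2)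
    then have "x * a' + d * x' \<in> integers_inf" using x by (simp add: integers_inf_closed)
    moreover have "c * a' + d * c' = fls_X * (x * a' + d * x')"
      by (simp add: x algebra_simps)
    ultimately have "\<exists>y\<in>integers_inf. (g ** h) $ 2 $ 1 = fls_X * y"
      by (auto simp: eq mat2_mult)
    moreover have "g ** h \<in> maximal_compact"
      using gh maximal_compact_group unfolding matrix_group_def iwahori_def by auto
    ultimately show ?thesis by (simp add: iwahori_def)
  qed
next
  fix g :: "'k fls^2^2" assume g: "g \<in> iwahori"
  show "\<exists>h\<in>iwahori. g ** h = mat 1 \<and> h ** g = mat 1"
  proof (cases g rule: mat2_cases)
    fix a b c d assume gd: "g = mat2 a b c d"
    let ?r = "inverse (a * d - b * c)"
    obtain x where x: "x \<in> integers_inf" "c = fls_X * x"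
      using g by (auto simp: gd iwahori_mat2)
    have *: "a * d - b * c \<noteq> 0" "fls_subdegree (a * d - b * c) = 0" "a \<in> integers_inf"
      "b \<in> integers_inf" "d \<in> integers_inf"
      using g by (simp_all add: gd iwahori_mat2)
    then have r: "?r \<in> integers_inf" "?r \<noteq> 0" "fls_subdegree ?r = 0"
      by (simp_all add: integers_inf_def)
    have "- ?r * c = fls_X * (- ?r * x)" by (simp add: x(2))
    moreover have "- ?r * x \<in> integers_inf" by (intro integers_inf_closed r x)
    ultimately have "\<exists>y\<in>integers_inf. - ?r * c = fls_X * y" by blast
    then have "mat2 (?r * d) (- ?r * b) (- ?r * c) (?r * a) \<in> iwahori"
      unfolding iwahori_mat2 mat2_inverse_det[OF *(1)]
      using * r by (intro conjI integers_inf_closed)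
    then show ?thesis using mat2_inverse[OF *(1)] gd by blast
  qed
qed

section \<open>Cosets, reversal and the action of matrices\<close>

definition matrix_coset :: "('k::field fls^2^2) set \<Rightarrow> 'k fls^2^2 \<Rightarrow> ('k fls^2^2) set" where
  "matrix_coset H g = {g ** z ** h | z h. z \<in> scalars \<and> h \<in> H}"

lemma edge_coset_eq: "edge_coset = matrix_coset iwahori"
  and vertex_coset_eq: "vertex_coset = matrix_coset maximal_compact"
  by (auto simp: fun_eq_iff edge_coset_def vertex_coset_def matrix_coset_def)

lemma mem_matrix_coset: "x \<in> matrix_coset H g \<longleftrightarrow> (\<exists>z h. z \<noteq> 0 \<and> h \<in> H \<and> x = g ** mat z ** h)"
  by (auto simp: matrix_coset_def scalars_def)

lemma mat_one_mult: "g ** mat 1 ** mat 1 = (g :: 'a::semiring_1^2^2)"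
  by (simp add: matrix_mul_rid)

lemma self_mem_matrix_coset: "matrix_group H \<Longrightarrow> g \<in> matrix_coset H g"
  unfolding mem_matrix_coset matrix_group_def
  by (rule exI[of _ 1], rule exI[of _ "mat 1"]) (simp add: mat_one_mult)

lemma scalar_group_mult:
  fixes g h h' :: "'a::comm_ring_1^2^2"
  shows "g ** mat z ** h ** mat z' ** h' = g ** mat (z * z') ** (h ** h')"
proof -
  have "g ** mat z ** h ** mat z' ** h' = g ** mat z ** (h ** mat z') ** h'"
    by (simp only: matrix_mul_assoc)
  also have "\<dots> = g ** (mat z ** mat z') ** (h ** h')"
    by (simp only: mat_mult_comm[of z' h, symmetric] matrix_mul_assoc)
  also have "\<dots> = g ** mat (z * z') ** (h ** h')"
    by (simp only: mat_mult_mat)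
  finally show ?thesis .
qed

lemma matrix_coset_absorb:
  assumes H: "matrix_group H" and z: "z \<noteq> 0" and h: "h \<in> H"
  shows "matrix_coset H (g ** mat z ** h) = matrix_coset H g"
proof (intro set_eqI iffI)
  fix x assume "x \<in> matrix_coset H (g ** mat z ** h)"
  then obtain z' h' where "z' \<noteq> 0" "h' \<in> H" "x = g ** mat z ** h ** mat z' ** h'"
    by (auto simp: mem_matrix_coset)
  then have "z * z' \<noteq> 0 \<and> h ** h' \<in> H \<and> x = g ** mat (z * z') ** (h ** h')"
    using H h z by (simp add: scalar_group_mult matrix_group_def)
  then show "x \<in> matrix_coset H g" unfolding mem_matrix_coset by blast
next
  fix x assume "x \<in> matrix_coset H g"
  then obtain z' h' where *: "z' \<noteq> 0" "h' \<in> H" "x = g ** mat z' ** h'"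
    by (auto simp: mem_matrix_coset)
  obtain hi where hi: "hi \<in> H" "h ** hi = mat 1" using H h unfolding matrix_group_def by blast
  have "g ** mat z ** h ** mat (z' / z) ** (hi ** h') = g ** mat (z * (z' / z)) ** (h ** (hi ** h'))"
    by (rule scalar_group_mult)
  also have "\<dots> = x" using z by (simp add: *(3) matrix_mul_assoc hi(2) matrix_mul_lid)
  finally have "z' / z \<noteq> 0 \<and> hi ** h' \<in> H \<and> x = g ** mat z ** h ** mat (z' / z) ** (hi ** h')"
    using * z hi(1) H by (simp add: matrix_group_def)
  then show "x \<in> matrix_coset H (g ** mat z ** h)" unfolding mem_matrix_coset by blast
qed

lemma matrix_coset_eqD:
  assumes "matrix_group H" "matrix_coset H a = matrix_coset H b"
  obtains z h where "z \<noteq> 0" "h \<in> H" "b = a ** mat z ** h"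
  using self_mem_matrix_coset[OF assms(1), of b] assms(2)[symmetric]
  by (auto simp: mem_matrix_coset)

lemmas edge_coset_absorb = matrix_coset_absorb[OF iwahori_group, folded edge_coset_eq]
lemmas vertex_coset_absorb = matrix_coset_absorb[OF maximal_compact_group, folded vertex_coset_eq]

lemma edge_coset_scalar: "z \<noteq> 0 \<Longrightarrow> edge_coset (g ** mat z) = edge_coset g"
  using edge_coset_absorb[OF _ conjunct1[OF iwahori_group[unfolded matrix_group_def]], of z g]
  by (simp add: matrix_mul_rid)

lemma vertex_coset_scalar: "z \<noteq> 0 \<Longrightarrow> vertex_coset (g ** mat z) = vertex_coset g"
  using vertex_coset_absorb[OF _ conjunct1[OF maximal_compact_group[unfolded matrix_group_def]], of z g]
  by (simp add: matrix_mul_rid)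

lemma edge_coset_iwahori: "h \<in> iwahori \<Longrightarrow> edge_coset (g ** h) = edge_coset g"
  using edge_coset_absorb[of 1 h g] by (simp add: matrix_mul_rid)

lemma vertex_coset_compact: "h \<in> maximal_compact \<Longrightarrow> vertex_coset (g ** h) = vertex_coset g"
  using vertex_coset_absorb[of 1 h g] by (simp add: matrix_mul_rid)

abbreviation flip :: "'k::field fls^2^2" where "flip \<equiv> mat2 0 1 fls_X 0"

lemma flip_GL2: "flip \<in> GL2"
  by (simp add: GL2_iff det_mat2)

lemma flip_flip: "flip ** flip = mat fls_X"
  by (simp add: mat2_mult mat_eq_mat2)

text \<open>\<open>flip\<close> normalises the Iwahori subgroup: conjugation exchanges the diagonal
  entries and moves the factor \<open>fls_X\<close> from one off-diagonal entry to the other. This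
  makes reversal well defined on cosets.\<close>

lemma flip_iwahori:
  assumes "h \<in> iwahori"
  shows "\<exists>h'\<in>iwahori. h ** flip = flip ** h'" and "\<exists>h'\<in>iwahori. flip ** h = h' ** flip"
proof -
  obtain a b c d where h: "h = mat2 a b c d" by (rule mat2_cases)
  then obtain x where x: "x \<in> integers_inf" "c = fls_X * x"
    using assms by (auto simp: iwahori_mat2)
  have "mat2 d x (fls_X * b) a \<in> iwahori"
    using assms x by (auto simp: h iwahori_mat2 algebra_simps)
  moreover have "h ** flip = flip ** mat2 d x (fls_X * b) a" "flip ** h = mat2 d x (fls_X * b) a ** flip"
    by (simp_all add: h x mat2_mult mat2_eq_iff mult.commute)
  ultimately show "\<exists>h'\<in>iwahori. h ** flip = flip ** h'" "\<exists>h'\<in>iwahori. flip ** h = h' ** flip"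
    by blast+
qed

lemma mat_mult_comm_right:
  fixes g h :: "'a::comm_ring_1^2^2"
  shows "g ** mat z ** h = g ** h ** mat z"
  by (simp only: matrix_mul_assoc[symmetric] mat_mult_comm[of z h])

lemma reverse_edge_coset: "reverse_edge (edge_coset g) = edge_coset (g ** flip)"
proof (intro set_eqI iffI)
  fix x assume "x \<in> reverse_edge (edge_coset g)"
  then obtain z h where zh: "z \<noteq> 0" "h \<in> iwahori" "x = g ** mat z ** h ** flip"
    by (auto simp: reverse_edge_def edge_coset_eq mem_matrix_coset)
  obtain h' where h': "h' \<in> iwahori" "h ** flip = flip ** h'" using flip_iwahori(1)[OF zh(2)] by blast
  have "x = g ** mat z ** (h ** flip)" by (simp only: zh(3) matrix_mul_assoc)
  also have "\<dots> = g ** mat z ** flip ** h'" by (simp only: h'(2) matrix_mul_assoc)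
  also have "\<dots> = g ** flip ** mat z ** h'" by (simp only: mat_mult_comm_right)
  finally show "x \<in> edge_coset (g ** flip)" using zh(1) h'(1) by (auto simp: edge_coset_eq mem_matrix_coset)
next
  fix x assume "x \<in> edge_coset (g ** flip)"
  then obtain z h where zh: "z \<noteq> 0" "h \<in> iwahori" "x = g ** flip ** mat z ** h"
    by (auto simp: edge_coset_eq mem_matrix_coset)
  obtain h' where h': "h' \<in> iwahori" "flip ** h = h' ** flip" using flip_iwahori(2)[OF zh(2)] by blast
  have "x = g ** mat z ** (flip ** h)"
    unfolding zh(3) mat_mult_comm_right[of g z flip, symmetric] by (simp only: matrix_mul_assoc)
  also have "\<dots> = g ** mat z ** h' ** flip" by (simp only: h'(2) matrix_mul_assoc)
  finally show "x \<in> reverse_edge (edge_coset g)"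
    using zh(1) h'(1) unfolding reverse_edge_def
    by (intro image_eqI[of x _ "g ** mat z ** h'"]) (auto simp: edge_coset_eq mem_matrix_coset)
qed

lemma reverse_reverse: "reverse_edge (reverse_edge (edge_coset g)) = edge_coset g"
  by (simp add: reverse_edge_coset matrix_mul_assoc[symmetric] flip_flip edge_coset_scalar)

lemma iwahori_subset: "iwahori \<subseteq> maximal_compact"
  by (auto simp: iwahori_def)

text \<open>The Iwahori subgroup is contained in \<open>maximal_compact\<close>, so all members of
  an edge have the same vertex coset and the union in \<open>origin\<close> is that single
  coset.\<close>

lemma origin_edge_coset: "origin (edge_coset g) = vertex_coset g"
proof -
  have "vertex_coset x = vertex_coset g" if "x \<in> edge_coset g" for x
    using that iwahori_subset by (auto simp: edge_coset_eq mem_matrix_coset intro!: vertex_coset_absorb)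
  moreover have "g \<in> edge_coset g"
    unfolding edge_coset_eq by (rule self_mem_matrix_coset[OF iwahori_group])
  ultimately show ?thesis unfolding origin_def by blast
qed

lemma terminus_edge_coset: "terminus (edge_coset g) = vertex_coset (g ** flip)"
  by (simp add: terminus_def reverse_edge_coset origin_edge_coset)

lemma act_matrix_coset: "(\<lambda>x. \<gamma> ** x) ` matrix_coset H g = matrix_coset H (\<gamma> ** g)"
proof (intro set_eqI iffI)
  fix x assume "x \<in> matrix_coset H (\<gamma> ** g)"
  then obtain z h where "z \<noteq> 0" "h \<in> H" "x = \<gamma> ** g ** mat z ** h" by (auto simp: mem_matrix_coset)
  then show "x \<in> (\<lambda>x. \<gamma> ** x) ` matrix_coset H g"
    by (intro image_eqI[of _ _ "g ** mat z ** h"]) (auto simp: matrix_mul_assoc mem_matrix_coset)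
next
  fix x assume "x \<in> (\<lambda>x. \<gamma> ** x) ` matrix_coset H g"
  then obtain z h where zh: "z \<noteq> 0" "h \<in> H" "x = \<gamma> ** (g ** mat z ** h)"
    by (auto simp: mem_matrix_coset)
  have "x = \<gamma> ** g ** mat z ** h" by (simp only: zh(3) matrix_mul_assoc)
  then show "x \<in> matrix_coset H (\<gamma> ** g)" unfolding mem_matrix_coset using zh(1,2) by blast
qed

lemma act_edge_coset: "act \<gamma> (edge_coset g) = edge_coset (\<gamma> ** g)"
  unfolding act_def edge_coset_eq by (rule act_matrix_coset)

lemma act_vertex_coset: "act \<gamma> (vertex_coset g) = vertex_coset (\<gamma> ** g)"
  unfolding act_def vertex_coset_eq by (rule act_matrix_coset)

lemma edgesE: assumes "e \<in> edges" obtains g where "g \<in> GL2" "e = edge_coset g"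
  using assms by (auto simp: edges_def)

lemma edge_coset_in_edges: "g \<in> GL2 \<Longrightarrow> edge_coset g \<in> edges"
  by (simp add: edges_def)

lemma act_in_edges: "\<gamma> \<in> GL2 \<Longrightarrow> e \<in> edges \<Longrightarrow> act \<gamma> e \<in> edges"
  by (elim edgesE) (auto simp: act_edge_coset intro!: edge_coset_in_edges GL2_mult)

lemma act_act: "act \<gamma> (act \<delta> e) = act (\<gamma> ** \<delta>) e"
  unfolding act_def by (simp add: image_image matrix_mul_assoc)

lemma act_one: "act (mat 1) e = e"
  unfolding act_def by (simp add: matrix_mul_lid)

lemma reverse_act: "reverse_edge (act \<gamma> e) = act \<gamma> (reverse_edge e)"
  unfolding reverse_edge_def act_def by (simp add: image_image matrix_mul_assoc)

lemma terminus_act: "e \<in> edges \<Longrightarrow> terminus (act \<gamma> e) = act \<gamma> (terminus e)"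
  by (elim edgesE) (simp add: act_edge_coset terminus_edge_coset act_vertex_coset matrix_mul_assoc)

lemma GL2_inverse:
  assumes "(\<gamma> :: 'a::field^2^2) \<in> GL2"
  obtains \<delta> where "\<delta> \<in> GL2" "\<gamma> ** \<delta> = mat 1" "\<delta> ** \<gamma> = mat 1"
  using assms unfolding GL2_def invertible_def by auto

section \<open>Harmonic cochains\<close>

text \<open>The action of \<open>\<gamma>\<close> commutes with reversal and maps the edges ending
  at \<open>v\<close> bijectively onto those ending at \<open>act \<gamma> v\<close>.\<close>

lemma harmonic_slash:
  assumes f: "harmonic_cochain f" and \<gamma>: "\<gamma> \<in> GL2"
  shows "harmonic_cochain (slash f \<gamma>)"
proof -
  obtain \<delta> where \<delta>: "\<delta> \<in> GL2" "\<gamma> ** \<delta> = mat 1" "\<delta> ** \<gamma> = mat 1"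
    using GL2_inverse[OF \<gamma>] by blast
  have "(\<Sum>e\<in>{e \<in> edges. terminus e = v}. slash f \<gamma> e) = 0" if v: "v \<in> vertices" for v
  proof -
    have "(\<Sum>e\<in>{e \<in> edges. terminus e = v}. slash f \<gamma> e) =
          (\<Sum>e\<in>{e \<in> edges. terminus e = act \<gamma> v}. f e)"
    proof (rule sum.reindex_bij_witness[of _ "act \<delta>" "act \<gamma>"])
      fix e assume "e \<in> {e \<in> edges. terminus e = act \<gamma> v}"
      then show "act \<delta> e \<in> {e \<in> edges. terminus e = v}"
        by (auto simp: terminus_act act_act \<delta> act_one intro!: act_in_edges)
    qed (auto simp: act_act \<delta> act_one slash_def terminus_act intro!: act_in_edges \<gamma>)
    moreover have "act \<gamma> v \<in> vertices"
      using v \<gamma> by (auto simp: vertices_def act_vertex_coset intro!: imageI GL2_mult)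
    ultimately show ?thesis using f by (simp add: harmonic_cochain_def)
  qed
  moreover have "slash f \<gamma> (reverse_edge e) = - slash f \<gamma> e" if "e \<in> edges" for e
    using f act_in_edges[OF \<gamma> that] by (simp add: harmonic_cochain_def slash_def reverse_act[symmetric])
  ultimately show ?thesis by (simp add: harmonic_cochain_def)
qed

lemma harmonic_add:
  "harmonic_cochain f \<Longrightarrow> harmonic_cochain g \<Longrightarrow> harmonic_cochain (\<lambda>e. f e + g e)"
  by (simp add: harmonic_cochain_def sum.distrib)

lemma harmonic_diff:
  "harmonic_cochain f \<Longrightarrow> harmonic_cochain g \<Longrightarrow> harmonic_cochain (\<lambda>e. f e - g e)"
  by (simp add: harmonic_cochain_def sum_subtractf)

lemma harmonic_scale: "harmonic_cochain f \<Longrightarrow> harmonic_cochain (\<lambda>e. c * f e)"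
  by (simp add: harmonic_cochain_def sum_distrib_left[symmetric])

lemma harmonic_sum:
  "(\<And>i. i \<in> I \<Longrightarrow> harmonic_cochain (f i)) \<Longrightarrow> harmonic_cochain (\<lambda>e. \<Sum>i\<in>I. f i e)"
  by (induction I rule: infinite_finite_induct)
     (auto intro!: harmonic_add simp: harmonic_cochain_def[of "\<lambda>_. 0"])

section \<open>Edges with a given terminus\<close>

abbreviation lower_rep :: "'k::field \<Rightarrow> 'k fls^2^2" where
  "lower_rep c \<equiv> mat2 (fls_const c) 1 1 0"

lemma lower_rep_compact: "lower_rep c \<in> maximal_compact"
  by (simp add: maximal_compact_mat2)

text \<open>The first column of \<open>\<kappa>\<close> reduces to a point of the projective line
  over the residue field. The identity represents the point with vanishing lower entry, and
  \<open>lower_rep c\<close> the point with ratio \<open>c\<close>.\<close>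

lemma maximal_compact_decomp:
  assumes "\<kappa> \<in> maximal_compact"
  shows "\<kappa> \<in> iwahori \<or> (\<exists>c. \<exists>h\<in>iwahori. \<kappa> = lower_rep c ** h)"
proof -
  obtain a b c d where k: "\<kappa> = mat2 a b c d" by (rule mat2_cases)
  have int: "a \<in> integers_inf" "b \<in> integers_inf" "c \<in> integers_inf" "d \<in> integers_inf"
    and det: "a * d - b * c \<noteq> 0" "fls_subdegree (a * d - b * c) = 0"
    using assms by (simp_all add: k maximal_compact_mat2)
  show ?thesis
  proof (cases "fls_nth c 0 = 0")
    case True
    have "fls_nth c i = 0" if "i < 1" for i
      using True int(3) that by (cases "i = 0") (auto simp: integers_inf_iff)
    then show ?thesis using int det
      by (simp add: k iwahori_mat2 fls_X_times_integers_iff)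
  next
    case False
    \<comment> \<open>The ratio of the residues of \<open>a\<close> and \<open>c\<close>; it makes
      the lower left entry of \<open>?h\<close> divisible by \<open>fls_X\<close>.\<close>
    define u where "u = fls_nth a 0 / fls_nth c 0"
    let ?h = "mat2 c d (a - fls_const u * c) (b - fls_const u * d)"
    have "fls_nth (a - fls_const u * c) i = 0" if "i < 1" for i
      using False int that by (cases "i = 0") (auto simp: integers_inf_iff u_def)
    moreover have "c * (b - fls_const u * d) - d * (a - fls_const u * c) = - (a * d - b * c)"
      by (simp add: algebra_simps)
    moreover have "- (a * d - b * c) \<noteq> 0" "fls_subdegree (- (a * d - b * c)) = 0"
      using det by (simp_all only: fls_uminus_subdegree neg_equal_0_iff_equal not_False_eq_True)
    ultimately have "?h \<in> iwahori" using int
      unfolding iwahori_mat2 fls_X_times_integers_iff by (auto simp: integers_inf_closed)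
    moreover have "\<kappa> = lower_rep u ** ?h"
      by (simp add: k mat2_mult mat2_eq_iff)
    ultimately show ?thesis by blast
  qed
qed

text \<open>Both determinants are units and they differ by the factor \<open>z * z\<close>, so
  \<open>z\<close> has valuation 0. This removes the centre when cosets are compared.\<close>

lemma scalar_iwahori:
  assumes "h \<in> iwahori" "det (mat z ** h) \<noteq> 0" "fls_subdegree (det (mat z ** h)) = 0"
  shows "mat z ** h \<in> iwahori"
proof -
  obtain a b c d where h: "h = mat2 a b c d" by (rule mat2_cases)
  have dh: "a * d - b * c \<noteq> 0" "fls_subdegree (a * d - b * c) = 0"
    using assms(1) by (simp_all add: h iwahori_mat2)
  have det: "det (mat z ** h) = z * z * (a * d - b * c)"
    by (simp add: h mat_eq_mat2 mat2_mult det_mat2 algebra_simps)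
  have "z \<noteq> 0" using assms(2) by (auto simp: det)
  then have "fls_subdegree z = 0" using assms(3) dh by (simp add: det)
  then have z: "z \<in> integers_inf" by (simp add: integers_inf_def)
  obtain x where "x \<in> integers_inf" "c = fls_X * x" using assms(1) by (auto simp: h iwahori_mat2)
  then have "\<exists>y\<in>integers_inf. z * c = fls_X * y"
    using z by (intro bexI[of _ "z * x"]) (auto simp: integers_inf_mult)
  moreover have "(z * a) * (z * d) - (z * b) * (z * c) = det (mat z ** h)"
    by (simp add: det algebra_simps)
  ultimately show ?thesis using assms z
    by (simp add: h mat_eq_mat2 mat2_mult iwahori_mat2 integers_inf_mult)
qed

lemma edge_coset_flip_eqI:
  assumes "h \<in> iwahori" "z \<noteq> 0" "g ** flip = k ** mat z ** h"
  shows "edge_coset g = edge_coset (k ** flip)"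
proof -
  obtain h' where h': "h' \<in> iwahori" "h ** flip = flip ** h'" using flip_iwahori(1)[OF assms(1)] by blast
  have "g ** mat fls_X = k ** mat z ** (h ** flip)"
    unfolding flip_flip[symmetric] by (simp only: matrix_mul_assoc assms(3))
  also have "\<dots> = k ** flip ** mat z ** h'"
    unfolding h'(2) by (simp only: matrix_mul_assoc mat_mult_comm_right)
  finally have "edge_coset (g ** mat fls_X) = edge_coset (k ** flip)"
    using edge_coset_absorb[OF assms(2) h'(1)] by simp
  then show ?thesis by (simp add: edge_coset_scalar)
qed

text \<open>An edge \<open>g\<close> ends at the vertex of \<open>g ** flip\<close>, so these edges
  correspond to the left cosets of the Iwahori subgroup in \<open>maximal_compact\<close>.\<close>

lemma edges_with_terminus:
  assumes h: "(h :: 'k::field fls^2^2) \<in> GL2"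
  shows "{e \<in> edges. terminus e = vertex_coset h} =
    insert (edge_coset (h ** flip)) (range (\<lambda>c. edge_coset (h ** lower_rep c ** flip)))"
proof (intro set_eqI iffI)
  fix e assume "e \<in> {e \<in> edges. terminus e = vertex_coset h}"
  then obtain g where g: "g \<in> GL2" "e = edge_coset g" and t: "vertex_coset (g ** flip) = vertex_coset h"
    by (auto elim!: edgesE simp: terminus_edge_coset)
  obtain z \<kappa> where zk: "z \<noteq> 0" "\<kappa> \<in> maximal_compact" "g ** flip = h ** mat z ** \<kappa>"
    using matrix_coset_eqD[OF maximal_compact_group t[symmetric, unfolded vertex_coset_eq]] by blast
  from maximal_compact_decomp[OF zk(2)]
  show "e \<in> insert (edge_coset (h ** flip)) (range (\<lambda>c. edge_coset (h ** lower_rep c ** flip)))"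
  proof
    assume "\<kappa> \<in> iwahori"
    then show ?thesis using edge_coset_flip_eqI[OF _ zk(1) zk(3)] g by simp
  next
    assume "\<exists>c. \<exists>i\<in>iwahori. \<kappa> = lower_rep c ** i"
    then obtain c i where i: "i \<in> iwahori" "\<kappa> = lower_rep c ** i" by blast
    have "g ** flip = h ** lower_rep c ** mat z ** i"
      unfolding zk(3) i(2) by (simp only: matrix_mul_assoc mat_mult_comm_right[of h z])
    then show ?thesis using edge_coset_flip_eqI[OF i(1) zk(1)] g by blast
  qed
next
  fix e assume "e \<in> insert (edge_coset (h ** flip)) (range (\<lambda>c. edge_coset (h ** lower_rep c ** flip)))"
  moreover have "lower_rep c \<in> GL2" for c :: 'k by (simp add: GL2_iff det_mat2)
  ultimately show "e \<in> {e \<in> edges. terminus e = vertex_coset h}"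
    using h
    by (auto simp: terminus_edge_coset matrix_mul_assoc[symmetric] flip_flip
        intro!: edge_coset_in_edges GL2_mult flip_GL2)
       (simp_all add: matrix_mul_assoc vertex_coset_scalar vertex_coset_compact lower_rep_compact)
qed

lemma edge_coset_flip_eqD:
  assumes "h \<in> GL2" "edge_coset (h ** a ** flip) = edge_coset (h ** b ** flip)"
    "a' ** a = mat 1" "det (a' ** b) \<noteq> 0" "fls_subdegree (det (a' ** b)) = 0"
  shows "a' ** b \<in> iwahori"
proof -
  obtain z i where zi: "z \<noteq> 0" "i \<in> iwahori" "h ** b ** flip = h ** a ** flip ** mat z ** i"
    using matrix_coset_eqD[OF iwahori_group assms(2)[unfolded edge_coset_eq]] by blast
  obtain j where j: "j \<in> iwahori" "flip ** i = j ** flip" using flip_iwahori(2)[OF zi(2)] by blast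
  have "h ** (b ** flip) = h ** (a ** mat z ** (flip ** i))"
    using zi(3) unfolding mat_mult_comm_right[of "a" z flip, symmetric]
    by (simp only: matrix_mul_assoc mat_mult_comm_right)
  then have "b ** flip = a ** mat z ** j ** flip"
    using GL2_left_cancel[OF assms(1)] unfolding j(2) by (simp only: matrix_mul_assoc)
  then have "b = a ** mat z ** j" using GL2_right_cancel[OF flip_GL2] by blast
  then have "a' ** b = mat z ** j"
    by (simp only: matrix_mul_assoc assms(3) matrix_mul_lid)
  then show ?thesis using scalar_iwahori[OF j(1)] assms by simp
qed

text \<open>Harmonicity is applied at the origin of the edge \<open>h\<close>. Among the edges
  ending there, \<open>h ** flip\<close> is the reverse of \<open>h\<close> and contributes the
  negative of the left side.\<close>

lemma harmonic_edge_sum: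
  fixes h :: "'k::{field,finite} fls^2^2"
  assumes f: "harmonic_cochain f" and h: "h \<in> GL2"
  shows "f (edge_coset h) = (\<Sum>c\<in>UNIV. f (edge_coset (h ** lower_rep c ** flip)))"
proof -
  have inj: "inj (\<lambda>c. edge_coset (h ** lower_rep c ** flip))"
  proof (rule injI)
    fix c c' :: 'k
    assume "edge_coset (h ** lower_rep c ** flip) = edge_coset (h ** lower_rep c' ** flip)"
    then have "mat2 0 1 1 (- fls_const c) ** lower_rep c' \<in> iwahori"
      by (rule edge_coset_flip_eqD[OF h]) (simp_all add: mat2_mult mat_eq_mat2 det_mat2)
    then have "\<forall>i<1. fls_nth (fls_const c' - fls_const c) i = 0"
      by (simp add: mat2_mult iwahori_mat2 fls_X_times_integers_iff)
    then show "c = c'" by (auto dest!: spec[of _ 0])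
  qed
  have new: "edge_coset (h ** flip) \<notin> range (\<lambda>c. edge_coset (h ** lower_rep c ** flip))"
  proof
    assume "edge_coset (h ** flip) \<in> range (\<lambda>c. edge_coset (h ** lower_rep c ** flip))"
    then obtain c where "edge_coset (h ** mat 1 ** flip) = edge_coset (h ** lower_rep c ** flip)"
      by (auto simp: matrix_mul_rid)
    then have "mat 1 ** lower_rep c \<in> iwahori"
      by (rule edge_coset_flip_eqD[OF h]) (simp_all add: det_mat2 matrix_mul_lid)
    then have "\<forall>i<1. fls_nth (1 :: 'k fls) i = 0"
      unfolding matrix_mul_lid iwahori_mat2 fls_X_times_integers_iff by blast
    then show False by (auto dest!: spec[of _ 0])
  qed
  have "vertex_coset h \<in> vertices" using h by (simp add: vertices_def)
  then have "0 = (\<Sum>e\<in>{e \<in> edges. terminus e = vertex_coset h}. f e)"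
    using f by (simp add: harmonic_cochain_def)
  also have "\<dots> = f (edge_coset (h ** flip)) + (\<Sum>c\<in>UNIV. f (edge_coset (h ** lower_rep c ** flip)))"
    unfolding edges_with_terminus[OF h] using new inj
    by (simp add: sum.reindex)
  also have "f (edge_coset (h ** flip)) = - f (edge_coset h)"
    using f edge_coset_in_edges[OF h] by (simp add: reverse_edge_coset[symmetric] harmonic_cochain_def)
  finally show ?thesis by simp
qed

section \<open>Edges given by upper triangular matrices\<close>

definition upper_edge :: "int \<Rightarrow> 'k::field fls \<Rightarrow> ('k fls^2^2) set" where
  "upper_edge k u = edge_coset (mat2 (fls_X_intpow k) u 0 1)"

lemma upper_GL2: "mat2 (fls_X_intpow k) u 0 1 \<in> (GL2 :: ('k::field fls^2^2) set)"
  by (simp add: GL2_iff det_mat2)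

lemma upper_edge_in_edges: "upper_edge k u \<in> edges"
  unfolding upper_edge_def by (intro edge_coset_in_edges upper_GL2)

text \<open>The edge knows \<open>u\<close> only up to \<open>fls_X_intpow k\<close> times an
  integer (\<open>upper_edge_shift\<close>); the edges on the right refine \<open>u\<close> by one
  more digit.\<close>

lemma harmonic_upper_edge_sum:
  fixes f :: "('k::{field,finite} fls^2^2) set \<Rightarrow> 'r::comm_ring_1"
  assumes "harmonic_cochain f"
  shows "f (upper_edge k u) = (\<Sum>c\<in>UNIV. f (upper_edge (k + 1) (u + fls_const c * fls_X_intpow k)))"
proof -
  have "mat2 (fls_X_intpow k) u 0 1 ** lower_rep c ** flip =
      mat2 (fls_X_intpow (k + 1)) (u + fls_const c * fls_X_intpow k) 0 1" for c :: 'k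
    by (simp add: mat2_mult mat2_eq_iff fls_X_times_conv_shift algebra_simps)
  then show ?thesis
    using harmonic_edge_sum[OF assms upper_GL2[of k u]] by (simp add: upper_edge_def)
qed

lemma upper_edge_shift:
  assumes "y \<in> integers_inf"
  shows "upper_edge k (u + fls_X_intpow k * y) = upper_edge k u"
proof -
  have "mat2 1 y 0 1 \<in> iwahori"
    using assms by (auto simp: iwahori_mat2 intro!: bexI[of _ 0])
  moreover have "mat2 (fls_X_intpow k) u 0 1 ** mat2 1 y 0 1 = mat2 (fls_X_intpow k) (u + fls_X_intpow k * y) 0 1"
    by (simp add: mat2_mult mat2_eq_iff add.commute)
  ultimately show ?thesis unfolding upper_edge_def using edge_coset_iwahori by metis
qed

lemma upper_edge_scale:
  assumes "c \<noteq> 0"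
  shows "act (mat2 (fls_const c) 0 0 1) (upper_edge k u) = upper_edge k (fls_const c * u)"
proof -
  have "mat2 (fls_const c) 0 0 1 \<in> iwahori"
    using assms by (auto simp: iwahori_mat2 intro!: bexI[of _ 0])
  moreover have "mat2 (fls_const c) 0 0 1 ** mat2 (fls_X_intpow k) u 0 1 =
      mat2 (fls_X_intpow k) (fls_const c * u) 0 1 ** mat2 (fls_const c) 0 0 1"
    by (simp add: mat2_mult mat2_eq_iff mult.commute)
  ultimately show ?thesis unfolding upper_edge_def act_edge_coset by (simp add: edge_coset_iwahori)
qed

lemma upper_edge_translate: "act (mat2 1 t 0 1) (upper_edge k u) = upper_edge k (u + t)"
  unfolding upper_edge_def act_edge_coset by (simp add: mat2_mult add.commute)

lemma edge_coset_upper: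
  assumes "d \<noteq> 0" "a * d - b * c \<noteq> 0" "\<exists>x\<in>integers_inf. c / d = fls_X * x"
  shows "\<exists>k u. edge_coset (mat2 a b c d) = upper_edge k u"
proof -
  \<comment> \<open>The determinant divided by \<open>d * d\<close>. Its unit part
    \<open>\<epsilon>\<close> is absorbed by the Iwahori subgroup, so that only the valuation
    \<open>k\<close> remains.\<close>
  define y where "y = (a - b * c / d) / d"
  define k where "k = fls_subdegree y"
  define \<epsilon> where "\<epsilon> = fls_shift k y"
  have y: "y \<noteq> 0" using assms(1,2) by (auto simp: y_def field_simps)
  have ye: "fls_X_intpow k * \<epsilon> = y"
    by (simp add: \<epsilon>_def fls_X_intpow_times_conv_shift)
  have "\<epsilon> \<noteq> 0" "fls_subdegree \<epsilon> = 0"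
    using y by (simp_all add: \<epsilon>_def k_def fls_X_intpow_times_conv_shift fls_shift_eq0_iff)
  then have "mat2 \<epsilon> 0 (c / d) 1 \<in> iwahori"
    using assms(3) by (simp add: iwahori_mat2) (simp add: integers_inf_def)
  moreover have "mat2 (fls_X_intpow k) (b / d) 0 1 ** mat d ** mat2 \<epsilon> 0 (c / d) 1 = mat2 a b c d"
  proof -
    have "fls_X_intpow k * d * \<epsilon> = d * y" by (simp add: ye[symmetric] mult_ac)
    also have "\<dots> = a - b * c / d" using assms(1) by (simp add: y_def)
    finally show ?thesis using assms(1) by (simp add: mat_eq_mat2 mat2_mult mat2_eq_iff)
  qed
  ultimately show ?thesis unfolding upper_edge_def using edge_coset_absorb[OF assms(1)] by metis
qed

text \<open>If \<open>c / d\<close> is not divisible by \<open>fls_X\<close>, then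
  \<open>d / c\<close> is integral. Reversal exchanges the two columns up to a factor
  \<open>fls_X\<close>, hence makes the edge upper triangular.\<close>

lemma edge_cases:
  assumes "e \<in> edges"
  obtains k u where "e = upper_edge k u" | k u where "e = reverse_edge (upper_edge k u)"
proof -
  obtain g where g: "g \<in> GL2" "e = edge_coset g" using assms by (rule edgesE)
  obtain a b c d where m: "g = mat2 a b c d" by (rule mat2_cases)
  have det: "a * d - b * c \<noteq> 0" using g by (simp add: m GL2_iff det_mat2)
  show thesis
  proof (cases "d \<noteq> 0 \<and> (\<exists>x\<in>integers_inf. c / d = fls_X * x)")
    case True
    then show thesis using edge_coset_upper[of d a b c] det that(1) g m by blast
  next
    case False
    have c: "c \<noteq> 0" using det False by (cases "d = 0") (auto intro!: bexI[of _ 0])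
    have dc: "d / c \<in> integers_inf"
    proof (cases "d = 0")
      case nz: False
      then have "\<exists>i<1. fls_nth (c / d) i \<noteq> 0"
        using False fls_X_times_integers_iff[of "c / d"] by blast
      then have "fls_subdegree (c / d) < 1" using fls_subdegree_leI by fastforce
      moreover have "c / d * (d / c) = 1" using c nz by simp
      then have "fls_subdegree (c / d) + fls_subdegree (d / c) = 0"
        using c nz fls_subdegree_mult[of "c / d" "d / c"] by (simp del: times_divide_times_eq)
      ultimately show ?thesis by (simp add: integers_inf_def)
    qed auto
    have "\<exists>x\<in>integers_inf. fls_X * d / c = fls_X * x"
      using dc by (intro bexI[of _ "d / c"]) auto
    moreover have "fls_X * b * c - a * (fls_X * d) \<noteq> 0"
    proof -
      have "fls_X * b * c - a * (fls_X * d) = - (fls_X * (a * d - b * c))" by (simp add: algebra_simps)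
      then show ?thesis using det by simp
    qed
    ultimately obtain k u where ku: "edge_coset (mat2 (fls_X * b) a (fls_X * d) c) = upper_edge k u"
      using edge_coset_upper[OF c] by blast
    have "g ** flip = mat2 (fls_X * b) a (fls_X * d) c" by (simp add: m mat2_mult mat2_eq_iff mult.commute)
    then have "reverse_edge e = upper_edge k u" using ku g(2) by (simp add: reverse_edge_coset)
    then have "e = reverse_edge (upper_edge k u)" using reverse_reverse g(2) by metis
    then show thesis by (rule that(2))
  qed
qed

lemma harmonic_eq_zeroI:
  assumes "harmonic_cochain f" "\<And>k u. f (upper_edge k u) = 0" "e \<in> edges"
  shows "f e = 0"
  using assms(3)
proof (cases rule: edge_cases)
  case (2 k u)
  then show ?thesis
    using bspec[OF conjunct1[OF assms(1)[unfolded harmonic_cochain_def]] upper_edge_in_edges] assms(2)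
    by simp
qed (use assms(2) in simp)

section \<open>Fourier expansion\<close>

lemma GL2_iff_unit: "(M :: 'a::comm_ring_1^2^2) \<in> GL2 \<longleftrightarrow> det M dvd 1"
proof
  assume "M \<in> GL2"
  then obtain N where "M ** N = mat 1" unfolding GL2_def invertible_def by auto
  then have "det M * det N = 1" by (metis det_mul det_I)
  then show "det M dvd 1" by (rule dvdI[OF sym])
next
  assume "det M dvd 1"
  then obtain r where r: "1 = det M * r" by (rule dvdE)
  obtain a b c d where M: "M = mat2 a b c d" by (rule mat2_cases)
  have r': "a * d * r - b * c * r = 1" using r[symmetric] by (simp add: M det_mat2 left_diff_distrib)
  have "M ** mat2 (r * d) (- r * b) (- r * c) (r * a) = mat 1"
    "mat2 (r * d) (- r * b) (- r * c) (r * a) ** M = mat 1"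
    using r' by (simp_all add: M mat2_mult mat_eq_mat2 mat2_eq_iff algebra_simps)
  then show "M \<in> GL2" unfolding GL2_def invertible_def by blast
qed

lemma emb_pCons: "emb (pCons c a) = fls_const c + fls_X_inv * emb a"
  by (simp add: emb_def map_poly_pCons)

lemma emb_0 [simp]: "emb 0 = 0"
  by (simp add: emb_def)

lemma emb_nth: "fls_nth (emb a) i = (if i \<le> 0 then coeff a (nat (- i)) else 0)"
proof (induction a arbitrary: i)
  case (pCons c a)
  show ?case
  proof (cases "i < 0")
    case True
    then have "nat (- i) = Suc (nat (- (i + 1)))" by simp
    then show ?thesis using True by (simp add: emb_pCons fls_X_inv_times_conv_shift pCons.IH)
  next
    case False
    then show ?thesis by (cases "i = 0") (simp_all add: emb_pCons fls_X_inv_times_conv_shift pCons.IH)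
  qed
qed simp

lemma emb_add: "emb (a + b) = emb a + emb b"
  by (rule fls_eqI) (simp add: emb_nth)

lemma emb_uminus: "emb (- a) = - emb a"
  by (rule fls_eqI) (simp add: emb_nth)

lemma emb_diff: "emb (a - b) = emb a - emb b"
  by (rule fls_eqI) (simp add: emb_nth)

lemma emb_smult: "emb (smult c a) = fls_const c * emb a"
  by (rule fls_eqI) (simp add: emb_nth)

lemma emb_const: "emb [:c:] = fls_const c"
  by (simp add: emb_pCons)

lemma emb_1 [simp]: "emb 1 = 1"
  using emb_const[of 1] by (simp add: pCons_one)

lemma emb_mult: "emb (a * b) = emb a * emb b"
  by (induction a) (simp_all add: emb_pCons emb_add emb_smult algebra_simps)

lemma emb_eq_iff [simp]: "emb a = emb b \<longleftrightarrow> a = b"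
proof
  assume *: "emb a = emb b"
  have "coeff a i = coeff b i" for i
    using arg_cong[OF *, of "\<lambda>x. fls_nth x (- int i)"] by (simp add: emb_nth)
  then show "a = b" by (rule poly_eqI)
qed simp

lemma emb_eq_0_iff [simp]: "emb a = 0 \<longleftrightarrow> a = 0"
  using emb_eq_iff[of a 0] by simp

lemma emb_pCons_mult: "emb (pCons c a) * u = fls_const c * u + fls_shift 1 (emb a * u)"
  unfolding emb_pCons distrib_right mult.assoc by (simp only: fls_X_inv_times_conv_shift)

text \<open>Multiplication by the variable of \<open>A\<close> shifts degrees down by one, so the
  coefficient in degree \<open>n\<close> of the product sees only the coefficients of
  \<open>u\<close> from \<open>n\<close> up to \<open>n + degree m\<close>.\<close>

lemma emb_mult_nth_eq_0:
  "(\<And>i. n \<le> i \<Longrightarrow> i \<le> n + int (degree m) \<Longrightarrow> fls_nth u i = 0) \<Longrightarrow> fls_nth (emb m * u) n = 0"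
proof (induction m arbitrary: n)
  case (pCons c a)
  have 0: "fls_nth u n = 0" by (rule pCons.prems) auto
  show ?case
  proof (cases "a = 0")
    case False
    then have "fls_nth (emb a * u) (n + 1) = 0"
      by (intro pCons.IH pCons.prems) auto
    then show ?thesis using 0 by (simp add: emb_pCons_mult)
  qed (use 0 in \<open>simp add: emb_pCons\<close>)
qed simp

lemma emb_monom_mult_nth: "fls_nth (emb (monom c j) * u) i = c * fls_nth u (i + int j)"
proof (induction j arbitrary: i)
  case (Suc j)
  show ?case
    by (simp add: monom_Suc emb_pCons_mult Suc add.assoc)
qed (simp add: monom_0 emb_const)

lemma emb_mat_mat2: "emb_mat (mat2 a b c d) = mat2 (emb a) (emb b) (emb c) (emb d)"
  by (simp add: emb_mat_def vec_eq_iff forall_2)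

lemma Gamma0_mat2: "mat2 a b c d \<in> Gamma0 n \<longleftrightarrow> (a * d - b * c) dvd 1 \<and> n dvd c"
  by (simp add: Gamma0_def GL2_iff_unit det_mat2)

section \<open>Residues modulo powers of the uniformizer\<close>

lemma pi_residues_nth:
  "u \<in> pi_residues k \<longleftrightarrow> (\<forall>i. i < 1 \<or> int k \<le> i \<longrightarrow> fls_nth u i = 0)"
  unfolding pi_residues_def mem_Collect_eq by (rule iff_allI) auto

lemma pi_residues_diff: "u \<in> pi_residues k \<Longrightarrow> v \<in> pi_residues k \<Longrightarrow> u - v \<in> pi_residues k"
  by (auto simp: pi_residues_nth)

lemma const_intpow_nth:
  "fls_nth (fls_const (c :: 'k::field) * fls_X_intpow k) i = (if i = k then c else 0)"
  by simp

text \<open>A residue is determined by its truncation and its digit in degree \<open>k\<close>. The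
  bound on \<open>k\<close> excludes degree 0, which does not occur in residues.\<close>

lemma pi_residues_Suc_bij:
  assumes "k \<ge> 1"
  shows "bij_betw (\<lambda>(u, c). u + fls_const c * fls_X_intpow (int k))
    (pi_residues k \<times> UNIV) (pi_residues (Suc k) :: 'k::field fls set)"
proof (rule bij_betwI')
  fix x y :: "'k fls \<times> 'k"
  assume "x \<in> pi_residues k \<times> UNIV" "y \<in> pi_residues k \<times> UNIV"
  then obtain u c u' c' where xy: "x = (u, c)" "y = (u', c')"
    and k: "fls_nth u (int k) = 0" "fls_nth u' (int k) = 0"
    by (auto simp: pi_residues_nth)
  have "c = c'" if "u + fls_const c * fls_X_intpow (int k) = u' + fls_const c' * fls_X_intpow (int k)"
    using arg_cong[OF that, of "\<lambda>v. fls_nth v (int k)"] k by (simp add: const_intpow_nth)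
  then show "((case x of (u, c) \<Rightarrow> u + fls_const c * fls_X_intpow (int k)) =
      (case y of (u, c) \<Rightarrow> u + fls_const c * fls_X_intpow (int k))) = (x = y)"
    unfolding xy by auto
next
  fix x :: "'k fls \<times> 'k" assume "x \<in> pi_residues k \<times> UNIV"
  then show "(case x of (u, c) \<Rightarrow> u + fls_const c * fls_X_intpow (int k)) \<in> pi_residues (Suc k)"
    using assms unfolding pi_residues_def by (auto simp: const_intpow_nth)
next
  fix u :: "'k fls" assume u: "u \<in> pi_residues (Suc k)"
  define c where "c = fls_nth u (int k)"
  define v where "v = u - fls_const c * fls_X_intpow (int k)"
  have "fls_nth v i = 0" if "i < 1 \<or> int k \<le> i" for i
  proof (cases "i = int k")
    case False
    then have "fls_nth u i = 0" using u that unfolding pi_residues_nth by auto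
    then show ?thesis using False by (simp add: v_def const_intpow_nth)
  qed (simp add: v_def c_def)
  then have "(v, c) \<in> pi_residues k \<times> UNIV" by (simp add: pi_residues_nth)
  moreover have "u = v + fls_const c * fls_X_intpow (int k)" by (simp add: v_def)
  ultimately show "\<exists>x\<in>pi_residues k \<times> UNIV. u = (case x of (u, c) \<Rightarrow> u + fls_const c * fls_X_intpow (int k))"
    by (intro bexI[of _ "(v, c)"]) simp_all
qed

lemma finite_pi_residues: "finite (pi_residues k :: 'k::{field,finite} fls set)"
proof (induction k)
  case 0
  have "pi_residues 0 \<subseteq> {0 :: 'k fls}"
  proof
    fix u :: "'k fls" assume "u \<in> pi_residues 0"
    then have "fls_nth u i = 0" for i by (cases "i < 1") (auto simp: pi_residues_nth)
    then show "u \<in> {0}" by (auto intro!: fls_eqI)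
  qed
  then show ?case by (rule finite_subset) simp
next
  case (Suc k)
  show ?case
  proof (cases "k = 0")
    case True
    have "pi_residues (Suc 0) \<subseteq> {0 :: 'k fls}"
    proof
      fix u :: "'k fls" assume "u \<in> pi_residues (Suc 0)"
      then have "fls_nth u i = 0" for i by (cases "i < 1") (auto simp: pi_residues_nth)
      then show "u \<in> {0}" by (auto intro!: fls_eqI)
    qed
    then show ?thesis using True finite_subset by auto
  next
    case False
    then show ?thesis
      using bij_betw_finite[OF pi_residues_Suc_bij[of k, where 'k='k]] Suc by simp
  qed
qed

text \<open>The series is cut at degrees 1 and \<open>k\<close>: polynomials occupy the nonpositive
  degrees, residues the degrees between the cuts, and the rest is the tail.\<close>

lemma fls_decomposition:
  fixes u :: "'k::field fls"
  assumes "k \<ge> 1"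
  obtains a r y where "r \<in> pi_residues k" "y \<in> integers_inf" "u = emb a + r + fls_X_intpow (int k) * y"
proof -
  obtain J :: nat where J: "\<forall>j>J. fls_nth u (- int j) = 0"
    by (rule fls_nth_vanishes_below_natE[of u])
  define a where "a = (\<Sum>j\<le>J. monom (fls_nth u (- int j)) j)"
  have "coeff a j = fls_nth u (- int j)" for j
  proof (cases "j \<le> J")
    case False
    then have "fls_nth u (- int j) = 0" using J by simp
    then show ?thesis using False by (simp add: a_def coeff_sum)
  qed (simp add: a_def coeff_sum)
  then have a: "fls_nth (emb a) i = (if i \<le> 0 then fls_nth u i else 0)" for i
    by (simp add: emb_nth)
  define r where "r = (\<Sum>j=1..<k. fls_const (fls_nth u (int j)) * fls_X_intpow (int j))"
  have r: "fls_nth r i = (if 1 \<le> i \<and> i < int k then fls_nth u i else 0)" for i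
  proof -
    have "fls_nth r i = (\<Sum>j=1..<k. if i = int j then fls_nth u (int j) else 0)"
      unfolding r_def fls_nth_sum by (intro sum.cong) auto
    also have "\<dots> = (\<Sum>j=1..<k. if j = nat i then (if 1 \<le> i \<and> i < int k then fls_nth u i else 0) else 0)"
      by (intro sum.cong) auto
    also have "\<dots> = (if 1 \<le> i \<and> i < int k then fls_nth u i else 0)"
      by (auto simp: sum.delta)
    finally show ?thesis .
  qed
  define y where "y = fls_shift (int k) (u - emb a - r)"
  have "y \<in> integers_inf"
    unfolding integers_inf_iff y_def by (auto simp: a r)
  moreover have "r \<in> pi_residues k" by (auto simp: pi_residues_nth r)
  moreover have "u = emb a + r + fls_X_intpow (int k) * y"
    by (simp add: y_def fls_X_intpow_times_conv_shift)
  ultimately show thesis using that by blast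
qed

section \<open>Orthogonality and Fourier inversion\<close>

locale coefficient_character =
  fixes \<phi> :: "'d::idom \<Rightarrow> 'r::comm_ring_1" and \<eta>\<^sub>0 :: "'k::{field,finite} \<Rightarrow> 'r"
  assumes R: "coefficient_ring CHAR('k) \<phi>" and char: "nontrivial_character \<eta>\<^sub>0"
begin

abbreviation \<psi> :: "'k poly \<Rightarrow> 'k fls \<Rightarrow> 'r" where
  "\<psi> m u \<equiv> eta \<eta>\<^sub>0 (emb m * u)"

lemma psi_add: "\<psi> m (u + v) = \<psi> m u * \<psi> m v"
  by (simp add: distrib_left eta_add[OF char])

text \<open>A product of two polynomials has no coefficient in degree 1, the only one that
  \<open>eta\<close> reads.\<close>

lemma psi_emb: "\<psi> m (emb a) = 1"
  by (rule eta_eq_1[OF char]) (simp add: emb_mult[symmetric] emb_nth)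

lemma psi_high:
  assumes "\<And>i. 1 \<le> i \<Longrightarrow> i \<le> 1 + int (degree m) \<Longrightarrow> fls_nth u i = 0"
  shows "\<psi> m u = 1"
  by (rule eta_eq_1[OF char]) (rule emb_mult_nth_eq_0[OF assms])

lemma unit_mult_eq_0:
  assumes "x dvd 1" "x * y = (0 :: 'r)" shows "y = 0"
proof -
  from assms(1) obtain r where r: "1 = x * r" by (rule dvdE)
  have "y * (x * r) = r * (x * y)" by (simp only: mult_ac)
  then show ?thesis unfolding r[symmetric] assms(2) by simp
qed

text \<open>Translating the summation variable by \<open>m0\<close> multiplies the sum by a
  character value whose difference from 1 is a unit.\<close>

lemma psi_orthogonal:
  assumes w: "w \<in> pi_residues (Suc d)" "w \<noteq> 0"
  shows "(\<Sum>m\<in>polys_below d. \<psi> m w) = 0"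
proof -
  obtain t where t: "(1 - \<eta>\<^sub>0 (abs_trace t)) dvd 1" using eta_nontrivial[OF char R] by blast
  obtain i where i: "fls_nth w i \<noteq> 0" using w(2) by (auto simp: fls_eq_iff)
  then have range: "1 \<le> i" "i \<le> int d" using w(1) by (auto simp: pi_residues_def)
  \<comment> \<open>This monomial moves the nonzero coefficient of \<open>w\<close> to degree 1 and
    rescales it to \<open>t\<close>; its exponent \<open>i - 1\<close> is below
    \<open>d\<close>.\<close>
  define m0 where "m0 = monom (t / fls_nth w i) (nat (i - 1))"
  have m0: "\<psi> m0 w = \<eta>\<^sub>0 (abs_trace t)"
    using i range by (simp add: eta_def m0_def emb_monom_mult_nth)
  have below: "m0 \<in> polys_below d" using range by (auto simp: polys_below_def m0_def)
  have "(\<Sum>m\<in>polys_below d. \<psi> m w) = (\<Sum>m\<in>polys_below d. \<psi> (m + m0) w)"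
    by (rule sum.reindex_bij_witness[of _ "\<lambda>m. m + m0" "\<lambda>m. m - m0"])
       (use below in \<open>auto simp: polys_below_def\<close>)
  also have "\<dots> = (\<Sum>m\<in>polys_below d. \<psi> m w) * \<eta>\<^sub>0 (abs_trace t)"
    by (simp add: emb_add distrib_right eta_add[OF char] m0 sum_distrib_right)
  finally have "(1 - \<eta>\<^sub>0 (abs_trace t)) * (\<Sum>m\<in>polys_below d. \<psi> m w) = 0"
    by (simp add: algebra_simps)
  then show ?thesis by (rule unit_mult_eq_0[OF t])
qed

text \<open>After the sums are exchanged, orthogonality leaves only \<open>v = u\<close>, which
  contributes once for each of the \<open>CARD('k) ^ d\<close> frequencies.\<close>

lemma fourier_inversion:
  assumes u: "u \<in> pi_residues (Suc d)"
  shows "of_nat (CARD('k) ^ d) * F u =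
    (\<Sum>m\<in>polys_below d. (\<Sum>v\<in>pi_residues (Suc d). F v * \<psi> m (- v)) * \<psi> m u)"
proof -
  have "(\<Sum>m\<in>polys_below d. (\<Sum>v\<in>pi_residues (Suc d). F v * \<psi> m (- v)) * \<psi> m u) =
      (\<Sum>m\<in>polys_below d. \<Sum>v\<in>pi_residues (Suc d). F v * \<psi> m (u - v))"
    unfolding sum_distrib_right
  proof (intro sum.cong refl)
    fix m v
    show "F v * \<psi> m (- v) * \<psi> m u = F v * \<psi> m (u - v)"
      using psi_add[of m u "- v"] by (simp add: mult_ac)
  qed
  also have "\<dots> = (\<Sum>v\<in>pi_residues (Suc d). F v * (\<Sum>m\<in>polys_below d. \<psi> m (u - v)))"
    by (subst sum.swap) (simp only: sum_distrib_left)
  also have "\<dots> = (\<Sum>v\<in>pi_residues (Suc d). if v = u then F u * of_nat (CARD('k) ^ d) else 0)"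
  proof (intro sum.cong refl)
    fix v :: "'k fls" assume v: "v \<in> pi_residues (Suc d)"
    have "\<psi> m 0 = 1" for m using psi_emb[of m 0] by simp
    then show "F v * (\<Sum>m\<in>polys_below d. \<psi> m (u - v)) = (if v = u then F u * of_nat (CARD('k) ^ d) else 0)"
      using psi_orthogonal[OF pi_residues_diff[OF u v]]
      by (auto simp: card_polys_below)
  qed
  also have "\<dots> = F u * of_nat (CARD('k) ^ d)"
    using u by (simp add: finite_pi_residues)
  finally show ?thesis by (simp add: mult.commute)
qed

text \<open>This is the operator \<open>D_i\<close>, read on the upper right entry of an upper
  triangular edge, where translation is addition.\<close>

definition shift_diff :: "'k poly \<Rightarrow> ('k fls \<Rightarrow> 'r) \<Rightarrow> 'k fls \<Rightarrow> 'r" where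
  "shift_diff p F u = of_nat (CARD('k) ^ degree p) * F u -
     (\<Sum>a\<in>polys_below (degree p). F (u + emb a / emb p))"

text \<open>The scalar by which \<open>shift_diff p\<close> acts on the character
  \<open>\<psi> m\<close>, because \<open>\<psi> m\<close> turns addition into
  multiplication.\<close>

definition eigenvalue :: "'k poly \<Rightarrow> 'k poly \<Rightarrow> 'r" where
  "eigenvalue p m = of_nat (CARD('k) ^ degree p) - (\<Sum>a\<in>polys_below (degree p). \<psi> m (emb a / emb p))"

lemma shift_diff_expansion:
  "shift_diff p (\<lambda>u. \<Sum>m\<in>M. c m * \<psi> m u) = (\<lambda>u. \<Sum>m\<in>M. (c m * eigenvalue p m) * \<psi> m u)"
proof
  fix u
  have "shift_diff p (\<lambda>u. \<Sum>m\<in>M. c m * \<psi> m u) u =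
      (\<Sum>m\<in>M. of_nat (CARD('k) ^ degree p) * (c m * \<psi> m u) -
        (\<Sum>a\<in>polys_below (degree p). c m * \<psi> m (u + emb a / emb p)))"
    unfolding shift_diff_def sum_subtractf sum_distrib_left by (subst sum.swap) (rule refl)
  also have "\<dots> = (\<Sum>m\<in>M. (c m * eigenvalue p m) * \<psi> m u)"
  proof (intro sum.cong refl)
    fix m
    have "(\<Sum>a\<in>polys_below (degree p). c m * \<psi> m (u + emb a / emb p)) =
        c m * \<psi> m u * (\<Sum>a\<in>polys_below (degree p). \<psi> m (emb a / emb p))"
      by (simp only: psi_add sum_distrib_left mult.assoc)
    then show "of_nat (CARD('k) ^ degree p) * (c m * \<psi> m u) -
        (\<Sum>a\<in>polys_below (degree p). c m * \<psi> m (u + emb a / emb p)) =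
        (c m * eigenvalue p m) * \<psi> m u"
      by (simp add: eigenvalue_def algebra_simps)
  qed
  finally show "shift_diff p (\<lambda>u. \<Sum>m\<in>M. c m * \<psi> m u) u = (\<Sum>m\<in>M. (c m * eigenvalue p m) * \<psi> m u)" .
qed

lemma shift_diff_scale: "shift_diff p (\<lambda>u. a * F u) = (\<lambda>u. a * shift_diff p F u)"
  unfolding shift_diff_def sum_distrib_left[symmetric]
  by (rule ext) (simp only: right_diff_distrib mult.left_commute)

text \<open>If \<open>p\<close> divides \<open>m\<close>, then
  \<open>emb m * (emb a / emb p)\<close> is a polynomial; all characters in the sum are 1 and their
  number cancels the first term.\<close>

lemma eigenvalue_eq_0:
  assumes "p dvd m" "p \<noteq> 0" shows "eigenvalue p m = 0"
proof -
  from assms(1) obtain l where l: "m = p * l" by (rule dvdE)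
  have "\<psi> m (emb a / emb p) = 1" for a
  proof -
    have "emb m * (emb a / emb p) = emb l * emb a" using assms(2) by (simp add: l emb_mult)
    then show ?thesis using psi_emb[of l a] by simp
  qed
  then show ?thesis by (simp add: eigenvalue_def card_polys_below)
qed

lemma unit_inverse_mult: "x dvd 1 \<Longrightarrow> x * unit_inverse x = (1 :: 'r)"
proof -
  assume "x dvd 1"
  then obtain r where r: "1 = x * r" by (rule dvdE)
  have uniq: "y = r" if "x * y = 1" for y
  proof -
    have "y * (x * r) = r * (x * y)" by (simp only: mult_ac)
    then show ?thesis unfolding r[symmetric] that by simp
  qed
  have "unit_inverse x = r" unfolding unit_inverse_def
    by (rule the_equality) (rule r[symmetric], rule uniq)
  then show ?thesis using r[symmetric] by simp
qed

text \<open>The Fourier coefficient without its normalising factor and at an arbitrary depth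
  \<open>k\<close>. The coefficient itself has depth \<open>2 + degree m\<close>; greater depths
  give the same value by \<open>fourier_sum_stable\<close>.\<close>

definition fourier_sum :: "(('k fls^2^2) set \<Rightarrow> 'r) \<Rightarrow> nat \<Rightarrow> 'k poly \<Rightarrow> 'r" where
  "fourier_sum f k m = (\<Sum>u\<in>pi_residues k. f (upper_edge (int k) u) * \<psi> m (- u))"

lemma fourier_sum_eq_0:
  assumes "fourier_coeff \<eta>\<^sub>0 f m = 0"
  shows "fourier_sum f (2 + degree m) m = 0"
proof -
  let ?x = "of_nat (CARD('k) ^ (1 + degree m)) :: 'r"
  have "fls_X ^ (2 + degree m) = (fls_X_intpow (int (2 + degree m)) :: 'k fls)"
    by (rule fls_X_power_conv_shift_1)
  then have "fourier_coeff \<eta>\<^sub>0 f m = unit_inverse ?x * fourier_sum f (2 + degree m) m"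
    unfolding fourier_coeff_def fourier_sum_def upper_edge_def by simp
  then have "(?x * unit_inverse ?x) * fourier_sum f (2 + degree m) m = ?x * fourier_coeff \<eta>\<^sub>0 f m"
    by (simp only: mult.assoc)
  then show ?thesis
    using assms by (simp only: unit_inverse_mult[OF CARD_power_unit[OF R]]) simp
qed

text \<open>The new digit lies in a degree beyond those that \<open>\<psi> m\<close> sees, so the
  inner sum over it collapses by harmonicity.\<close>

lemma fourier_sum_Suc:
  assumes f: "harmonic_cochain f" and k: "k \<ge> 2 + degree m"
  shows "fourier_sum f (Suc k) m = fourier_sum f k m"
proof -
  have k1: "k \<ge> 1" using k by simp
  have "fourier_sum f (Suc k) m = (\<Sum>(u, c)\<in>pi_residues k \<times> UNIV.
      f (upper_edge (int k + 1) (u + fls_const c * fls_X_intpow (int k))) *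
      \<psi> m (- (u + fls_const c * fls_X_intpow (int k))))"
    unfolding fourier_sum_def
    by (subst sum.reindex_bij_betw[OF pi_residues_Suc_bij[OF k1], symmetric])
       (simp add: case_prod_unfold add.commute)
  also have "\<dots> = (\<Sum>(u, c)\<in>pi_residues k \<times> UNIV.
      f (upper_edge (int k + 1) (u + fls_const c * fls_X_intpow (int k))) * \<psi> m (- u))"
  proof (intro sum.cong refl, clarify)
    fix u c
    have "\<psi> m (- (fls_const c * fls_X_intpow (int k))) = 1"
      by (rule psi_high) (use k in auto)
    then have "\<psi> m (- (u + fls_const c * fls_X_intpow (int k))) = \<psi> m (- u)"
      using psi_add[of m "- u" "- (fls_const c * fls_X_intpow (int k))"] by simp
    then show "f (upper_edge (int k + 1) (u + fls_const c * fls_X_intpow (int k))) *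
        \<psi> m (- (u + fls_const c * fls_X_intpow (int k))) =
        f (upper_edge (int k + 1) (u + fls_const c * fls_X_intpow (int k))) * \<psi> m (- u)" by simp
  qed
  also have "\<dots> = (\<Sum>u\<in>pi_residues k. (\<Sum>c\<in>UNIV.
      f (upper_edge (int k + 1) (u + fls_const c * fls_X_intpow (int k)))) * \<psi> m (- u))"
    unfolding sum.cartesian_product[symmetric] sum_distrib_right ..
  also have "\<dots> = fourier_sum f k m"
    unfolding fourier_sum_def harmonic_upper_edge_sum[OF f, symmetric] ..
  finally show ?thesis .
qed

lemma fourier_sum_stable:
  assumes "harmonic_cochain f" "k \<ge> 2 + degree m"
  shows "fourier_sum f k m = fourier_sum f (2 + degree m) m"
  using assms(2) by (induction k rule: dec_induct) (auto simp: fourier_sum_Suc[OF assms(1)])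

end

lemma Gamma0_upper_edge:
  fixes f :: "('k::field fls^2^2) set \<Rightarrow> 'r::comm_ring_1"
  assumes f: "f \<in> harmonic_cochains n"
  shows "f (upper_edge k (u + emb a)) = f (upper_edge k u)"
    and "c \<noteq> 0 \<Longrightarrow> f (upper_edge k (fls_const c * u)) = f (upper_edge k u)"
proof -
  have inv: "f (act (emb_mat \<gamma>) (upper_edge k u)) = f (upper_edge k u)" if "\<gamma> \<in> Gamma0 n" for \<gamma>
    using f that upper_edge_in_edges by (auto simp: harmonic_cochains_def slash_def)
  show "f (upper_edge k (u + emb a)) = f (upper_edge k u)"
    using inv[of "mat2 1 a 0 1"] by (simp add: Gamma0_mat2 emb_mat_mat2 upper_edge_translate)
  have "[:c:] dvd 1" if "c \<noteq> 0" using that by (simp add: is_unit_pCons_iff)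
  then show "f (upper_edge k (fls_const c * u)) = f (upper_edge k u)" if "c \<noteq> 0"
    using inv[of "mat2 [:c:] 0 0 1"] that
    by (simp add: Gamma0_mat2 emb_mat_mat2 upper_edge_scale emb_const)
qed

context coefficient_character begin

text \<open>Rescaling of the summation variable by a constant unit. It reduces nonzero frequencies
  to monic ones, about which the vanishing hypothesis speaks.\<close>

lemma fourier_sum_smult:
  assumes f: "f \<in> harmonic_cochains n" and c: "c \<noteq> 0"
  shows "fourier_sum f k (smult c m) = fourier_sum f k m"
proof -
  have "fourier_sum f k (smult c m) =
      (\<Sum>u\<in>pi_residues k. f (upper_edge (int k) (fls_const c * u)) * \<psi> m (- (fls_const c * u)))"
    unfolding fourier_sum_def Gamma0_upper_edge(2)[OF f c]
    by (simp add: emb_smult mult_ac)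
  also have "\<dots> = fourier_sum f k m"
    unfolding fourier_sum_def
    by (rule sum.reindex_bij_witness[of _ "\<lambda>u. fls_const (inverse c) * u" "\<lambda>u. fls_const c * u"])
       (use c in \<open>auto simp: pi_residues_nth fls_const_mult_const mult.assoc[symmetric]\<close>)
  finally show ?thesis .
qed

text \<open>Residues at depth \<open>Suc d\<close> have \<open>d\<close> digits, matching the
  \<open>d\<close> coefficients of a frequency. The polynomial part and the tail of \<open>u\<close>
  affect neither the value on the edge nor the characters.\<close>

lemma upper_edge_expansion:
  assumes f: "f \<in> harmonic_cochains n" and d: "d > 0"
  shows "of_nat (CARD('k) ^ d) * f (upper_edge (int (Suc d)) u) =
    (\<Sum>m\<in>polys_below d. fourier_sum f (Suc d) m * \<psi> m u)"
proof -
  have "1 \<le> Suc d" by simp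
  then obtain a r y where *: "r \<in> pi_residues (Suc d)" "y \<in> integers_inf"
      "u = emb a + r + fls_X_intpow (int (Suc d)) * y"
    by (rule fls_decomposition)
  have u: "u = r + emb a + fls_X_intpow (int (Suc d)) * y" unfolding *(3) by (simp only: add_ac)
  have "f (upper_edge (int (Suc d)) u) = f (upper_edge (int (Suc d)) (r + emb a))"
    unfolding u upper_edge_shift[OF *(2)] ..
  then have fu: "f (upper_edge (int (Suc d)) u) = f (upper_edge (int (Suc d)) r)"
    unfolding Gamma0_upper_edge(1)[OF f] .
  have psi: "\<psi> m u = \<psi> m r" if "m \<in> polys_below d" for m
  proof -
    have "\<psi> m (fls_X_intpow (int (Suc d)) * y) = 1"
    proof (rule psi_high)
      fix i assume i: "1 \<le> i" "i \<le> 1 + int (degree m)"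
      \<comment> \<open>Positivity of \<open>d\<close> enters for \<open>m = 0\<close>, whose degree
        is 0.\<close>
      have "degree m < d" using that d by (cases d) (auto simp: polys_below_iff_degree)
      then have "i - int (Suc d) < 0" using i by linarith
      then show "fls_nth (fls_X_intpow (int (Suc d)) * y) i = 0"
        using *(2) unfolding fls_X_intpow_times_conv_shift integers_inf_iff by simp
    qed
    then show ?thesis using psi_emb[of m a] by (simp only: u psi_add mult_1_right)
  qed
  have "(\<Sum>m\<in>polys_below d. fourier_sum f (Suc d) m * \<psi> m u) =
      (\<Sum>m\<in>polys_below d. fourier_sum f (Suc d) m * \<psi> m r)"
    by (intro sum.cong refl) (simp only: psi)
  then show ?thesis
    using fourier_inversion[OF *(1), of "\<lambda>u. f (upper_edge (int (Suc d)) u)"]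
    unfolding fu fourier_sum_def by simp
qed

end

section \<open>Averages over translations\<close>

abbreviation unip :: "'k::field fls \<Rightarrow> 'k fls^2^2" where
  "unip t \<equiv> mat2 1 t 0 1"

abbreviation lower_unip :: "'k::field poly \<Rightarrow> 'k fls^2^2" where
  "lower_unip c \<equiv> mat2 1 0 (emb c) 1"

lemma unip_GL2: "unip t \<in> GL2" and lower_unip_GL2: "lower_unip c \<in> GL2"
  by (simp_all add: GL2_iff det_mat2)

text \<open>The average \<open>e_i\<close> multiplied by \<open>q_i\<close>: the polynomials in the
  sum, divided by \<open>p\<close>, represent the translations by fractions with denominator
  \<open>p\<close> modulo those by \<open>A\<close>.\<close>

definition avg :: "'k::{field,finite} poly \<Rightarrow> (('k fls^2^2) set \<Rightarrow> 'r::comm_ring_1) \<Rightarrow> ('k fls^2^2) set \<Rightarrow> 'r" where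
  "avg p F e = (\<Sum>a\<in>polys_below (degree p). F (act (unip (emb a / emb p)) e))"

text \<open>This is \<open>D_i\<close> acting on cochains.\<close>

definition defect :: "'k::{field,finite} poly \<Rightarrow> (('k fls^2^2) set \<Rightarrow> 'r::comm_ring_1) \<Rightarrow> ('k fls^2^2) set \<Rightarrow> 'r" where
  "defect p F e = of_nat (CARD('k) ^ degree p) * F e - avg p F e"

lemma harmonic_defect:
  assumes "harmonic_cochain F" shows "harmonic_cochain (defect p F)"
proof -
  have "harmonic_cochain (\<lambda>e. \<Sum>a\<in>polys_below (degree p). slash F (unip (emb a / emb p)) e)"
    by (intro harmonic_sum harmonic_slash assms unip_GL2)
  then show ?thesis
    unfolding defect_def[abs_def] avg_def slash_def by (rule harmonic_diff[OF harmonic_scale[OF assms]])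
qed

lemma defect_cong:
  assumes "\<And>e. e \<in> edges \<Longrightarrow> F e = F' e" "e \<in> edges"
  shows "defect p F e = defect p F' e"
proof -
  have "avg p F e = avg p F' e"
    unfolding avg_def by (intro sum.cong refl assms(1) act_in_edges unip_GL2 assms(2))
  then show ?thesis using assms by (simp add: defect_def)
qed

context coefficient_character begin

lemma defect_upper_edge:
  "(\<lambda>u. defect p F (upper_edge k u)) = shift_diff p (\<lambda>u. F (upper_edge k u))"
  by (rule ext) (simp add: defect_def avg_def shift_diff_def upper_edge_translate)

text \<open>In the Fourier expansion a frequency divisible by one of the three polynomials has a
  vanishing eigenvalue, and any other frequency has a vanishing coefficient after passing to its
  monic multiple.\<close>

lemma triple_defect_eq_0:
  assumes f: "f \<in> harmonic_cochains n" and nz: "p1 \<noteq> 0" "p2 \<noteq> 0" "p3 \<noteq> 0"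
    and vanish: "\<And>m. monic m \<Longrightarrow> \<not> p1 dvd m \<Longrightarrow> \<not> p2 dvd m \<Longrightarrow> \<not> p3 dvd m \<Longrightarrow>
      fourier_coeff \<eta>\<^sub>0 f m = 0"
    and e: "e \<in> edges"
  shows "defect p1 (defect p2 (defect p3 f)) e = 0"
proof -
  let ?G = "defect p1 (defect p2 (defect p3 f))"
  have harm: "harmonic_cochain f" using f by (simp add: harmonic_cochains_def)
  then have G: "harmonic_cochain ?G" by (intro harmonic_defect)
  have large: "?G (upper_edge (int (Suc d)) u) = 0" if d: "d > 0" for d u
  proof -
    let ?q = "of_nat (CARD('k) ^ d) :: 'r"
    let ?F = "\<lambda>u. f (upper_edge (int (Suc d)) u)"
    let ?c = "fourier_sum f (Suc d)"
    have c0: "?c m * eigenvalue p3 m * eigenvalue p2 m * eigenvalue p1 m = 0" if m: "m \<in> polys_below d" for m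
    proof (cases "p1 dvd m \<or> p2 dvd m \<or> p3 dvd m")
      case True
      then show ?thesis using eigenvalue_eq_0[OF _ nz(1)] eigenvalue_eq_0[OF _ nz(2)]
          eigenvalue_eq_0[OF _ nz(3)] by auto
    next
      case False
      then have "m \<noteq> 0" by auto
      define c where "c = lead_coeff m"
      define m0 where "m0 = smult (inverse c) m"
      have c: "c \<noteq> 0" using \<open>m \<noteq> 0\<close> by (simp add: c_def)
      then have m0: "m = smult c m0" by (simp add: m0_def)
      have mon: "monic m0" using c by (simp add: monic_def m0_def c_def)
      have ndvd: "\<not> p dvd m0" if "\<not> p dvd m" for p using that dvd_smult[of p m0 c] m0 by auto
      have deg: "degree m0 = degree m" using c by (simp add: m0)
      have "degree m < d" using m d by (cases d) (auto simp: polys_below_iff_degree)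
      then have "fourier_sum f (Suc d) m0 = fourier_sum f (2 + degree m0) m0"
        using deg by (intro fourier_sum_stable[OF harm]) simp
      also have "\<dots> = 0"
        using mon ndvd False by (intro fourier_sum_eq_0 vanish) auto
      finally have "?c m = 0" using fourier_sum_smult[OF f c] m0 by simp
      then show ?thesis by simp
    qed
    have "(\<lambda>u. ?q * ?F u) = (\<lambda>u. \<Sum>m\<in>polys_below d. ?c m * \<psi> m u)"
      by (rule ext) (rule upper_edge_expansion[OF f d])
    then have "shift_diff p1 (shift_diff p2 (shift_diff p3 (\<lambda>u. ?q * ?F u))) u =
        shift_diff p1 (shift_diff p2 (shift_diff p3 (\<lambda>u. \<Sum>m\<in>polys_below d. ?c m * \<psi> m u))) u"
      by (simp only:)
    also have "\<dots> = (\<Sum>m\<in>polys_below d.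
        (?c m * eigenvalue p3 m * eigenvalue p2 m * eigenvalue p1 m) * \<psi> m u)"
      by (simp only: shift_diff_expansion)
    also have "\<dots> = 0" by (intro sum.neutral ballI) (simp only: c0 mult_zero_left)
    finally have "?q * shift_diff p1 (shift_diff p2 (shift_diff p3 ?F)) u = 0"
      by (simp only: shift_diff_scale)
    then have "shift_diff p1 (shift_diff p2 (shift_diff p3 ?F)) u = 0"
      by (rule unit_mult_eq_0[OF CARD_power_unit[OF R]])
    then show ?thesis
      by (simp only: defect_upper_edge[symmetric])
  qed
  \<comment> \<open>Small depths follow by descending induction, as harmonicity expresses a value
    through values one level deeper.\<close>
  have "?G (upper_edge (2 - int j) u) = 0" for j u
  proof (induction j arbitrary: u)
    case 0
    then show ?case using large[of 1 u] by simp
  next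
    case (Suc j)
    have "2 - int (Suc j) + 1 = 2 - int j" by simp
    then show ?case using Suc harmonic_upper_edge_sum[OF G, of "2 - int (Suc j)" u]
      by (simp only: sum.neutral_const)
  qed
  note small = this
  have "?G (upper_edge k u) = 0" for k u
  proof (cases "k \<le> 2")
    case True
    then have "k = 2 - int (nat (2 - k))" by simp
    then show ?thesis using small by metis
  next
    case False
    then have "k = int (Suc (nat (k - 1)))" "nat (k - 1) > 0" by simp_all
    then show ?thesis using large by metis
  qed
  then show ?thesis by (rule harmonic_eq_zeroI[OF G _ e])
qed

end

section \<open>Levels and residues modulo a prime\<close>

definition level :: "'k::field poly \<Rightarrow> (('k fls^2^2) set \<Rightarrow> 'r) \<Rightarrow> bool" where
  "level n F \<longleftrightarrow> (\<forall>\<gamma>\<in>Gamma0 n. \<forall>e\<in>edges. F (act (emb_mat \<gamma>) e) = F e)"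

lemma levelD:
  assumes "level n F" "a * d - b * c dvd 1" "n dvd c" "e \<in> edges"
  shows "F (act (mat2 (emb a) (emb b) (emb c) (emb d)) e) = F e"
proof -
  have "mat2 a b c d \<in> Gamma0 n" using assms by (simp add: Gamma0_mat2)
  then show ?thesis using assms unfolding level_def by (simp flip: emb_mat_mat2)
qed

lemma levelI:
  assumes "\<And>a b c d e. a * d - b * c dvd 1 \<Longrightarrow> n dvd c \<Longrightarrow> e \<in> edges \<Longrightarrow>
    F (act (mat2 (emb a) (emb b) (emb c) (emb d)) e) = F e"
  shows "level n F"
  unfolding level_def
proof (intro ballI)
  fix \<gamma> e assume *: "\<gamma> \<in> Gamma0 n" "(e :: ('a fls^2^2) set) \<in> edges"
  obtain a b c d where g: "\<gamma> = mat2 a b c d" by (rule mat2_cases)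
  show "F (act (emb_mat \<gamma>) e) = F e"
    using * assms[of a d b c e] by (simp add: g emb_mat_mat2 Gamma0_mat2)
qed

lemma harmonic_cochains_iff: "f \<in> harmonic_cochains n \<longleftrightarrow> harmonic_cochain f \<and> level n f"
  by (simp add: harmonic_cochains_def level_def slash_def)

lemma polys_below_dvd_eq:
  fixes p :: "'k::field poly"
  assumes "s \<in> polys_below (degree p)" "t \<in> polys_below (degree p)" "p dvd s - t"
  shows "s = t"
proof (rule ccontr)
  assume "s \<noteq> t"
  then have "degree p \<le> degree (s - t)" using assms(3) by (simp add: dvd_imp_degree_le)
  then have "lead_coeff (s - t) = 0" using assms(1,2) by (simp add: polys_below_def)
  then show False using \<open>s \<noteq> t\<close> by (simp only: leading_coeff_0_iff right_minus_eq)
qed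

lemma mod_in_polys_below:
  fixes p :: "'k::field poly"
  assumes "p \<noteq> 0" shows "x mod p \<in> polys_below (degree p)"
proof (cases "x mod p = 0")
  case False
  then have "degree (x mod p) < degree p" using degree_mod_less[OF assms, of x] by simp
  then show ?thesis by (auto simp: polys_below_def coeff_eq_0)
qed (simp add: polys_below_def)

text \<open>Multiplication by \<open>a\<close> is injective on the finite set of remainders modulo
  \<open>p\<close>, hence surjective.\<close>

lemma prime_poly_solve:
  fixes p :: "'k::{field,finite} poly"
  assumes p: "prime_elem p" and a: "\<not> p dvd a"
  shows "\<exists>t\<in>polys_below (degree p). p dvd b - a * t"
proof -
  let ?S = "polys_below (degree p) :: 'k poly set"
  have p0: "p \<noteq> 0" using p by auto
  have mod: "x mod p \<in> ?S" for x by (rule mod_in_polys_below[OF p0])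
  have "inj_on (\<lambda>t. (a * t) mod p) ?S"
  proof (rule inj_onI)
    fix s t assume st: "s \<in> ?S" "t \<in> ?S" "(a * s) mod p = (a * t) mod p"
    then have "p dvd a * (s - t)" by (simp add: mod_eq_dvd_iff right_diff_distrib)
    then have "p dvd s - t" using p a by (simp add: prime_elem_dvd_mult_iff)
    then show "s = t" by (rule polys_below_dvd_eq[OF st(1,2)])
  qed
  moreover have "(\<lambda>t. (a * t) mod p) ` ?S \<subseteq> ?S" using mod by auto
  ultimately have "(\<lambda>t. (a * t) mod p) ` ?S = ?S"
    by (intro endo_inj_surj finite_polys_below)
  then have "b mod p \<in> (\<lambda>t. (a * t) mod p) ` ?S" using mod[of b] by (simp only:)
  then obtain t where t: "t \<in> ?S" "b mod p = (a * t) mod p" by (rule imageE)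
  then show ?thesis by (intro bexI[of _ t]) (simp_all only: mod_eq_dvd_iff)
qed

lemma ideal_norm_eq:
  fixes p :: "'k::{field,finite} poly"
  assumes "p \<noteq> 0"
  shows "ideal_norm p = CARD('k) ^ degree p"
proof -
  let ?S = "polys_below (degree p) :: 'k poly set"
  let ?r = "{(a, b). p dvd a - b}"
  have equiv: "equiv UNIV ?r"
  proof (rule equivI)
    show "sym ?r" unfolding sym_def by (simp add: dvd_diff_commute)
    show "trans ?r"
    proof (rule transI, clarify)
      fix a b c assume "p dvd a - b" "p dvd b - c"
      then have "p dvd (a - b) + (b - c)" by (rule dvd_add)
      then show "p dvd a - c" by simp
    qed
  qed (auto simp: refl_on_def)
  have "bij_betw (\<lambda>a. ?r `` {a}) ?S (UNIV // ?r)"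
  proof (rule bij_betw_imageI)
    show "inj_on (\<lambda>a. ?r `` {a}) ?S"
    proof (rule inj_onI)
      fix a b assume ab: "a \<in> ?S" "b \<in> ?S" "?r `` {a} = ?r `` {b}"
      then have "(a, b) \<in> ?r" using eq_equiv_class[OF ab(3) equiv] by auto
      then show "a = b" using polys_below_dvd_eq[OF ab(1,2)] by simp
    qed
    show "(\<lambda>a. ?r `` {a}) ` ?S = UNIV // ?r"
    proof
      show "UNIV // ?r \<subseteq> (\<lambda>a. ?r `` {a}) ` ?S"
      proof
        fix X assume "X \<in> UNIV // ?r"
        then obtain x where x: "X = ?r `` {x}" by (rule quotientE)
        have "(x, x mod p) \<in> ?r" by (simp add: mod_eq_dvd_iff[symmetric])
        then have "X = ?r `` {x mod p}" unfolding x by (rule equiv_class_eq[OF equiv])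
        moreover have "x mod p \<in> ?S" by (rule mod_in_polys_below[OF assms])
        ultimately show "X \<in> (\<lambda>a. ?r `` {a}) ` ?S" by blast
      qed
    qed (auto simp: quotient_def)
  qed
  then show ?thesis unfolding ideal_norm_def by (simp add: bij_betw_same_card[symmetric] card_polys_below)
qed

section \<open>Invariance under translations and descent of the level\<close>

text \<open>The conjugate \<open>B^-1 \<gamma> B\<close> with \<open>B = B_mat p\<close>. For
  \<open>\<gamma>\<close> in \<open>Gamma0 m\<close> it translates cochains of level
  \<open>p * m\<close>, and the first row of \<open>\<gamma>\<close> modulo \<open>p\<close> is the
  corresponding point of the projective line.\<close>

definition conj_mat :: "'k::field poly \<Rightarrow> 'k poly^2^2 \<Rightarrow> 'k fls^2^2" where
  "conj_mat p \<gamma> = mat2 (emb (\<gamma> $ 1 $ 1)) (emb (\<gamma> $ 1 $ 2) / emb p) (emb (p * \<gamma> $ 2 $ 1)) (emb (\<gamma> $ 2 $ 2))"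

lemma conj_mat_mat2:
  "conj_mat p (mat2 a b c d) = mat2 (emb a) (emb b / emb p) (emb (p * c)) (emb d)"
  by (simp add: conj_mat_def)

lemma conj_mat_mult:
  assumes "p \<noteq> 0" shows "conj_mat p (\<gamma> ** \<delta>) = conj_mat p \<gamma> ** conj_mat p \<delta>"
proof -
  obtain a b c d where g: "\<gamma> = mat2 a b c d" by (rule mat2_cases)
  obtain a' b' c' d' where d: "\<delta> = mat2 a' b' c' d'" by (rule mat2_cases)
  show ?thesis using assms
    by (simp add: g d mat2_mult conj_mat_mat2 mat2_eq_iff emb_add emb_mult field_simps)
qed

lemma conj_mat_unip: "conj_mat p (mat2 1 a 0 1) = unip (emb a / emb p)"
  by (simp add: conj_mat_mat2)

lemma conj_mat_lower: "conj_mat p (mat2 1 0 c 1) = lower_unip (p * c)"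
  by (simp add: conj_mat_mat2)

lemma conj_mat_1: "conj_mat p (mat 1) = mat 1"
  by (simp add: mat_eq_mat2 conj_mat_mat2)

lemma conj_mat_GL2:
  assumes "p \<noteq> 0" "\<gamma> \<in> Gamma0 m" shows "conj_mat p \<gamma> \<in> GL2"
proof -
  obtain a b c d where g: "\<gamma> = mat2 a b c d" by (rule mat2_cases)
  have "a * d - b * c \<noteq> 0" using assms(2) by (auto simp: g Gamma0_mat2)
  moreover have "det (conj_mat p \<gamma>) = emb (a * d - b * c)"
    using assms(1) by (simp add: g conj_mat_mat2 det_mat2 emb_mult emb_diff)
  ultimately show ?thesis by (simp add: GL2_iff)
qed

lemma Gamma0_mult:
  assumes "\<gamma> \<in> Gamma0 m" "\<delta> \<in> Gamma0 m" shows "\<gamma> ** \<delta> \<in> Gamma0 m"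
proof -
  obtain a b c d where g: "\<gamma> = mat2 a b c d" by (rule mat2_cases)
  obtain a' b' c' d' where d: "\<delta> = mat2 a' b' c' d'" by (rule mat2_cases)
  have "\<gamma> ** \<delta> \<in> GL2"
    using assms by (auto simp: Gamma0_def GL2_def invertible_mult)
  moreover have "m dvd (\<gamma> ** \<delta>) $ 2 $ 1"
    using assms by (simp add: g d Gamma0_mat2 mat2_mult)
  ultimately show ?thesis by (simp add: Gamma0_def)
qed

definition translation_invariant :: "'k::field poly \<Rightarrow> (('k fls^2^2) set \<Rightarrow> 'r) \<Rightarrow> bool" where
  "translation_invariant p F \<longleftrightarrow> (\<forall>a. \<forall>e\<in>edges. F (act (unip (emb a / emb p)) e) = F e)"

text \<open>\<open>Gamma0 (p * m)\<close> and the translations generate the conjugated group. If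
  \<open>p\<close> does not divide \<open>a\<close>, one translation splits off on the right;
  otherwise a translation on the left first makes the upper left entry prime to
  \<open>p\<close>.\<close>

lemma translation_invariant_conj_mat:
  fixes F :: "('k::{field,finite} fls^2^2) set \<Rightarrow> 'r"
  assumes p: "prime_elem p" and F: "level (p * m) F" "translation_invariant p F"
    and g: "\<gamma> \<in> Gamma0 m" and e: "e \<in> edges"
  shows "F (act (conj_mat p \<gamma>) e) = F e"
proof -
  have p0: "p \<noteq> 0" using p by auto
  have *: "F (act (conj_mat p (mat2 a b c d)) e) = F e"
    if asm: "a * d - b * c dvd 1" "m dvd c" "\<not> p dvd a" "e \<in> edges" for a b c d e
  proof -
    \<comment> \<open>With this \<open>t\<close>, splitting off the translation by
      \<open>t / p\<close> leaves an integral upper right entry \<open>s\<close>.\<close>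
    obtain t where t: "p dvd b - a * t" using prime_poly_solve[OF p asm(3)] by blast
    then obtain s where s: "b - a * t = p * s" by (rule dvdE)
    have bs: "b = a * t + p * s" using s by (simp add: algebra_simps)
    have "conj_mat p (mat2 a b c d) = mat2 (emb a) (emb s) (emb (p * c)) (emb (d - c * t)) ** unip (emb t / emb p)"
      using p0 by (simp add: conj_mat_mat2 mat2_mult mat2_eq_iff bs emb_add emb_mult emb_diff field_simps)
    moreover have "a * (d - c * t) - s * (p * c) = a * d - b * c"
      by (simp add: bs algebra_simps)
    then have "F (act (mat2 (emb a) (emb s) (emb (p * c)) (emb (d - c * t))) (act (unip (emb t / emb p)) e)) =
        F (act (unip (emb t / emb p)) e)"
      using asm by (intro levelD[OF F(1)] act_in_edges unip_GL2) auto
    ultimately show ?thesis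
      using F(2) asm(4) by (simp add: act_act translation_invariant_def)
  qed
  obtain a b c d where gd: "\<gamma> = mat2 a b c d" by (rule mat2_cases)
  have det: "a * d - b * c dvd 1" and c: "m dvd c" using g by (simp_all add: gd Gamma0_mat2)
  show ?thesis
  proof (cases "p dvd a")
    case False
    then show ?thesis unfolding gd using * det c e by blast
  next
    case True
    have "\<not> p dvd c"
    proof
      assume "p dvd c"
      then have "p dvd a * d - b * c" using True by (intro dvd_diff) auto
      then show False using det p dvd_trans by (metis not_prime_unit prime_elem_not_unit)
    qed
    \<comment> \<open>Adding the second row to the first is a translation after conjugation and
      moves the matrix into the case already settled.\<close>
    then have "\<not> p dvd a + c" using True by (simp add: dvd_add_right_iff)
    moreover have "(a + c) * d - (b + d) * c = a * d - b * c" by (simp add: algebra_simps)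
    ultimately have "F (act (conj_mat p (mat2 (a + c) (b + d) c d)) e) = F e"
      using det c e by (intro *) simp_all
    also have "mat2 (a + c) (b + d) c d = mat2 1 1 0 1 ** \<gamma>"
      by (simp add: gd mat2_mult mat2_eq_iff)
    also have "conj_mat p (mat2 1 1 0 1 ** \<gamma>) = unip (emb 1 / emb p) ** conj_mat p \<gamma>"
      by (simp only: conj_mat_mult[OF p0] conj_mat_unip)
    also have "F (act (unip (emb 1 / emb p) ** conj_mat p \<gamma>) e) = F (act (conj_mat p \<gamma>) e)"
      using F(2) act_in_edges[OF conj_mat_GL2[OF p0 g] e]
      unfolding translation_invariant_def act_act[symmetric] by blast
    finally show ?thesis .
  qed
qed

text \<open>The cochain \<open>g\<close> is \<open>F\<close> translated by the inverse of
  \<open>B_mat p\<close>; conjugation turns invariance under the conjugated group into level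
  \<open>m\<close>.\<close>

lemma translation_invariant_descends:
  fixes F :: "('k::{field,finite} fls^2^2) set \<Rightarrow> 'r::comm_ring_1"
  assumes p: "prime_elem p" and F: "harmonic_cochain F" "level (p * m) F" "translation_invariant p F"
  shows "\<exists>g\<in>harmonic_cochains m. \<forall>e\<in>edges. F e = slash g (B_mat p) e"
proof -
  have p0: "p \<noteq> 0" using p by auto
  let ?B = "mat2 (inverse (emb p)) 0 0 1"
  have B: "?B \<in> GL2" using p0 by (simp add: GL2_iff det_mat2)
  have "level m (slash F ?B)"
  proof (rule levelI)
    fix a b c d e assume *: "a * d - b * c dvd 1" "m dvd c" "(e :: ('k fls^2^2) set) \<in> edges"
    have "?B ** mat2 (emb a) (emb b) (emb c) (emb d) = conj_mat p (mat2 a b c d) ** ?B"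
      using p0 by (simp add: conj_mat_mat2 mat2_mult mat2_eq_iff emb_mult field_simps)
    then have "slash F ?B (act (mat2 (emb a) (emb b) (emb c) (emb d)) e) =
        F (act (conj_mat p (mat2 a b c d)) (act ?B e))"
      by (simp only: slash_def act_act)
    also have "\<dots> = F (act ?B e)"
      using * act_in_edges[OF B] by (intro translation_invariant_conj_mat[OF p F(2,3)]) (simp_all add: Gamma0_mat2)
    finally show "slash F ?B (act (mat2 (emb a) (emb b) (emb c) (emb d)) e) = slash F ?B e"
      by (simp only: slash_def)
  qed
  then have "slash F ?B \<in> harmonic_cochains m"
    using harmonic_slash[OF F(1) B] by (simp add: harmonic_cochains_iff)
  moreover have "?B ** B_mat p = mat 1"
    using p0 by (simp add: B_mat_def mat2_mult mat_eq_mat2)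
  then have "slash (slash F ?B) (B_mat p) e = F e" for e
    by (simp only: slash_def act_act act_one)
  ultimately show ?thesis by (intro bexI[of _ "slash F ?B"]) simp_all
qed

text \<open>\<open>\<gamma>\<close> and \<open>\<delta>\<close> define the same point of the projective line over \<open>A/p\<close>.\<close>

definition same_point :: "'k::field poly \<Rightarrow> 'k poly^2^2 \<Rightarrow> 'k poly^2^2 \<Rightarrow> bool" where
  "same_point p \<gamma> \<delta> \<longleftrightarrow> p dvd \<gamma> $ 1 $ 1 * \<delta> $ 1 $ 2 - \<gamma> $ 1 $ 2 * \<delta> $ 1 $ 1"

text \<open>The first row \<open>(a, b)\<close> of \<open>\<gamma>\<close> is nonzero modulo
  \<open>p\<close>, since the determinant is a unit. Both \<open>a\<close> and \<open>b\<close>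
  times the minor of the rows of \<open>\<delta>\<close> and \<open>\<epsilon>\<close> are
  combinations of the given minors.\<close>

lemma same_point_euclid:
  assumes p: "prime_elem p" and "\<gamma> \<in> Gamma0 m" "same_point p \<gamma> \<delta>" "same_point p \<gamma> \<epsilon>"
  shows "same_point p \<delta> \<epsilon>"
proof -
  obtain a b c d where g: "\<gamma> = mat2 a b c d" by (rule mat2_cases)
  let ?x = "\<delta> $ 1 $ 1" and ?y = "\<delta> $ 1 $ 2" and ?z = "\<epsilon> $ 1 $ 1" and ?w = "\<epsilon> $ 1 $ 2"
  let ?M = "?x * ?w - ?y * ?z"
  have 1: "p dvd a * ?y - b * ?x" and 2: "p dvd a * ?w - b * ?z" and det: "a * d - b * c dvd 1"
    using assms(2-4) by (simp_all add: g same_point_def Gamma0_mat2)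
  have "a * ?M = ?x * (a * ?w - b * ?z) - ?z * (a * ?y - b * ?x)" by (simp add: algebra_simps)
  then have aM: "p dvd a * ?M" using 1 2 by (metis dvd_diff dvd_mult)
  have "b * ?M = ?y * (a * ?w - b * ?z) - ?w * (a * ?y - b * ?x)" by (simp add: algebra_simps)
  then have bM: "p dvd b * ?M" using 1 2 by (metis dvd_diff dvd_mult)
  have "\<not> (p dvd a \<and> p dvd b)"
  proof
    assume "p dvd a \<and> p dvd b"
    then have "p dvd a * d - b * c" by (intro dvd_diff) auto
    then have "p dvd 1" using det by (rule dvd_trans)
    then show False using p by (simp add: prime_elem_def)
  qed
  then show ?thesis unfolding same_point_def using aM bM p by (auto simp: prime_elem_dvd_mult_iff)
qed

text \<open>Right multiplication by \<open>\<delta>\<close> multiplies the minor by the determinant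
  of \<open>\<delta>\<close>, a unit.\<close>

lemma same_point_mult:
  assumes "\<delta> \<in> Gamma0 m" "same_point p (\<gamma> ** \<delta>) (\<gamma>' ** \<delta>)"
  shows "same_point p \<gamma> \<gamma>'"
proof -
  obtain a b c d where d: "\<delta> = mat2 a b c d" by (rule mat2_cases)
  obtain x y z w where g: "\<gamma> = mat2 x y z w" by (rule mat2_cases)
  obtain x' y' z' w' where g': "\<gamma>' = mat2 x' y' z' w'" by (rule mat2_cases)
  have unit: "a * d - b * c dvd 1" using assms(1) by (simp add: d Gamma0_mat2)
  have "p dvd (x * y' - y * x') * (a * d - b * c)"
    using assms(2) by (simp add: d g g' same_point_def mat2_mult algebra_simps)
  then have "p dvd x * y' - y * x'" using unit by (simp add: dvd_mult_unit_iff)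
  then show ?thesis by (simp add: g g' same_point_def)
qed

text \<open>Equality of points makes the upper right entry of \<open>\<gamma> \<delta>^-1\<close>
  divisible by \<open>p\<close>, so the conjugate of this matrix is integral and lies in
  \<open>Gamma0 (p * m)\<close>.\<close>

lemma same_point_eq:
  assumes p0: "p \<noteq> 0" and F: "level (p * m) F"
    and g: "\<gamma> \<in> Gamma0 m" "\<delta> \<in> Gamma0 m" "same_point p \<gamma> \<delta>" and e: "e \<in> edges"
  shows "F (act (conj_mat p \<gamma>) e) = F (act (conj_mat p \<delta>) e)"
proof -
  obtain a b c d where d: "\<delta> = mat2 a b c d" by (rule mat2_cases)
  obtain x y z w where gm: "\<gamma> = mat2 x y z w" by (rule mat2_cases)
  have unit: "a * d - b * c dvd 1" "x * w - y * z dvd 1" and m: "m dvd c" "m dvd z"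
    using g by (simp_all add: d gm Gamma0_mat2)
  from unit(1) obtain r where r: "1 = (a * d - b * c) * r" by (rule dvdE)
  have "p dvd - (x * b - y * a)" using g(3) by (simp only: gm d same_point_def mat2_nth dvd_minus_iff)
  then obtain s where s: "- (x * b - y * a) = p * s" by (rule dvdE)
  \<comment> \<open>The entries of \<open>\<gamma> \<delta>^-1\<close>, with \<open>r\<close> the
    inverse determinant of \<open>\<delta>\<close> and the upper right entry written as
    \<open>p * ?B\<close>.\<close>
  let ?A = "r * (x * d - y * c)" and ?B = "r * s" and ?C = "r * (z * d - w * c)" and ?D = "r * (w * a - z * b)"
  let ?\<sigma> = "mat2 ?A (p * ?B) ?C ?D"
  have "?\<sigma> ** \<delta> = mat2 (x * ((a * d - b * c) * r)) (y * ((a * d - b * c) * r))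
      (z * ((a * d - b * c) * r)) (w * ((a * d - b * c) * r))"
  proof -
    have "p * ?B = r * (y * a - x * b)" using s by (simp add: algebra_simps)
    then show ?thesis by (simp only: d mat2_mult mat2_eq_iff) (simp add: algebra_simps)
  qed
  also have "\<dots> = \<gamma>" unfolding r[symmetric] gm by simp
  finally have sg: "\<gamma> = ?\<sigma> ** \<delta>" by (rule sym)
  have "r dvd 1" using dvdI[OF r[unfolded mult.commute[of _ r]]] .
  have "?A * ?D - p * ?B * ?C = r * r * ((a * d - b * c) * (x * w - y * z))"
  proof -
    have "p * ?B = r * (y * a - x * b)" using s by (simp add: algebra_simps)
    then show ?thesis by (simp only:) (simp add: algebra_simps)
  qed
  moreover have "r * r * ((a * d - b * c) * (x * w - y * z)) dvd 1"
    using \<open>r dvd 1\<close> unit by (simp add: is_unit_mult_iff)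
  ultimately have "?A * ?D - p * ?B * ?C dvd 1" by (simp only:)
  then have det: "?A * ?D - ?B * (p * ?C) dvd 1" by (simp only: mult_ac)
  have "m dvd z * d - w * c" using m by (intro dvd_diff) auto
  then have mC: "p * m dvd p * ?C" by (intro mult_dvd_mono dvd_refl dvd_mult)
  have "conj_mat p ?\<sigma> = mat2 (emb ?A) (emb ?B) (emb (p * ?C)) (emb ?D)"
    using p0 by (simp add: conj_mat_mat2 emb_mult)
  then have "F (act (conj_mat p \<gamma>) e) =
      F (act (mat2 (emb ?A) (emb ?B) (emb (p * ?C)) (emb ?D)) (act (conj_mat p \<delta>) e))"
    by (simp only: sg conj_mat_mult[OF p0] act_act)
  also have "\<dots> = F (act (conj_mat p \<delta>) e)"
    by (rule levelD[OF F det mC act_in_edges[OF conj_mat_GL2[OF p0 g(2)] e]])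
  finally show ?thesis .
qed

section \<open>The trace over the projective line\<close>

text \<open>Right multiplication by \<open>\<delta>\<close> permutes the points. The map
  \<open>\<pi>\<close> sends a representative to the one of its translated point and is injective,
  hence a permutation of the finite set \<open>Rps\<close>.\<close>

lemma sum_over_points:
  fixes Rps :: "('k::field poly^2^2) set"
  assumes p: "prime_elem p" and fin: "finite Rps" and sub: "Rps \<subseteq> Gamma0 m"
    and cover: "\<And>\<gamma>. \<gamma> \<in> Gamma0 m \<Longrightarrow> \<exists>\<rho>\<in>Rps. same_point p \<rho> \<gamma>"
    and sep: "\<And>\<rho> \<rho>'. \<rho> \<in> Rps \<Longrightarrow> \<rho>' \<in> Rps \<Longrightarrow> same_point p \<rho> \<rho>' \<Longrightarrow> \<rho> = \<rho>'"
    and \<Psi>: "\<And>\<gamma> \<delta>. \<gamma> \<in> Gamma0 m \<Longrightarrow> \<delta> \<in> Gamma0 m \<Longrightarrow> same_point p \<gamma> \<delta> \<Longrightarrow> \<Psi> \<gamma> = \<Psi> \<delta>"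
    and \<delta>: "\<delta> \<in> Gamma0 m"
  shows "(\<Sum>\<rho>\<in>Rps. \<Psi> (\<rho> ** \<delta>)) = (\<Sum>\<rho>\<in>Rps. \<Psi> \<rho>)"
proof -
  have "\<exists>\<rho>'. \<rho>' \<in> Rps \<and> same_point p \<rho>' (\<rho> ** \<delta>)" if "\<rho> \<in> Rps" for \<rho>
    using cover[OF Gamma0_mult[OF subsetD[OF sub that] \<delta>]] by (auto simp only: Bex_def)
  then obtain \<pi> where *: "\<forall>\<rho>\<in>Rps. \<pi> \<rho> \<in> Rps \<and> same_point p (\<pi> \<rho>) (\<rho> ** \<delta>)"
    using bchoice[of Rps "\<lambda>\<rho> \<rho>'. \<rho>' \<in> Rps \<and> same_point p \<rho>' (\<rho> ** \<delta>)"] by auto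
  have \<pi>: "\<pi> \<rho> \<in> Rps" "same_point p (\<pi> \<rho>) (\<rho> ** \<delta>)" if "\<rho> \<in> Rps" for \<rho>
    using * that by auto
  have inj: "inj_on \<pi> Rps"
  proof (rule inj_onI)
    fix \<rho> \<rho>' assume *: "\<rho> \<in> Rps" "\<rho>' \<in> Rps" "\<pi> \<rho> = \<pi> \<rho>'"
    have "same_point p (\<rho> ** \<delta>) (\<rho>' ** \<delta>)"
      by (rule same_point_euclid[OF p subsetD[OF sub \<pi>(1)[OF *(1)]] \<pi>(2)[OF *(1)]
            \<pi>(2)[OF *(2), folded *(3)]])
    then show "\<rho> = \<rho>'" by (rule sep[OF *(1,2) same_point_mult[OF \<delta>]])
  qed
  have "\<pi> ` Rps \<subseteq> Rps" using \<pi>(1) by (rule image_subsetI)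
  from endo_inj_surj[OF fin this inj] have "(\<Sum>\<rho>\<in>Rps. \<Psi> \<rho>) = (\<Sum>\<rho>\<in>\<pi> ` Rps. \<Psi> \<rho>)"
    by (rule arg_cong[OF sym])
  also have "\<dots> = (\<Sum>\<rho>\<in>Rps. \<Psi> (\<pi> \<rho>))"
    unfolding sum.reindex[OF inj] o_def ..
  also have "\<dots> = (\<Sum>\<rho>\<in>Rps. \<Psi> (\<rho> ** \<delta>))"
  proof (rule sum.cong[OF refl])
    fix \<rho> assume "\<rho> \<in> Rps"
    then show "\<Psi> (\<pi> \<rho>) = \<Psi> (\<rho> ** \<delta>)"
      by (intro \<Psi>[OF _ Gamma0_mult[OF _ \<delta>]] subsetD[OF sub] \<pi>)
  qed
  finally show ?thesis by (rule sym)
qed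

text \<open>This is \<open>T_i F\<close>, provided that \<open>\<omega>\<close> represents the point
  at infinity.\<close>

definition point_trace ::
    "'k::{field,finite} poly \<Rightarrow> 'k poly^2^2 \<Rightarrow> (('k fls^2^2) set \<Rightarrow> 'r::comm_ring_1) \<Rightarrow> ('k fls^2^2) set \<Rightarrow> 'r" where
  "point_trace p \<omega> F e = avg p F e + F (act (conj_mat p \<omega>) e)"

text \<open>The affine points of the projective line are represented by unipotent matrices, the point at
  infinity by \<open>\<omega>\<close>.\<close>

lemma point_trace_invariant:
  fixes F :: "('k::{field,finite} fls^2^2) set \<Rightarrow> 'r::comm_ring_1" and \<omega> \<delta> :: "'k poly^2^2"
  assumes p: "prime_elem p" and F: "level (p * m) F"
    and \<omega>: "\<omega> \<in> Gamma0 m" "p dvd \<omega> $ 1 $ 1" and \<delta>: "\<delta> \<in> Gamma0 m" and e: "e \<in> edges"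
  shows "point_trace p \<omega> F (act (conj_mat p \<delta>) e) = point_trace p \<omega> F e"
proof -
  have p0: "p \<noteq> 0" using p by auto
  let ?S = "polys_below (degree p) :: 'k poly set"
  let ?N = "\<lambda>a. mat2 1 a 0 1 :: 'k poly^2^2"
  let ?R = "insert \<omega> (?N ` ?S)"
  obtain x y z w where om: "\<omega> = mat2 x y z w" by (rule mat2_cases)
  have x: "p dvd x" and det: "x * w - y * z dvd 1" using \<omega> by (simp_all add: om Gamma0_mat2)
  have y: "\<not> p dvd y"
  proof
    assume "p dvd y"
    then have "p dvd x * w - y * z" using x by (intro dvd_diff) auto
    then have "p dvd 1" using det by (rule dvd_trans)
    then show False using p by (simp add: prime_elem_def)
  qed
  have N: "?N a \<in> Gamma0 m" for a by (simp add: Gamma0_mat2)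
  \<comment> \<open>The first entry of \<open>\<omega>\<close> vanishes modulo \<open>p\<close> and
    the second does not, so its point differs from every affine point \<open>(1, a)\<close>.\<close>
  have apart: "\<not> same_point p \<omega> (?N a)" "\<not> same_point p (?N a) \<omega>" for a
  proof -
    have "p dvd x * a" using x by simp
    then show "\<not> same_point p \<omega> (?N a)" "\<not> same_point p (?N a) \<omega>"
      using y by (simp_all add: om same_point_def dvd_diff_right_iff dvd_diff_left_iff mult.commute)
  qed
  have self: "same_point p \<gamma> \<gamma>" for \<gamma> by (simp add: same_point_def mult.commute)
  have new: "\<omega> \<notin> ?N ` ?S" using apart(1) self by auto
  have inj: "inj_on ?N ?S" by (auto simp: inj_on_def mat2_eq_iff)
  have expand: "point_trace p \<omega> F e' = (\<Sum>\<rho>\<in>?R. F (act (conj_mat p \<rho>) e'))" for e'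
  proof -
    have "(\<Sum>\<rho>\<in>?R. F (act (conj_mat p \<rho>) e')) =
        F (act (conj_mat p \<omega>) e') + (\<Sum>a\<in>?S. F (act (conj_mat p (?N a)) e'))"
      unfolding sum.insert[OF finite_imageI[OF finite_polys_below] new] sum.reindex[OF inj] o_def ..
    then show ?thesis
      by (simp only: point_trace_def avg_def conj_mat_unip add.commute)
  qed
  have "(\<Sum>\<rho>\<in>?R. F (act (conj_mat p (\<rho> ** \<delta>)) e)) = (\<Sum>\<rho>\<in>?R. F (act (conj_mat p \<rho>) e))"
  proof (rule sum_over_points[OF p _ _ _ _ _ \<delta>])
    show "finite ?R" by (simp add: finite_polys_below)
    show "?R \<subseteq> Gamma0 m" using N \<omega>(1) by auto
    show "\<exists>\<rho>\<in>?R. same_point p \<rho> \<gamma>" for \<gamma>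
    proof (cases "p dvd \<gamma> $ 1 $ 1")
      case True
      then have "same_point p \<omega> \<gamma>" unfolding same_point_def om using x by (intro dvd_diff) auto
      then show ?thesis by blast
    next
      case False
      obtain t where "t \<in> ?S" "p dvd \<gamma> $ 1 $ 2 - \<gamma> $ 1 $ 1 * t" using prime_poly_solve[OF p False] by blast
      then have "?N t \<in> ?R" "same_point p (?N t) \<gamma>" by (simp_all add: same_point_def mult.commute)
      then show ?thesis by blast
    qed
    show "\<rho> = \<rho>'" if "\<rho> \<in> ?R" "\<rho>' \<in> ?R" "same_point p \<rho> \<rho>'" for \<rho> \<rho>'
    proof -
      have "a = b" if "a \<in> ?S" "b \<in> ?S" "same_point p (?N a) (?N b)" for a b
        using polys_below_dvd_eq[OF that(2,1)] that(3) by (simp add: same_point_def)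
      then show ?thesis using that apart by auto
    qed
    show "F (act (conj_mat p \<gamma>) e) = F (act (conj_mat p \<gamma>') e)"
      if "\<gamma> \<in> Gamma0 m" "\<gamma>' \<in> Gamma0 m" "same_point p \<gamma> \<gamma>'" for \<gamma> \<gamma>'
      by (rule same_point_eq[OF p0 F that e])
  qed
  then show ?thesis unfolding expand conj_mat_mult[OF p0] act_act .
qed

text \<open>The conjugated group contains both the embedded \<open>Gamma0 (p * m)\<close> and the
  translations with denominator \<open>p\<close>.\<close>

lemma conj_mat_level:
  fixes p m :: "'k::field poly" and T :: "('k fls^2^2) set \<Rightarrow> 'r"
  assumes p: "p \<noteq> 0" and inv: "\<And>\<delta> e. \<delta> \<in> Gamma0 m \<Longrightarrow> e \<in> edges \<Longrightarrow> T (act (conj_mat p \<delta>) e) = T e"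
  shows "level (p * m) T" and "translation_invariant p T"
proof -
  show "level (p * m) T"
  proof (rule levelI)
    fix a b c d e assume *: "a * d - b * c dvd 1" "p * m dvd c" "(e :: ('k fls^2^2) set) \<in> edges"
    from *(2) obtain s where s: "c = p * m * s" by (rule dvdE)
    have "mat2 a (p * b) (m * s) d \<in> Gamma0 m"
      using *(1) by (simp add: Gamma0_mat2 s mult_ac)
    moreover have "conj_mat p (mat2 a (p * b) (m * s) d) = mat2 (emb a) (emb b) (emb c) (emb d)"
      using p by (simp add: conj_mat_mat2 emb_mult s mult_ac)
    ultimately show "T (act (mat2 (emb a) (emb b) (emb c) (emb d)) e) = T e"
      using inv[OF _ *(3), of "mat2 a (p * b) (m * s) d"] by simp
  qed
  show "translation_invariant p T"
    unfolding translation_invariant_def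
  proof (intro allI ballI)
    fix a and e :: "('k fls^2^2) set" assume "e \<in> edges"
    then show "T (act (unip (emb a / emb p)) e) = T e"
      using inv[of "mat2 1 a 0 1" e] by (simp add: conj_mat_unip Gamma0_mat2)
  qed
qed

text \<open>The matrix is a product of an upper and a lower unipotent matrix, so it has determinant
  1. Its point is infinity once \<open>x\<close> is inverse to \<open>- c\<close> modulo
  \<open>p\<close>.\<close>

lemma infinity_exists:
  fixes p :: "'k::{field,finite} poly"
  assumes p: "prime_elem p" and c: "\<not> p dvd c" "m dvd c"
  obtains x where "p dvd 1 + x * c" "mat2 (1 + x * c) x c 1 \<in> Gamma0 m"
proof -
  obtain x where "p dvd - 1 - c * x" using prime_poly_solve[OF p c(1), of "- 1"] by blast
  then have "p dvd - (1 + x * c)" by (simp add: algebra_simps)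
  then have "p dvd 1 + x * c" by (simp only: dvd_minus_iff)
  then show thesis using that c(2) by (simp add: Gamma0_mat2)
qed

text \<open>Elements of \<open>Gamma0 (p * m * p)\<close> fix both the point 0 and the point at
  infinity. The affine average is the invariant trace minus the term at infinity, so it is invariant
  too.\<close>

lemma level_defect:
  fixes F :: "('k::{field,finite} fls^2^2) set \<Rightarrow> 'r::comm_ring_1"
  assumes p: "prime_elem p" and m: "\<not> p dvd m" and F: "level (p * m) F"
  shows "level (p * m * p) (defect p F)"
proof -
  have p0: "p \<noteq> 0" using p by auto
  obtain x where x: "p dvd 1 + x * m" and \<omega>: "mat2 (1 + x * m) x m 1 \<in> Gamma0 m"
    using infinity_exists[OF p m dvd_refl] by blast
  let ?\<omega> = "mat2 (1 + x * m) x m 1"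
  show ?thesis
  proof (rule levelI)
    fix a b c d e assume *: "a * d - b * c dvd 1" "p * m * p dvd c" "(e :: ('k fls^2^2) set) \<in> edges"
    from *(2) obtain s where s: "c = p * m * p * s" by (rule dvdE)
    \<comment> \<open>Its off-diagonal entries are divisible by \<open>p\<close>, which is why it
      fixes both points.\<close>
    let ?\<delta> = "mat2 a (p * b) (m * p * s) d"
    let ?\<gamma> = "mat2 (emb a) (emb b) (emb c) (emb d)"
    have \<delta>: "?\<delta> \<in> Gamma0 m" using *(1) by (simp add: Gamma0_mat2 s mult_ac)
    have conj: "conj_mat p ?\<delta> = ?\<gamma>"
      using p0 by (simp add: conj_mat_mat2 emb_mult s mult_ac)
    have tr: "point_trace p ?\<omega> F (act ?\<gamma> e) = point_trace p ?\<omega> F e"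
      using point_trace_invariant[OF p F \<omega> _ \<delta> *(3)] x by (simp add: conj)
    have "(?\<omega> ** ?\<delta>) $ 1 $ 1 = (1 + x * m) * a + p * (x * (m * s))"
      by (simp add: mat2_mult algebra_simps)
    then have "p dvd (?\<omega> ** ?\<delta>) $ 1 $ 1" using x by simp
    then have "same_point p (?\<omega> ** ?\<delta>) ?\<omega>"
      using x unfolding same_point_def by (intro dvd_diff) auto
    then have "F (act (conj_mat p (?\<omega> ** ?\<delta>)) e) = F (act (conj_mat p ?\<omega>) e)"
      by (intro same_point_eq[OF p0 F Gamma0_mult[OF \<omega> \<delta>] \<omega> _ *(3)])
    then have om: "F (act (conj_mat p ?\<omega>) (act ?\<gamma> e)) = F (act (conj_mat p ?\<omega>) e)"
      by (simp only: conj_mat_mult[OF p0] conj act_act)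
    have "avg p F (act ?\<gamma> e) = avg p F e"
      using tr om by (simp add: point_trace_def)
    moreover have "F (act ?\<gamma> e) = F e"
      using *(2) by (intro levelD[OF F *(1) _ *(3)]) (rule dvd_mult_left)
    ultimately show "defect p F (act ?\<gamma> e) = defect p F e"
      by (simp add: defect_def)
  qed
qed

text \<open>Translations fix infinity, so \<open>avg p F\<close>, the trace minus that term, is
  translation invariant. A vanishing defect identifies it with \<open>F\<close> times a
  unit.\<close>

lemma defect_zero_imp_translation_invariant:
  fixes F :: "('k::{field,finite} fls^2^2) set \<Rightarrow> 'r::comm_ring_1"
  assumes p: "prime_elem p" and m: "\<not> p dvd m" and F: "level (p * m) F"
    and zero: "\<And>e. e \<in> edges \<Longrightarrow> defect p F e = 0" and unit: "(of_nat (CARD('k) ^ degree p) :: 'r) dvd 1"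
  shows "translation_invariant p F"
  unfolding translation_invariant_def
proof (intro allI ballI)
  fix b and e :: "('k fls^2^2) set" assume e: "e \<in> edges"
  have p0: "p \<noteq> 0" using p by auto
  obtain x where x: "p dvd 1 + x * m" and \<omega>: "mat2 (1 + x * m) x m 1 \<in> Gamma0 m"
    using infinity_exists[OF p m dvd_refl] by blast
  let ?\<omega> = "mat2 (1 + x * m) x m 1" and ?\<delta> = "mat2 1 b 0 1 :: 'k poly^2^2"
  let ?\<gamma> = "unip (emb b / emb p)"
  have \<delta>: "?\<delta> \<in> Gamma0 m" by (simp add: Gamma0_mat2)
  have tr: "point_trace p ?\<omega> F (act ?\<gamma> e) = point_trace p ?\<omega> F e"
    using point_trace_invariant[OF p F \<omega> _ \<delta> e] x by (simp add: conj_mat_unip)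
  have "(?\<omega> ** ?\<delta>) $ 1 $ 1 = 1 + x * m" by (simp add: mat2_mult)
  then have "same_point p (?\<omega> ** ?\<delta>) ?\<omega>"
    using x unfolding same_point_def by (intro dvd_diff) auto
  then have "F (act (conj_mat p (?\<omega> ** ?\<delta>)) e) = F (act (conj_mat p ?\<omega>) e)"
    by (intro same_point_eq[OF p0 F Gamma0_mult[OF \<omega> \<delta>] \<omega> _ e])
  then have om: "F (act (conj_mat p ?\<omega>) (act ?\<gamma> e)) = F (act (conj_mat p ?\<omega>) e)"
    by (simp only: conj_mat_mult[OF p0] conj_mat_unip act_act)
  have "avg p F (act ?\<gamma> e) = avg p F e"
    using tr om by (simp add: point_trace_def)
  then have eq: "of_nat (CARD('k) ^ degree p) * F (act ?\<gamma> e) = of_nat (CARD('k) ^ degree p) * F e"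
    using zero[OF e] zero[OF act_in_edges[OF unip_GL2 e]] by (simp add: defect_def)
  from unit obtain r where r: "1 = (of_nat (CARD('k) ^ degree p) :: 'r) * r" by (rule dvdE)
  have "of_nat (CARD('k) ^ degree p) * r * F (act ?\<gamma> e) = r * (of_nat (CARD('k) ^ degree p) * F (act ?\<gamma> e))"
    by (simp only: mult_ac)
  also have "\<dots> = of_nat (CARD('k) ^ degree p) * r * F e"
    unfolding eq by (simp only: mult_ac)
  finally show "F (act ?\<gamma> e) = F e" unfolding r[symmetric] by simp
qed

text \<open>The combination of translates which turns \<open>defect p F\<close> into
  \<open>(q_i + 1) F - T_i F\<close>; separating it from \<open>F\<close> lets it be moved past the
  other defects.\<close>

definition twist ::
    "'k::field poly \<Rightarrow> 'k poly \<Rightarrow> 'k poly \<Rightarrow> (('k fls^2^2) set \<Rightarrow> 'r::comm_ring_1) \<Rightarrow> ('k fls^2^2) set \<Rightarrow> 'r" where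
  "twist p c x G e = G e - G (act (unip (emb x / emb p)) e) +
     G (act (lower_unip c) (act (unip (emb x / emb p)) e))"

text \<open>With \<open>q\<close> the number of remainders modulo \<open>p\<close>, the three terms
  of the twist are \<open>q [0] + [\<infinity>] - T\<close>,
  \<open>q [u] + [\<infinity>] - T\<close> and \<open>q [u] + [0] - T\<close>. Their alternating sum
  is \<open>(q + 1) [0] - T\<close>.\<close>

lemma twist_defect:
  fixes F :: "('k::{field,finite} fls^2^2) set \<Rightarrow> 'r::comm_ring_1"
  assumes p: "prime_elem p" and c: "\<not> p dvd c" "m dvd c"
    and F: "harmonic_cochain F" "level (p * m) F"
  obtains x T where "harmonic_cochain T" "level (p * m) T" "translation_invariant p T"
    "\<And>e. e \<in> edges \<Longrightarrow>
      twist p (p * c) x (defect p F) e = of_nat (CARD('k) ^ degree p + 1) * F e - T e"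
proof -
  have p0: "p \<noteq> 0" using p by auto
  obtain x where x: "p dvd 1 + x * c" and \<omega>: "mat2 (1 + x * c) x c 1 \<in> Gamma0 m"
    using infinity_exists[OF p c] by blast
  define \<omega> where om: "\<omega> = mat2 (1 + x * c) x c 1"
  define l :: "'k poly^2^2" where l: "l = mat2 1 0 c 1"
  define u :: "'k poly^2^2" where u: "u = mat2 1 x 0 1"
  have G: "\<omega> \<in> Gamma0 m" "l \<in> Gamma0 m" "u \<in> Gamma0 m" "(mat 1 :: 'k poly^2^2) \<in> Gamma0 m"
    using \<omega> c(2) by (simp_all add: om l u mat_eq_mat2 Gamma0_mat2)
  define T where "T = point_trace p \<omega> F"
  have inv: "T (act (conj_mat p \<delta>) e) = T e" if "\<delta> \<in> Gamma0 m" "e \<in> edges" for \<delta> e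
    unfolding T_def using x by (intro point_trace_invariant[OF p F(2) G(1) _ that]) (simp add: om)
  have "harmonic_cochain (\<lambda>e. (\<Sum>a\<in>polys_below (degree p). slash F (unip (emb a / emb p)) e) +
      slash F (conj_mat p \<omega>) e)"
    by (intro harmonic_add harmonic_sum harmonic_slash F(1) unip_GL2 conj_mat_GL2[OF p0 G(1)])
  then have harm: "harmonic_cochain T"
    unfolding T_def point_trace_def[abs_def] avg_def slash_def .
  have "twist p (p * c) x (defect p F) e = of_nat (CARD('k) ^ degree p + 1) * F e - T e"
    if e: "e \<in> edges" for e
  proof -
    define \<Psi> where "\<Psi> \<gamma> = F (act (conj_mat p \<gamma>) e)" for \<gamma>
    have avg: "avg p F (act (conj_mat p \<gamma>) e) = T e - \<Psi> (\<omega> ** \<gamma>)" if "\<gamma> \<in> Gamma0 m" for \<gamma>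
    proof -
      have "\<Psi> (\<omega> ** \<gamma>) = F (act (conj_mat p \<omega>) (act (conj_mat p \<gamma>) e))"
        by (simp only: \<Psi>_def conj_mat_mult[OF p0] act_act)
      then show ?thesis using inv[OF that e] by (simp add: T_def point_trace_def eq_diff_eq)
    qed
    have D: "defect p F (act (conj_mat p \<gamma>) e) =
        of_nat (CARD('k) ^ degree p) * \<Psi> \<gamma> - T e + \<Psi> (\<omega> ** \<gamma>)" if "\<gamma> \<in> Gamma0 m" for \<gamma>
      by (simp add: defect_def avg[OF that] \<Psi>_def)
    have same: "\<Psi> \<gamma> = \<Psi> \<delta>" if "\<gamma> \<in> Gamma0 m" "\<delta> \<in> Gamma0 m" "same_point p \<gamma> \<delta>" for \<gamma> \<delta>
      unfolding \<Psi>_def by (rule same_point_eq[OF p0 F(2) that e])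
    have lu: "l ** u \<in> Gamma0 m" by (intro Gamma0_mult G)
    have 1: "\<Psi> (\<omega> ** u) = \<Psi> \<omega>"
      using x by (intro same Gamma0_mult G) (auto simp: same_point_def om u mat2_mult intro!: dvd_diff)
    have 2: "\<Psi> (l ** u) = \<Psi> u"
      by (intro same lu G) (simp add: same_point_def l u mat2_mult)
    \<comment> \<open>The lower unipotent moves infinity to 0: the upper right entry of the product
      is a multiple of \<open>1 + x * c\<close>, hence of \<open>p\<close>.\<close>
    have 3: "\<Psi> (\<omega> ** (l ** u)) = \<Psi> (mat 1)"
    proof (intro same lu Gamma0_mult G)
      have "(\<omega> ** (l ** u)) $ 1 $ 2 = 2 * x * (1 + x * c)"
        by (simp add: om l u mat2_mult algebra_simps)
      then show "same_point p (\<omega> ** (l ** u)) (mat 1)"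
        unfolding same_point_def using x by (simp add: mat_eq_mat2)
    qed
    have a: "defect p F e = of_nat (CARD('k) ^ degree p) * \<Psi> (mat 1) - T e + \<Psi> \<omega>"
      using D[OF G(4)] by (simp add: conj_mat_1 act_one matrix_mul_rid)
    have b: "defect p F (act (unip (emb x / emb p)) e) =
        of_nat (CARD('k) ^ degree p) * \<Psi> u - T e + \<Psi> \<omega>"
      using D[OF G(3)] unfolding 1 unfolding u conj_mat_unip .
    have "act (lower_unip (p * c)) (act (unip (emb x / emb p)) e) = act (conj_mat p (l ** u)) e"
      by (simp only: conj_mat_mult[OF p0] l u conj_mat_unip conj_mat_lower act_act)
    then have c: "defect p F (act (lower_unip (p * c)) (act (unip (emb x / emb p)) e)) =
        of_nat (CARD('k) ^ degree p) * \<Psi> u - T e + \<Psi> (mat 1)"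
      using D[OF lu] by (simp only: 2 3)
    have "\<Psi> (mat 1) = F e" by (simp add: \<Psi>_def conj_mat_1 act_one)
    then show ?thesis unfolding twist_def a b c by (simp add: algebra_simps)
  qed
  then show thesis using that[OF harm conj_mat_level[OF p0 inv]] by blast
qed

section \<open>Decomposition\<close>

lemma defect_unip: "defect p (\<lambda>e. G (act (unip t) e)) e = defect p G (act (unip t) e)"
proof -
  have "act (unip t) (act (unip s) e) = act (unip s) (act (unip t) e)" for s
    by (simp add: act_act mat2_mult add.commute)
  then show ?thesis by (simp add: defect_def avg_def)
qed

text \<open>The commutator of \<open>lower_unip c\<close> and \<open>unip (b / p)\<close> lies in \<open>\<Gamma>\<^sub>0(M)\<close> as soon as
  \<open>p\<^sup>2\<close> divides \<open>c\<close> and \<open>M\<close> divides \<open>c\<^sup>2 / p\<close>.\<close>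

lemma level_commutator:
  assumes p: "p \<noteq> 0" and c: "p * p dvd c" "M * p dvd c * c" and G: "level M G" and e: "e \<in> edges"
  shows "G (act (lower_unip c) (act (unip (emb b / emb p)) e)) =
    G (act (unip (emb b / emb p)) (act (lower_unip c) e))"
proof -
  from c(1) obtain s where s: "c = p * p * s" by (rule dvdE)
  have "p * M dvd p * (p * s * c)" using c(2) by (simp add: s mult_ac)
  then have M: "M dvd p * s * c" using p by simp
  \<comment> \<open>The entries of \<open>l u l^-1 u^-1\<close> for \<open>l = lower_unip c\<close>
    and \<open>u\<close> the translation by \<open>b / p\<close>; writing
    \<open>c = p * p * s\<close> clears the denominators.\<close>
  let ?A = "1 - b * p * s" and ?B = "b * b * s" and ?C = "- (b * (p * s * c))"
    and ?D = "1 + b * p * s + b * p * s * (b * p * s)"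
  have det: "?A * ?D - ?B * ?C = 1" by (simp add: s algebra_simps)
  have "M dvd ?C" using M by (simp only: dvd_minus_iff dvd_mult)
  define t where "t = emb b / emb p"
  have b: "emb b = t * emb p" using p by (simp add: t_def)
  have "lower_unip c ** unip t =
      mat2 (emb ?A) (emb ?B) (emb ?C) (emb ?D) ** (unip t ** lower_unip c)"
    by (simp add: mat2_mult mat2_eq_iff emb_add emb_diff emb_uminus emb_mult s b algebra_simps)
  then have "G (act (lower_unip c) (act (unip t) e)) =
      G (act (mat2 (emb ?A) (emb ?B) (emb ?C) (emb ?D)) (act (unip t) (act (lower_unip c) e)))"
    by (simp only: act_act)
  also have "\<dots> = G (act (unip t) (act (lower_unip c) e))"
    by (rule levelD[OF G _ \<open>M dvd ?C\<close>]) (simp only: det dvd_refl, intro act_in_edges unip_GL2 lower_unip_GL2 e)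
  finally show ?thesis unfolding t_def .
qed

lemma defect_lower_unip:
  assumes "p \<noteq> 0" "p * p dvd c" "M * p dvd c * c" "level M G" "e \<in> edges"
  shows "defect p (\<lambda>e. G (act (lower_unip c) e)) e = defect p G (act (lower_unip c) e)"
  using level_commutator[OF assms] by (simp add: defect_def avg_def)

lemma defect_combination:
  "defect p (\<lambda>e. A e - B e + C e) e = defect p A e - defect p B e + defect p C e"
  by (simp add: defect_def avg_def sum.distrib sum_subtractf algebra_simps)

text \<open>Translations commute with one another, and the conditions on \<open>c\<close> allow the
  lower unipotent matrix to be exchanged with translations of denominator \<open>r\<close> up to the
  level of \<open>G\<close>.\<close>

lemma defect_twist:
  assumes "r \<noteq> 0" "r * r dvd c" "M * r dvd c * c" "level M G" "e \<in> edges"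
  shows "defect r (twist p c x G) e = twist p c x (defect r G) e"
proof -
  have "defect r (\<lambda>e. G (act (lower_unip c) (act (unip (emb x / emb p)) e))) e =
      defect r (\<lambda>e. G (act (lower_unip c) e)) (act (unip (emb x / emb p)) e)"
    by (rule defect_unip)
  also have "\<dots> = defect r G (act (lower_unip c) (act (unip (emb x / emb p)) e))"
    by (rule defect_lower_unip[OF assms(1-4) act_in_edges[OF unip_GL2 assms(5)]])
  finally show ?thesis
    unfolding twist_def[abs_def] defect_combination defect_unip by simp
qed

lemma twist_cong:
  assumes "\<And>e. e \<in> edges \<Longrightarrow> G e = G' e" "e \<in> edges"
  shows "twist p c x G e = twist p c x G' e"
  unfolding twist_def
  using assms act_in_edges[OF unip_GL2 assms(2)]
    act_in_edges[OF lower_unip_GL2 act_in_edges[OF unip_GL2 assms(2)]] by simp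

text \<open>By \<open>translation_invariant_descends\<close> such cochains come from level
  \<open>n div p\<close> when the prime \<open>p\<close> divides \<open>n\<close>. This form is
  visibly closed under linear combinations.\<close>

definition oldform :: "'k::field poly \<Rightarrow> 'k poly \<Rightarrow> (('k fls^2^2) set \<Rightarrow> 'r::comm_ring_1) \<Rightarrow> bool" where
  "oldform n p F \<longleftrightarrow> harmonic_cochain F \<and> level n F \<and> translation_invariant p F"

lemma oldform_add: "oldform n p F \<Longrightarrow> oldform n p G \<Longrightarrow> oldform n p (\<lambda>e. F e + G e)"
  by (auto simp: oldform_def level_def translation_invariant_def harmonic_add)

lemma oldform_scale: "oldform n p F \<Longrightarrow> oldform n p (\<lambda>e. c * F e)"
  by (auto simp: oldform_def level_def translation_invariant_def harmonic_scale)

text \<open>Here \<open>g\<close> is a twist of \<open>defect p2 f\<close> and \<open>h\<close> a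
  twist of \<open>defect p1 g\<close>. Moving the defects at \<open>p1\<close> and \<open>p3\<close>
  past the twists reduces \<open>defect p3 h\<close> to the vanishing triple defect, so
  \<open>h\<close> is translation invariant at \<open>p3\<close>.\<close>

lemma pair_decomposition:
  fixes f :: "('k::{field,finite} fls^2^2) set \<Rightarrow> 'r::comm_ring_1"
  assumes p: "prime_elem p1" "prime_elem p2" "prime_elem p3"
    and nd: "\<not> p1 dvd p2" "\<not> p1 dvd p3" "\<not> p2 dvd p1" "\<not> p2 dvd p3" "\<not> p3 dvd p1" "\<not> p3 dvd p2"
    and k: "\<not> p1 dvd k" "\<not> p2 dvd k" "\<not> p3 dvd k"
    and n: "n = p1 * p2 * p3 * k"
    and f: "harmonic_cochain f" "level n f"
    and zero: "\<And>e. e \<in> edges \<Longrightarrow> defect p3 (defect p1 (defect p2 f)) e = 0"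
    and unit: "(of_nat (CARD('k) ^ degree p3) :: 'r) dvd 1"
  shows "\<exists>F1 F2 F3. oldform n p1 F1 \<and> oldform n p2 F2 \<and> oldform n p3 F3 \<and>
    (\<forall>e\<in>edges. of_nat ((CARD('k) ^ degree p1 + 1) * (CARD('k) ^ degree p2 + 1)) * f e =
      F1 e + F2 e + F3 e)"
proof -
  define m1 m2 m3 where m: "m1 = p2 * p3 * k" "m2 = p1 * p3 * k" "m3 = p1 * p2 * k"
  have nm: "n = p1 * m1" "n = p2 * m2" "n = p3 * m3" by (simp_all add: n m mult_ac)
  have p0: "p1 \<noteq> 0" "p2 \<noteq> 0" "p3 \<noteq> 0" using p by auto
  have dm: "\<not> p1 dvd m1" "\<not> p2 dvd m2" "\<not> p3 dvd m3"
    using p nd k by (simp_all add: m prime_elem_dvd_mult_iff)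
  \<comment> \<open>The extra factors make each lower unipotent entry divisible by the squares of
    the other two primes, as \<open>defect_twist\<close> requires, and keep \<open>c1\<close> prime
    to \<open>p1\<close> and \<open>c2\<close> prime to \<open>p2\<close>.\<close>
  define c1 c2 where c: "c1 = m1 * (p2 * p3)" "c2 = m2 * (p1 * p3)"
  have dc: "\<not> p1 dvd c1" "\<not> p2 dvd c2"
    using p nd dm by (simp_all add: c prime_elem_dvd_mult_iff)
  have mc: "m1 dvd c1" "m2 dvd c2" by (simp_all add: c)
  \<comment> \<open>These are the norms plus one.\<close>
  let ?q1 = "of_nat (CARD('k) ^ degree p1 + 1) :: 'r" and ?q2 = "of_nat (CARD('k) ^ degree p2 + 1) :: 'r"
  obtain x2 T2 where T2: "harmonic_cochain T2" "level (p2 * m2) T2" "translation_invariant p2 T2"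
    and tw2: "\<And>e. e \<in> edges \<Longrightarrow> twist p2 (p2 * c2) x2 (defect p2 f) e = ?q2 * f e - T2 e"
    using twist_defect[OF p(2) dc(2) mc(2) f(1) f(2)[unfolded nm(2)]] by blast
  define g where "g = (\<lambda>e. ?q2 * f e - T2 e)"
  have g: "harmonic_cochain g" "level n g"
    unfolding g_def using f T2(1) T2(2)[folded nm(2)]
    by (auto simp: level_def intro!: harmonic_diff harmonic_scale)
  obtain x1 T1 where T1: "harmonic_cochain T1" "level (p1 * m1) T1" "translation_invariant p1 T1"
    and tw1: "\<And>e. e \<in> edges \<Longrightarrow> twist p1 (p1 * c1) x1 (defect p1 g) e = ?q1 * g e - T1 e"
    using twist_defect[OF p(1) dc(1) mc(1) g(1) g(2)[unfolded nm(1)]] by blast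
  define h where "h = (\<lambda>e. ?q1 * g e - T1 e)"
  have h: "harmonic_cochain h" "level n h"
    unfolding h_def using g T1(1) T1(2)[folded nm(1)]
    by (auto simp: level_def intro!: harmonic_diff harmonic_scale)
  have L2: "level (p2 * m2 * p2) (defect p2 f)"
    by (rule level_defect[OF p(2) dm(2) f(2)[unfolded nm(2)]])
  have d1g: "defect p1 g e = twist p2 (p2 * c2) x2 (defect p1 (defect p2 f)) e" if "e \<in> edges" for e
  proof -
    have "defect p1 g e = defect p1 (twist p2 (p2 * c2) x2 (defect p2 f)) e"
      by (rule defect_cong[OF _ that]) (simp only: tw2 g_def)
    also have "\<dots> = twist p2 (p2 * c2) x2 (defect p1 (defect p2 f)) e"
    proof (rule defect_twist[OF p0(1) _ _ L2 that])
      show "p1 * p1 dvd p2 * c2"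
        by (rule dvdI[of _ _ "p2 * p3 * k * p3"]) (simp add: c m mult_ac)
      show "p2 * m2 * p2 * p1 dvd p2 * c2 * (p2 * c2)"
        by (rule dvdI[of _ _ "p1 * p1 * p3 * p3 * p3 * k"]) (simp add: c m mult_ac)
    qed
    finally show ?thesis .
  qed
  \<comment> \<open>Each defect costs one more factor of its prime in the level; the next exchange
    has to be checked against this larger level.\<close>
  have L12: "level (p1 * (p2 * p2 * p3 * k) * p1) (defect p1 (defect p2 f))"
  proof (rule level_defect[OF p(1)])
    show "\<not> p1 dvd p2 * p2 * p3 * k" using p nd k by (simp add: prime_elem_dvd_mult_iff)
    have "p2 * m2 * p2 = p1 * (p2 * p2 * p3 * k)" by (simp add: m mult_ac)
    then show "level (p1 * (p2 * p2 * p3 * k)) (defect p2 f)" using L2 by (simp only:)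
  qed
  have d31g: "defect p3 (defect p1 g) e = 0" if "e \<in> edges" for e
  proof -
    have "defect p3 (defect p1 g) e = defect p3 (twist p2 (p2 * c2) x2 (defect p1 (defect p2 f))) e"
      by (rule defect_cong[OF d1g that])
    also have "\<dots> = twist p2 (p2 * c2) x2 (defect p3 (defect p1 (defect p2 f))) e"
    proof (rule defect_twist[OF p0(3) _ _ L12 that])
      show "p3 * p3 dvd p2 * c2"
        by (rule dvdI[of _ _ "p2 * p1 * p1 * k"]) (simp add: c m mult_ac)
      show "p1 * (p2 * p2 * p3 * k) * p1 * p3 dvd p2 * c2 * (p2 * c2)"
        by (rule dvdI[of _ _ "p1 * p1 * p3 * p3 * k"]) (simp add: c m mult_ac)
    qed
    also have "\<dots> = twist p2 (p2 * c2) x2 (\<lambda>_. 0) e"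
      by (rule twist_cong[OF zero that])
    finally show ?thesis by (simp add: twist_def)
  qed
  have L1: "level (p1 * m1 * p1) (defect p1 g)"
    by (rule level_defect[OF p(1) dm(1) g(2)[unfolded nm(1)]])
  have "defect p3 h e = 0" if "e \<in> edges" for e
  proof -
    have "defect p3 h e = defect p3 (twist p1 (p1 * c1) x1 (defect p1 g)) e"
      by (rule defect_cong[OF _ that]) (simp only: tw1 h_def)
    also have "\<dots> = twist p1 (p1 * c1) x1 (defect p3 (defect p1 g)) e"
    proof (rule defect_twist[OF p0(3) _ _ L1 that])
      show "p3 * p3 dvd p1 * c1"
        by (rule dvdI[of _ _ "p1 * p2 * p2 * k"]) (simp add: c m mult_ac)
      show "p1 * m1 * p1 * p3 dvd p1 * c1 * (p1 * c1)"
        by (rule dvdI[of _ _ "p2 * p2 * p2 * p3 * p3 * k"]) (simp add: c m mult_ac)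
    qed
    also have "\<dots> = twist p1 (p1 * c1) x1 (\<lambda>_. 0) e"
      by (rule twist_cong[OF d31g that])
    finally show ?thesis by (simp add: twist_def)
  qed
  then have "translation_invariant p3 h"
    by (rule defect_zero_imp_translation_invariant[OF p(3) dm(3) h(2)[unfolded nm(3)] _ unit])
  then have "oldform n p3 h" using h by (simp add: oldform_def)
  moreover have "oldform n p1 T1" using T1 by (simp add: oldform_def nm(1))
  moreover have "oldform n p2 (\<lambda>e. ?q1 * T2 e)"
    using T2 by (intro oldform_scale) (simp add: oldform_def nm(2))
  \<comment> \<open>Substituting \<open>g\<close> into \<open>h\<close> leaves \<open>h\<close>,
    \<open>T1\<close> and a multiple of \<open>T2\<close>, one term for each prime.\<close>
  moreover have "of_nat ((CARD('k) ^ degree p1 + 1) * (CARD('k) ^ degree p2 + 1)) * f e =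
      T1 e + ?q1 * T2 e + h e" for e
    unfolding of_nat_mult h_def g_def by (simp only: right_diff_distrib mult.assoc) simp
  ultimately show ?thesis by blast
qed

text \<open>The product of the Bezout relations for \<open>(a, b)\<close> and \<open>(a, c)\<close>
  has only one unmixed term, in \<open>a * a\<close>. The third factor, written as a combination of
  \<open>b\<close> and \<open>c\<close>, makes it mixed.\<close>

lemma gcd_products_combination:
  fixes a b c :: nat
  shows "\<exists>u v w :: int. int (gcd a b * gcd a c * gcd b c) = u * int (a * b) + v * int (a * c) + w * int (b * c)"
proof -
  obtain x y where xy: "x * int a + y * int b = int (gcd a b)"
    using bezout_int[of "int a" "int b"] by (auto simp: gcd_int_int_eq)
  obtain x' y' where xy': "x' * int a + y' * int c = int (gcd a c)"
    using bezout_int[of "int a" "int c"] by (auto simp: gcd_int_int_eq)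
  obtain x'' y'' where xy'': "x'' * int b + y'' * int c = int (gcd b c)"
    using bezout_int[of "int b" "int c"] by (auto simp: gcd_int_int_eq)
  let ?g = "int (gcd b c)"
  have "int (gcd a b * gcd a c * gcd b c) = (x * int a + y * int b) * (x' * int a + y' * int c) * ?g"
    by (simp only: of_nat_mult xy xy')
  also have "\<dots> = (x * x' * int a * int a) * (x'' * int b + y'' * int c) +
      (x * y' * ?g) * (int a * int c) + (y * x' * ?g) * (int a * int b) + (y * y' * ?g) * (int b * int c)"
    unfolding xy'' by (simp add: algebra_simps)
  also have "\<dots> = (x * x' * int a * x'' + y * x' * ?g) * int (a * b) +
      (x * x' * int a * y'' + x * y' * ?g) * int (a * c) + (y * y' * ?g) * int (b * c)"
    by (simp add: algebra_simps)
  finally show ?thesis by blast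
qed

lemma monic_prime_dvd_imp_eq:
  fixes p q :: "'k::field poly"
  assumes "monic p" "prime_elem p" "monic q" "prime_elem q" "p dvd q"
  shows "p = q"
proof -
  from assms(5) obtain s where s: "q = p * s" by (rule dvdE)
  have "irreducible q" using assms(4) by (rule prime_elem_imp_irreducible)
  then have "p dvd 1 \<or> s dvd 1" using s by (rule irreducibleD)
  moreover have "\<not> p dvd 1" using assms(2) by (simp add: prime_elem_def)
  ultimately obtain c where c: "s = [:c:]" by (auto simp: is_unit_poly_iff)
  have "lead_coeff q = lead_coeff p * lead_coeff s" unfolding s by (rule lead_coeff_mult)
  then have "c = 1" using assms(1,3) by (simp add: monic_def c)
  then show ?thesis by (simp add: s c)
qed

theorem theorem6p1:
  fixes n p1 p2 p3 :: "'k::{field, finite} poly"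
    and \<phi> :: "'d::idom \<Rightarrow> 'r::comm_ring_1"
    and \<eta>\<^sub>0 :: "'k \<Rightarrow> 'r"
    and f :: "('k fls^2^2) set \<Rightarrow> 'r"
  assumes n: "monic n"
    and p1: "monic p1" "prime_elem p1" "p1 dvd n" "coprime p1 (n div (p1 * p2 * p3))"
    and p2: "monic p2" "prime_elem p2" "p2 dvd n" "coprime p2 (n div (p1 * p2 * p3))"
    and p3: "monic p3" "prime_elem p3" "p3 dvd n" "coprime p3 (n div (p1 * p2 * p3))"
    and distinct: "p1 \<noteq> p2" "p1 \<noteq> p3" "p2 \<noteq> p3"
    and R: "coefficient_ring CHAR('k) \<phi>"
    and eta: "nontrivial_character \<eta>\<^sub>0"
    and f: "f \<in> harmonic_cochains n"
    and vanish: "\<And>m. monic m \<Longrightarrow> \<not> p1 dvd m \<Longrightarrow> \<not> p2 dvd m \<Longrightarrow> \<not> p3 dvd m \<Longrightarrow>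
      fourier_coeff \<eta>\<^sub>0 f m = 0"
  shows "\<exists>f1 \<in> harmonic_cochains (n div p1). \<exists>f2 \<in> harmonic_cochains (n div p2).
    \<exists>f3 \<in> harmonic_cochains (n div p3). \<forall>e\<in>edges.
      of_nat (gcd (ideal_norm p1 + 1) (ideal_norm p2 + 1) *
              gcd (ideal_norm p1 + 1) (ideal_norm p3 + 1) *
              gcd (ideal_norm p2 + 1) (ideal_norm p3 + 1)) * f e =
      slash f1 (B_mat p1) e + slash f2 (B_mat p2) e + slash f3 (B_mat p3) e"
proof -
  interpret coefficient_character \<phi> \<eta>\<^sub>0 by unfold_locales (fact R, fact eta)
  have p0: "p1 \<noteq> 0" "p2 \<noteq> 0" "p3 \<noteq> 0" using p1(2) p2(2) p3(2) by auto
  have nd: "\<not> p1 dvd p2" "\<not> p1 dvd p3" "\<not> p2 dvd p1" "\<not> p2 dvd p3" "\<not> p3 dvd p1" "\<not> p3 dvd p2"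
    using monic_prime_dvd_imp_eq p1(1,2) p2(1,2) p3(1,2) distinct by blast+
  obtain a where a: "n = p1 * a" using p1(3) by (rule dvdE)
  have "p2 dvd a" using p2(2,3) nd(3) by (simp add: a prime_elem_dvd_mult_iff)
  then obtain b where b: "a = p2 * b" by (rule dvdE)
  have "p3 dvd b" using p3(2,3) nd(5,6) by (simp add: a b prime_elem_dvd_mult_iff)
  then obtain k where "b = p3 * k" by (rule dvdE)
  then have nk: "n = p1 * p2 * p3 * k" by (simp add: a b mult.assoc)
  have "n div (p1 * p2 * p3) = k" unfolding nk using p0 by simp
  then have cop: "coprime p1 k" "coprime p2 k" "coprime p3 k" using p1(4) p2(4) p3(4) by simp_all
  have k: "\<not> p1 dvd k" "\<not> p2 dvd k" "\<not> p3 dvd k"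
    using coprime_common_divisor[OF cop(1) dvd_refl] coprime_common_divisor[OF cop(2) dvd_refl]
      coprime_common_divisor[OF cop(3) dvd_refl] p1(2) p2(2) p3(2)
    unfolding prime_elem_def by blast+
  have fl: "harmonic_cochain f" "level n f" using f by (simp_all add: harmonic_cochains_iff)
  let ?a = "CARD('k) ^ degree p1 + 1" and ?b = "CARD('k) ^ degree p2 + 1" and ?c = "CARD('k) ^ degree p3 + 1"
  note units = CARD_power_unit[OF R]
  have "\<exists>F1 F2 F3. oldform n p1 F1 \<and> oldform n p2 F2 \<and> oldform n p3 F3 \<and>
      (\<forall>e\<in>edges. of_nat (?a * ?b) * f e = F1 e + F2 e + F3 e)"
  proof (rule pair_decomposition[OF p1(2) p2(2) p3(2) nd k nk fl _ units])
    show "defect p3 (defect p1 (defect p2 f)) e = 0" if "e \<in> edges" for e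
      by (rule triple_defect_eq_0[OF f p0(3,1,2) vanish that])
  qed
  then obtain F1 F2 F3 where F: "oldform n p1 F1" "oldform n p2 F2" "oldform n p3 F3"
    "\<And>e. e \<in> edges \<Longrightarrow> of_nat (?a * ?b) * f e = F1 e + F2 e + F3 e" by auto
  \<comment> \<open>The defects may be taken in any order, since the vanishing hypothesis is
    symmetric in the three primes.\<close>
  have "\<exists>F1 F3 F2. oldform n p1 F1 \<and> oldform n p3 F3 \<and> oldform n p2 F2 \<and>
      (\<forall>e\<in>edges. of_nat (?a * ?c) * f e = F1 e + F3 e + F2 e)"
  proof (rule pair_decomposition[OF p1(2) p3(2) p2(2) nd(2,1,5,6,3,4) k(1,3,2) _ fl _ units])
    show "n = p1 * p3 * p2 * k" by (simp add: nk mult_ac)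
    show "defect p2 (defect p1 (defect p3 f)) e = 0" if "e \<in> edges" for e
      by (rule triple_defect_eq_0[OF f p0(2,1,3) vanish that])
  qed
  then obtain G1 G2 G3 where G: "oldform n p1 G1" "oldform n p2 G2" "oldform n p3 G3"
    "\<And>e. e \<in> edges \<Longrightarrow> of_nat (?a * ?c) * f e = G1 e + G3 e + G2 e" by auto
  have "\<exists>F2 F3 F1. oldform n p2 F2 \<and> oldform n p3 F3 \<and> oldform n p1 F1 \<and>
      (\<forall>e\<in>edges. of_nat (?b * ?c) * f e = F2 e + F3 e + F1 e)"
  proof (rule pair_decomposition[OF p2(2) p3(2) p1(2) nd(4,3,6,5,1,2) k(2,3,1) _ fl _ units])
    show "n = p2 * p3 * p1 * k" by (simp add: nk mult_ac)
    show "defect p1 (defect p2 (defect p3 f)) e = 0" if "e \<in> edges" for e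
      by (rule triple_defect_eq_0[OF f p0 vanish that])
  qed
  then obtain H1 H2 H3 where H: "oldform n p1 H1" "oldform n p2 H2" "oldform n p3 H3"
    "\<And>e. e \<in> edges \<Longrightarrow> of_nat (?b * ?c) * f e = H2 e + H3 e + H1 e" by auto
  obtain u v w where uvw: "int (gcd ?a ?b * gcd ?a ?c * gcd ?b ?c) =
      u * int (?a * ?b) + v * int (?a * ?c) + w * int (?b * ?c)"
    using gcd_products_combination by blast
  let ?s = "gcd ?a ?b * gcd ?a ?c * gcd ?b ?c"
  have s: "(of_nat ?s :: 'r) = of_int u * of_nat (?a * ?b) + of_int v * of_nat (?a * ?c) + of_int w * of_nat (?b * ?c)"
    using arg_cong[OF uvw, of "of_int :: int \<Rightarrow> 'r"]
    by (simp only: of_int_add of_int_mult of_int_of_nat_eq)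
  \<comment> \<open>The parts belonging to each prime are collected from the three decompositions
    with the Bezout weights.\<close>
  define E1 E2 E3 where E: "E1 = (\<lambda>e. of_int u * F1 e + of_int v * G1 e + of_int w * H1 e)"
    "E2 = (\<lambda>e. of_int u * F2 e + of_int v * G2 e + of_int w * H2 e)"
    "E3 = (\<lambda>e. of_int u * F3 e + of_int v * G3 e + of_int w * H3 e)"
  have old: "oldform n p1 E1" "oldform n p2 E2" "oldform n p3 E3"
    unfolding E by (intro oldform_add oldform_scale F G H)+
  have sum: "of_nat ?s * f e = E1 e + E2 e + E3 e" if e: "e \<in> edges" for e
  proof -
    have "of_nat ?s * f e = of_int u * (of_nat (?a * ?b) * f e) + of_int v * (of_nat (?a * ?c) * f e) +
        of_int w * (of_nat (?b * ?c) * f e)"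
      unfolding s by (simp only: distrib_right mult.assoc)
    also have "\<dots> = of_int u * (F1 e + F2 e + F3 e) + of_int v * (G1 e + G3 e + G2 e) +
        of_int w * (H2 e + H3 e + H1 e)"
      by (simp only: F(4)[OF e] G(4)[OF e] H(4)[OF e])
    also have "\<dots> = E1 e + E2 e + E3 e"
      unfolding E by (simp only: distrib_left add_ac)
    finally show ?thesis .
  qed
  have descend: "\<exists>g\<in>harmonic_cochains (n div p). \<forall>e\<in>edges. E e = slash g (B_mat p) e"
    if "prime_elem p" "p dvd n" "oldform n p E" for p and E :: "('k fls^2^2) set \<Rightarrow> 'r"
    using translation_invariant_descends[OF that(1), of E "n div p"] that(2,3)
    by (simp add: oldform_def)
  obtain f1 where f1: "f1 \<in> harmonic_cochains (n div p1)" "\<And>e. e \<in> edges \<Longrightarrow> E1 e = slash f1 (B_mat p1) e"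
    using descend[OF p1(2,3) old(1)] by blast
  obtain f2 where f2: "f2 \<in> harmonic_cochains (n div p2)" "\<And>e. e \<in> edges \<Longrightarrow> E2 e = slash f2 (B_mat p2) e"
    using descend[OF p2(2,3) old(2)] by blast
  obtain f3 where f3: "f3 \<in> harmonic_cochains (n div p3)" "\<And>e. e \<in> edges \<Longrightarrow> E3 e = slash f3 (B_mat p3) e"
    using descend[OF p3(2,3) old(3)] by blast
  have "\<forall>e\<in>edges. of_nat ?s * f e =
      slash f1 (B_mat p1) e + slash f2 (B_mat p2) e + slash f3 (B_mat p3) e"
  proof
    fix e :: "('k fls^2^2) set" assume e: "e \<in> edges"
    show "of_nat ?s * f e = slash f1 (B_mat p1) e + slash f2 (B_mat p2) e + slash f3 (B_mat p3) e"
      unfolding f1(2)[OF e, symmetric] f2(2)[OF e, symmetric] f3(2)[OF e, symmetric] by (rule sum[OF e])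
  qed
  then show ?thesis
    unfolding ideal_norm_eq[OF p0(1)] ideal_norm_eq[OF p0(2)] ideal_norm_eq[OF p0(3)]
    by (intro bexI[OF _ f1(1)] bexI[OF _ f2(1)] bexI[OF _ f3(1)])
qed

end
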